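(* Let $\Gamma$ be a group of finite type whose Euler characteristic satisfies $e(\Gamma)\neq 0$. Then $\Gamma$ is not an SEA group.
   Context: **Groups of finite type.** A finitely generated group $\Gamma$ is of finite type if there exists a finite (connected) simplicial complex $B\Gamma$ with fundamental group $\Gamma$ whose universal cover $E\Gamma$ is contractible. The homotopy type of $B\Gamma$ depends only on $\Gamma$. The Euler characteristic $e(\Gamma)$ is the integer defined as the usual topological Euler characteristic of $B\Gamma$. **Bernoulli shifts and linear subshifts.** Let $\Gamma$ be a countable group or semigroup and $S$ a finite abelian group. Let $\Sigma(\Gamma,S)$ be the set of all functions $\tau:\Gamma\to S$, with pointwise addition and the product topology ($S$ discrete). It is a compact metrizable abelian group. $\Gamma$ acts on the left by $\sigma_\gamma(\tau)(\gamma')=\tau(\gamma'\gamma)$. A linear subshift is a $\Gamma$-invariant closed subgroup of some $\Sigma(\Gamma,S)$. A map $T$ between linear subshifts is called $\Gamma$-invariant if it commutes with the $\Gamma$-actions, i.e. $T\circ\sigma_\gamma=\sigma_\gamma\circ T$ for all $\gamma\in\Gamma$. **SEA.** $\Gamma$ is called SEA (symbolically entropy additive) if the following axioms hold. (A1) There is a real-valued function $h$ (entropy) defined on all linear subshifts, i.e. on all linear subshifts $\phi\subset\Sigma(\Gamma,S)$ for all finite abelian groups $S$, which satisfies (A2)-(A6). (A2) $h(\Sigma(\Gamma,S))=\log_2|S|$ for every finite abelian group $S$. (A3) If $\phi_1\subset\phi_2$ are linear subshifts, then $0\le h(\phi_1)\le h(\phi_2)$. (A4) If $\phi_1\subset\Sigma(\Gamma,S_1)$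 and $\phi_2\subset\Sigma(\Gamma,S_2)$ are linear subshifts and $T:\phi_1\to\phi_2$ is a $\Gamma$-invariant homeomorphism, then $h(\phi_1)=h(\phi_2)$. (A5) If a linear subshift $\phi$ contains only finitely many elements, then $h(\phi)=0$. (A6) If $T:\phi_1\to\phi_2$ is a $\Gamma$-invariant surjective continuous group homomorphism between linear subshifts, then $h(\operatorname{Ker}T)+h(\phi_2)=h(\phi_1)$. *)

theory Defs
  imports "HOL-Analysis.Analysis" "HOL-Algebra.Product_Groups" "HOL-Algebra.Generated_Groups"
begin

section \<open>Finite simplicial complexes\<close>

definition finite_simplicial_complex :: "nat set set \<Rightarrow> bool" where
  "finite_simplicial_complex K \<longleftrightarrow>
     finite K \<and>
     (\<forall>s\<in>K. finite s \<and> s \<noteq> {}) \<and>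
     (\<forall>s\<in>K. \<forall>t. t \<subseteq> s \<and> t \<noteq> {} \<longrightarrow> t \<in> K)"

text \<open>Points of the realization are given by their barycentric coordinates.  The ambient space
  is the normed space of all bounded functions on the naturals with the supremum norm.\<close>

type_synonym linfty = "nat \<Rightarrow>\<^sub>C real"

definition realization :: "nat set set \<Rightarrow> linfty set" where
  "realization K =
     {x. (\<forall>v. 0 \<le> apply_bcontfun x v) \<and>
         {v. apply_bcontfun x v \<noteq> 0} \<in> K \<and>
         (\<Sum>v | apply_bcontfun x v \<noteq> 0. apply_bcontfun x v) = 1}"

definition complex_euler_characteristic :: "nat set set \<Rightarrow> int" where
  "complex_euler_characteristic K = (\<Sum>s\<in>K. (- 1) ^ (card s - 1))"


section \<open>Fundamental group and universal cover\<close>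

definition based_loops :: "'a::topological_space set \<Rightarrow> 'a \<Rightarrow> (real \<Rightarrow> 'a) set" where
  "based_loops X x = {p. path p \<and> path_image p \<subseteq> X \<and> pathstart p = x \<and> pathfinish p = x}"

definition fundamental_group ::
    "'a::topological_space set \<Rightarrow> 'a \<Rightarrow> (real \<Rightarrow> 'a) set monoid" where
  "fundamental_group X x =
     \<lparr>carrier = based_loops X x // {(p, q). homotopic_paths X p q},
      monoid.mult = (\<lambda>A B. {r. \<exists>p\<in>A. \<exists>q\<in>B. homotopic_paths X (p +++ q) r}),
      one = {r. homotopic_paths X (\<lambda>_. x) r}\<rparr>"

definition universal_cover ::
    "'a::topological_space set \<Rightarrow> ('a \<Rightarrow> 'b) \<Rightarrow> 'b::topological_space set \<Rightarrow> bool" where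
  "universal_cover E p X \<longleftrightarrow> covering_space E p X \<and> simply_connected E"


section \<open>Groups of finite type and their Euler characteristic\<close>

definition finitely_generated :: "('g, 'm) monoid_scheme \<Rightarrow> bool" where
  "finitely_generated \<Gamma> \<longleftrightarrow> (\<exists>A. finite A \<and> A \<subseteq> carrier \<Gamma> \<and> generate \<Gamma> A = carrier \<Gamma>)"

text \<open>Looking for the universal cover among the subsets of \<^typ>\<open>linfty\<close> is no restriction:
  the universal cover of a finite connected complex is a separable metrizable space, and every
  such space embeds into the bounded sequences.  As universal covers are unique up to
  homeomorphism, it does not matter which one is asked to be contractible.\<close>

definition classifying_complex :: "('g, 'm) monoid_scheme \<Rightarrow> nat set set \<Rightarrow> bool" where
  "classifying_complex \<Gamma> K \<longleftrightarrow>
     finite_simplicial_complex K \<and>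
     connected (realization K) \<and>
     (\<exists>x \<in> realization K. \<Gamma> \<cong> fundamental_group (realization K) x) \<and>
     (\<exists>(E :: linfty set) p. universal_cover E p (realization K) \<and> contractible E)"

definition finite_type :: "('g, 'm) monoid_scheme \<Rightarrow> bool" where
  "finite_type \<Gamma> \<longleftrightarrow> group \<Gamma> \<and> finitely_generated \<Gamma> \<and> (\<exists>K. classifying_complex \<Gamma> K)"

text \<open>The choice of the complex is immaterial, since any two classifying complexes of a group
  are homotopy equivalent.\<close>

definition euler_characteristic :: "('g, 'm) monoid_scheme \<Rightarrow> int" where
  "euler_characteristic \<Gamma> = complex_euler_characteristic (SOME K. classifying_complex \<Gamma> K)"


section \<open>Linear subshifts\<close>

definition full_shift ::
    "('g, 'm) monoid_scheme \<Rightarrow> ('s, 'n) monoid_scheme \<Rightarrow> ('g \<Rightarrow> 's) monoid" where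
  "full_shift \<Gamma> S = product_group (carrier \<Gamma>) (\<lambda>_. S)"

definition full_shift_topology ::
    "('g, 'm) monoid_scheme \<Rightarrow> ('s, 'n) monoid_scheme \<Rightarrow> ('g \<Rightarrow> 's) topology" where
  "full_shift_topology \<Gamma> S =
     product_topology (\<lambda>_. discrete_topology (carrier S)) (carrier \<Gamma>)"

definition shift :: "('g, 'm) monoid_scheme \<Rightarrow> 'g \<Rightarrow> ('g \<Rightarrow> 's) \<Rightarrow> ('g \<Rightarrow> 's)" where
  "shift \<Gamma> \<gamma> \<tau> = (\<lambda>\<gamma>'\<in>carrier \<Gamma>. \<tau> (\<gamma>' \<otimes>\<^bsub>\<Gamma>\<^esub> \<gamma>))"

definition finite_abelian_group :: "('s, 'n) monoid_scheme \<Rightarrow> bool" where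
  "finite_abelian_group S \<longleftrightarrow> comm_group S \<and> finite (carrier S)"

definition linear_subshift ::
    "('g, 'm) monoid_scheme \<Rightarrow> ('s, 'n) monoid_scheme \<Rightarrow> ('g \<Rightarrow> 's) set \<Rightarrow> bool" where
  "linear_subshift \<Gamma> S \<phi> \<longleftrightarrow>
     finite_abelian_group S \<and>
     subgroup \<phi> (full_shift \<Gamma> S) \<and>
     closedin (full_shift_topology \<Gamma> S) \<phi> \<and>
     (\<forall>\<gamma>\<in>carrier \<Gamma>. \<forall>\<tau>\<in>\<phi>. shift \<Gamma> \<gamma> \<tau> \<in> \<phi>)"

definition subshift_topology ::
    "('g, 'm) monoid_scheme \<Rightarrow> ('s, 'n) monoid_scheme \<Rightarrow> ('g \<Rightarrow> 's) set \<Rightarrow> ('g \<Rightarrow> 's) topology"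
  where "subshift_topology \<Gamma> S \<phi> = subtopology (full_shift_topology \<Gamma> S) \<phi>"

definition subshift_group ::
    "('g, 'm) monoid_scheme \<Rightarrow> ('s, 'n) monoid_scheme \<Rightarrow> ('g \<Rightarrow> 's) set \<Rightarrow> ('g \<Rightarrow> 's) monoid"
  where "subshift_group \<Gamma> S \<phi> = (full_shift \<Gamma> S)\<lparr>carrier := \<phi>\<rparr>"

definition shift_equivariant ::
    "('g, 'm) monoid_scheme \<Rightarrow> ('g \<Rightarrow> 's) set \<Rightarrow> (('g \<Rightarrow> 's) \<Rightarrow> ('g \<Rightarrow> 't)) \<Rightarrow> bool" where
  "shift_equivariant \<Gamma> \<phi> T \<longleftrightarrow>
     (\<forall>\<gamma>\<in>carrier \<Gamma>. \<forall>\<tau>\<in>\<phi>. T (shift \<Gamma> \<gamma> \<tau>) = shift \<Gamma> \<gamma> (T \<tau>))"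


section \<open>Symbolic entropy additivity\<close>

text \<open>The coefficient groups range over all finite abelian groups whose elements are natural
  numbers, which represent every isomorphism class of finite abelian groups.  An entropy takes
  the coefficient group as an argument, as a set of functions does not determine it.\<close>

definition entropy ::
    "('g, 'm) monoid_scheme \<Rightarrow> (nat monoid \<Rightarrow> ('g \<Rightarrow> nat) set \<Rightarrow> real) \<Rightarrow> bool" where
  "entropy \<Gamma> h \<longleftrightarrow>
     (\<forall>S. finite_abelian_group S \<longrightarrow>
        h S (carrier (full_shift \<Gamma> S)) = log 2 (card (carrier S))) \<and>
     (\<forall>S \<phi>\<^sub>1 \<phi>\<^sub>2. linear_subshift \<Gamma> S \<phi>\<^sub>1 \<and> linear_subshift \<Gamma> S \<phi>\<^sub>2 \<and> \<phi>\<^sub>1 \<subseteq> \<phi>\<^sub>2 \<longrightarrow>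
        0 \<le> h S \<phi>\<^sub>1 \<and> h S \<phi>\<^sub>1 \<le> h S \<phi>\<^sub>2) \<and>
     (\<forall>S\<^sub>1 S\<^sub>2 \<phi>\<^sub>1 \<phi>\<^sub>2 T. linear_subshift \<Gamma> S\<^sub>1 \<phi>\<^sub>1 \<and> linear_subshift \<Gamma> S\<^sub>2 \<phi>\<^sub>2 \<and>
        homeomorphic_map (subshift_topology \<Gamma> S\<^sub>1 \<phi>\<^sub>1) (subshift_topology \<Gamma> S\<^sub>2 \<phi>\<^sub>2) T \<and>
        shift_equivariant \<Gamma> \<phi>\<^sub>1 T \<longrightarrow>
        h S\<^sub>1 \<phi>\<^sub>1 = h S\<^sub>2 \<phi>\<^sub>2) \<and>
     (\<forall>S \<phi>. linear_subshift \<Gamma> S \<phi> \<and> finite \<phi> \<longrightarrow> h S \<phi> = 0) \<and>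
     (\<forall>S\<^sub>1 S\<^sub>2 \<phi>\<^sub>1 \<phi>\<^sub>2 T. linear_subshift \<Gamma> S\<^sub>1 \<phi>\<^sub>1 \<and> linear_subshift \<Gamma> S\<^sub>2 \<phi>\<^sub>2 \<and>
        T \<in> hom (subshift_group \<Gamma> S\<^sub>1 \<phi>\<^sub>1) (subshift_group \<Gamma> S\<^sub>2 \<phi>\<^sub>2) \<and>
        continuous_map (subshift_topology \<Gamma> S\<^sub>1 \<phi>\<^sub>1) (subshift_topology \<Gamma> S\<^sub>2 \<phi>\<^sub>2) T \<and>
        T ` \<phi>\<^sub>1 = \<phi>\<^sub>2 \<and>
        shift_equivariant \<Gamma> \<phi>\<^sub>1 T \<longrightarrow>
        h S\<^sub>1 (kernel (subshift_group \<Gamma> S\<^sub>1 \<phi>\<^sub>1) (subshift_group \<Gamma> S\<^sub>2 \<phi>\<^sub>2) T) + h S\<^sub>2 \<phi>\<^sub>2 = h S\<^sub>1 \<phi>\<^sub>1)"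

definition SEA :: "('g, 'm) monoid_scheme \<Rightarrow> bool" where
  "SEA \<Gamma> \<longleftrightarrow> (\<exists>h. entropy \<Gamma> h)"

end

theory Submission
  imports Defs "HOL-Library.Z2" "HOL-Homology.Simplices"
begin

text \<open>An entropy behaves like a dimension over the group: the full shift whose alphabet has 2^n elements
has entropy n, and entropy is additive in short exact sequences. Let K be a finite complex with fundamental
group \<Gamma> and contractible universal cover E, and triangulate E by the lifts of the simplices of K. The lifts
of a simplex form a free orbit of \<Gamma>, so the mod 2 cochains of degree k on E form a full shift
of entropy n_k, the number of k-simplices of K, and the coboundary maps are equivariant, continuous and linear.
Since E is contractible, this cochain complex is exact except in degree 0, where the cocycles are the two
constant functions, which form a finite subshift and have entropy 0. Additivity along the complex makes the
alternating sum of the n_k, which is the Euler characteristic, equal to 0. Only the parity of degrees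
matters here, so all cochains of even degree are collected in one shift and those of odd degree in
another one, with a coboundary map in each direction; the additivity argument is exact_pair_card_eq.

The topological part is to deduce the exactness of the simplicial cochain complex from contractibility,
through singular homology. It suffices to show that a cocycle u vanishes on every finite cycle Z of
lifted simplices; the rest is linear algebra over a field (cocycle_is_coboundary). As a singular chain, Z is a boundary
modulo 2, because E is contractible (contractible_mod2_cycle_is_boundary). Subdivide this
singular chain finely and label every point of E by a vertex whose star contains it, namely the one with
the largest barycentric coordinate. The corners of a small singular simplex have labels that span a lifted simplex
(small_label_set). So u can be evaluated on small singular chains, where it remains a cocycle, and it
vanishes on the subdivision of Z. But on each subdivided lifted simplex the labelling is a Sperner labelling,
so u takes there the same value as on the simplex itself (sperner). Hence u vanishes on Z.

The identification of cochains with configurations uses covering theory: the points of E over a vertex correspond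
to the elements of \<Gamma> by lifting paths (mark_bij), and moving inside a lifted simplex from one vertex to another
multiplies the element on the left by a constant (mark_transition). As shifts translate on the right, the coboundary
commutes with them.\<close>

section \<open>Cochains modulo 2\<close>

lemma bit_add_self [simp]: "x + x = (0::bit)"
  by (cases x) auto

text \<open>Over the field with two elements every additive map is linear and every additive group with
x + x = 0 is a vector space, so u factors through the restriction of d to V and, by a linear section
of d on its image, extends to the whole target. This extension of functionals is what turns a
statement about cycles into one about cochains.\<close>

lemma functional_factors_char2:
  fixes d :: "'b::ab_group_add \<Rightarrow> 'c::ab_group_add" and u :: "'b \<Rightarrow> bit"
  assumes char2: "\<And>x::'b. x + x = 0" "\<And>y::'c. y + y = 0"
    and d: "\<And>x y. d (x + y) = d x + d y"
    and u: "\<And>x y. u (x + y) = u x + u y"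
    and V: "0 \<in> V" "\<And>x y. x \<in> V \<Longrightarrow> y \<in> V \<Longrightarrow> x + y \<in> V"
    and ker: "\<And>x. x \<in> V \<Longrightarrow> d x = 0 \<Longrightarrow> u x = 0"
  obtains b :: "'c \<Rightarrow> bit"
  where "\<And>x y. b (x + y) = b x + b y" "\<And>x. x \<in> V \<Longrightarrow> b (d x) = u x"
proof -
  (* Scalar multiplication by the two elements of the field. *)
  define s1 :: "bit \<Rightarrow> 'b \<Rightarrow> 'b" where "s1 = (\<lambda>a x. if a = 0 then 0 else x)"
  define s2 :: "bit \<Rightarrow> 'c \<Rightarrow> 'c" where "s2 = (\<lambda>a x. if a = 0 then 0 else x)"
  have bits: "a = 0 \<or> a = 1" for a :: bit by (cases a) auto
  have vs1: "vector_space s1"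
  proof
    fix a b :: bit and x y
    show "s1 (a + b) x = s1 a x + s1 b x" using bits[of a] bits[of b] char2(1)[of x] by (auto simp: s1_def)
  qed (auto simp: s1_def)
  have vs2: "vector_space s2"
  proof
    fix a b :: bit and x y
    show "s2 (a + b) x = s2 a x + s2 b x" using bits[of a] bits[of b] char2(2)[of x] by (auto simp: s2_def)
  qed (auto simp: s2_def)
  have d0: "d 0 = 0" using d[of 0 0] by simp
  interpret P: vector_space_pair s1 s2
    using vs1 vs2 by (simp add: vector_space_pair_def)
  have "Vector_Spaces.linear s1 s2 d"
    unfolding Vector_Spaces.linear_iff using vs1 vs2 d d0 by (auto simp: s1_def s2_def)
  moreover have "P.vs1.subspace V"
    by (rule P.vs1.subspaceI) (use V in \<open>auto simp: s1_def\<close>)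
  ultimately obtain g where g: "g ` UNIV \<subseteq> V" "Vector_Spaces.linear s2 s1 g" "\<And>y. y \<in> d ` V \<Longrightarrow> d (g y) = y"
    using P.linear_exists_right_inverse_on[of d V] by blast
  have gadd: "g (x + y) = g x + g y" for x y
    using g(2) unfolding linear_iff_module_hom by (simp add: module_hom.add)
  show thesis
  proof (rule that[of "\<lambda>y. u (g y)"])
    show "u (g (x + y)) = u (g x) + u (g y)" for x y by (simp add: gadd u)
  next
    fix x assume x: "x \<in> V"
    have "g (d x) \<in> V" using g(1) by blast
    then have "u (g (d x) + x) = 0"
      by (intro ker V x) (use x g(3)[of "d x"] char2 in \<open>auto simp: d\<close>)
    then have "u (g (d x)) + u x = 0" by (simp add: u)
    then show "u (g (d x)) = u x" using bits[of "u x"] bits[of "u (g (d x))"] by auto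
  qed
qed

text \<open>The mod 2 simplicial coboundary in its augmented form: a simplex is the set of its vertices and the
empty set is the only simplex of dimension -1.\<close>

definition cobound :: "('a set \<Rightarrow> bit) \<Rightarrow> 'a set \<Rightarrow> bit" where
  "cobound u A = (\<Sum>a\<in>A. u (A - {a}))"

lemma sum_symmetric_bit:
  fixes f :: "'a \<Rightarrow> 'a \<Rightarrow> bit"
  assumes "finite F" "\<And>a b. f a b = f b a" "\<And>a. f a a = 0"
  shows "(\<Sum>a\<in>F. \<Sum>b\<in>F. f a b) = 0"
  using assms(1)
proof induction
  case (insert x F)
  have "(\<Sum>a\<in>F. f a x) = (\<Sum>b\<in>F. f x b)" by (simp add: assms(2)[of _ x])
  moreover have "(\<Sum>a\<in>insert x F. \<Sum>b\<in>insert x F. f a b)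
      = (\<Sum>b\<in>F. f x b) + ((\<Sum>a\<in>F. f a x) + (\<Sum>a\<in>F. \<Sum>b\<in>F. f a b))"
    using insert.hyps by (simp only: sum.insert sum.distrib assms(3) add_0_left ac_simps not_False_eq_True)
  ultimately show ?case using insert.IH bit_add_self[of "\<Sum>b\<in>F. f x b"] by (simp only: add_0_right)
qed simp

lemma cobound_cobound:
  assumes "finite A"
  shows "cobound (cobound u) A = 0"
proof -
  have "cobound (cobound u) A = (\<Sum>a\<in>A. \<Sum>b\<in>A - {a}. u (A - {a} - {b}))"
    by (simp add: cobound_def)
  also have "\<dots> = (\<Sum>a\<in>A. \<Sum>b\<in>A. if a = b then 0 else u (A - {a,b}))"
    using assms by (intro sum.cong refl sum.mono_neutral_cong_left) (auto intro: arg_cong[of _ _ u])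
  also have "\<dots> = 0" using assms
    by (intro sum_symmetric_bit) (auto simp: insert_commute)
  finally show ?thesis .
qed

text \<open>A mod 2 chain is a finite set of simplices, written as a finitely supported function to the field
with two elements; chain_eval is the additive extension of g from simplices to chains.\<close>

definition chain_eval :: "('k \<Rightarrow> 'm::ab_group_add) \<Rightarrow> ('k \<Rightarrow>\<^sub>0 bit) \<Rightarrow> 'm" where
  "chain_eval g z = (\<Sum>k\<in>Poly_Mapping.keys z. g k)"

lemma chain_eval_superset:
  assumes "finite S" "Poly_Mapping.keys z \<subseteq> S"
  shows "chain_eval g z = (\<Sum>k\<in>S. if Poly_Mapping.lookup z k = 0 then 0 else g k)"
  unfolding chain_eval_def
  using assms by (intro sum.mono_neutral_cong_left) (auto simp: in_keys_iff)

lemma chain_eval_add: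
  fixes g :: "'k \<Rightarrow> 'm::ab_group_add"
  assumes char2: "\<And>y::'m. y + y = 0"
  shows "chain_eval g (x + y) = chain_eval g x + chain_eval g y"
proof -
  let ?S = "Poly_Mapping.keys x \<union> Poly_Mapping.keys y"
  have "Poly_Mapping.keys (x + y) \<subseteq> ?S" by (rule keys_add)
  then have "chain_eval g (x + y) = (\<Sum>k\<in>?S. if Poly_Mapping.lookup (x + y) k = 0 then 0 else g k)"
    by (intro chain_eval_superset) auto
  also have "\<dots> = (\<Sum>k\<in>?S. (if Poly_Mapping.lookup x k = 0 then 0 else g k) + (if Poly_Mapping.lookup y k = 0 then 0 else g k))"
    by (intro sum.cong refl) (auto simp: lookup_add char2)
  also have "\<dots> = chain_eval g x + chain_eval g y"
    by (simp add: sum.distrib chain_eval_superset[of ?S x] chain_eval_superset[of ?S y])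
  finally show ?thesis .
qed

lemma chain_eval_single [simp]: "chain_eval g (Poly_Mapping.single k 1) = g k"
  by (simp add: chain_eval_def)

lemma additive_sum:
  fixes f :: "'b::ab_group_add \<Rightarrow> 'c::ab_group_add"
  assumes "\<And>x y. f (x + y) = f x + f y"
  shows "f (\<Sum>i\<in>I. g i) = (\<Sum>i\<in>I. f (g i))"
proof -
  have f0: "f 0 = 0" using assms[of 0 0] by simp
  show ?thesis by (induction I rule: infinite_finite_induct) (auto simp: assms f0)
qed

lemma poly_bit_add_self: "(z::'k \<Rightarrow>\<^sub>0 bit) + z = 0"
  by (rule poly_mapping_eqI) (simp add: lookup_add)

text \<open>Every cocycle u annihilates every cycle Z. That Z is a cycle is expressed by the vanishing of all
coboundaries on it. Since cobound v {a} = v {}, for p = 0 this condition says that Z has an even number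
of points, so the notion is the vanishing of reduced homology in all degrees.\<close>

definition homologically_trivial :: "'a set set \<Rightarrow> bool" where
  "homologically_trivial L \<longleftrightarrow>
     (\<forall>u Z p. (\<forall>A\<in>L. 2 \<le> card A \<longrightarrow> cobound u A = 0) \<longrightarrow> finite Z \<longrightarrow> Z \<subseteq> L \<longrightarrow>
        (\<forall>A\<in>Z. card A = Suc p) \<longrightarrow> (\<forall>v. (\<Sum>A\<in>Z. cobound v A) = 0) \<longrightarrow> (\<Sum>A\<in>Z. u A) = 0)"

lemma homologically_trivialD:
  assumes "homologically_trivial L" "\<And>A. A \<in> L \<Longrightarrow> 2 \<le> card A \<Longrightarrow> cobound u A = 0"
    "finite Z" "Z \<subseteq> L" "\<And>A. A \<in> Z \<Longrightarrow> card A = Suc p" "\<And>v. (\<Sum>A\<in>Z. cobound v A) = 0"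
  shows "(\<Sum>A\<in>Z. u A) = 0"
  using assms unfolding homologically_trivial_def by blast

text \<open>Cohomology over a field is dual to homology. The functional u vanishes on the kernel of the boundary
operator, because a chain can be split into its homogeneous parts and the boundary of each part can
be tested separately. Hence u factors through the boundary operator, and the factor is b. The
augmentation is included: on a one-point simplex the conclusion reads b {} = u {a}.\<close>

lemma cocycle_is_coboundary:
  fixes L :: "'a set set"
  assumes triv: "homologically_trivial L"
    and L: "\<And>A. A \<in> L \<Longrightarrow> finite A \<and> A \<noteq> {}"
    and u: "\<And>A. A \<in> L \<Longrightarrow> 2 \<le> card A \<Longrightarrow> cobound u A = 0"
  obtains b where "\<And>A. A \<in> L \<Longrightarrow> cobound b A = u A"
proof -
  define bd :: "('a set \<Rightarrow>\<^sub>0 bit) \<Rightarrow> ('a set \<Rightarrow>\<^sub>0 bit)"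
    where "bd = chain_eval (\<lambda>A. \<Sum>a\<in>A. Poly_Mapping.single (A - {a}) 1)"
  define V where "V = {z::'a set \<Rightarrow>\<^sub>0 bit. Poly_Mapping.keys z \<subseteq> L}"
  have eval_bd: "chain_eval v (bd z) = (\<Sum>A\<in>Poly_Mapping.keys z. cobound v A)" for z and v :: "'a set \<Rightarrow> bit"
    unfolding bd_def chain_eval_def[of _ z] cobound_def
    by (simp add: additive_sum[of "chain_eval v", OF chain_eval_add])
  have ker: "chain_eval u z = 0" if z: "z \<in> V" "bd z = 0" for z
  proof -
    let ?Z = "Poly_Mapping.keys z"
    have part: "(\<Sum>A\<in>{A \<in> ?Z. card A = n}. u A) = 0" if "n \<in> card ` ?Z" for n
    proof -
      from that obtain A where "A \<in> ?Z" "n = card A" by auto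
      then have "n > 0" using z(1) L[of A] by (auto simp: V_def card_gt_0_iff)
      then obtain p where p: "n = Suc p" using gr0_implies_Suc by blast
      have cyc: "(\<Sum>A\<in>{A \<in> ?Z. card A = n}. cobound v A) = 0" for v :: "'a set \<Rightarrow> bit"
      proof -
        (* Testing only with faces of p elements isolates the part whose simplices have p + 1 elements. *)
        define v' where "v' B = (if card B = p then v B else 0)" for B :: "'a set"
        have "cobound v' A = (if card A = n then cobound v A else 0)" if "A \<in> ?Z" for A
        proof -
          have "card (A - {a}) = p \<longleftrightarrow> card A = n" if "a \<in> A" for a
          proof -
            have "card A = Suc (card (A - {a}))"
              by (rule card.remove) (use \<open>A \<in> ?Z\<close> z(1) L[of A] that in \<open>auto simp: V_def\<close>)
            then show ?thesis by (simp add: p)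
          qed
          then show ?thesis unfolding cobound_def v'_def by simp
        qed
        then have "(\<Sum>A\<in>?Z. cobound v' A) = (\<Sum>A\<in>{A \<in> ?Z. card A = n}. cobound v A)"
          by (intro sum.mono_neutral_cong_right) auto
        moreover have "(\<Sum>A\<in>?Z. cobound v' A) = chain_eval v' (bd z)" by (simp add: eval_bd)
        ultimately show ?thesis by (simp add: z(2) chain_eval_def)
      qed
      show ?thesis
        by (rule homologically_trivialD[OF triv u, where p = p]) (use z(1) p cyc in \<open>auto simp: V_def\<close>)
    qed
    have "chain_eval u z = (\<Sum>n\<in>card ` ?Z. \<Sum>A\<in>{A \<in> ?Z. card A = n}. u A)"
      unfolding chain_eval_def by (rule sum.image_gen) simp
    then show ?thesis using part by simp
  qed
  obtain b where b: "\<And>x y. b (x + y) = b x + b y" "\<And>x. x \<in> V \<Longrightarrow> b (bd x) = chain_eval u x"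
  proof (rule functional_factors_char2[where d = bd and u = "chain_eval u" and V = V])
    show "bd (x + y) = bd x + bd y" for x y
      unfolding bd_def by (rule chain_eval_add) (rule poly_bit_add_self)
    show "chain_eval u (x + y) = chain_eval u x + chain_eval u y" for x y
      by (rule chain_eval_add) simp
    show "x + y \<in> V" if "x \<in> V" "y \<in> V" for x y
      using that keys_add[of x y] unfolding V_def by auto
  qed (auto simp: poly_bit_add_self ker V_def)
  show thesis
  proof (rule that[of "\<lambda>B. b (Poly_Mapping.single B 1)"])
    fix A assume "A \<in> L"
    then have "b (bd (Poly_Mapping.single A 1)) = u A"
      by (subst b(2)) (auto simp: V_def)
    then show "cobound (\<lambda>B. b (Poly_Mapping.single B 1)) A = u A"
      by (simp add: bd_def cobound_def additive_sum[of b, OF b(1)])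
  qed
qed

section \<open>Evaluating cochains on labelled singular chains\<close>

definition corner :: "nat \<Rightarrow> nat \<Rightarrow> real" where
  "corner i = (\<lambda>j. if j = i then 1 else 0)"

lemma corner_in_standard_simplex [simp]: "corner i \<in> standard_simplex p \<longleftrightarrow> i \<le> p"
  by (simp add: corner_def)

lemma simplical_face_corner:
  "simplical_face k (corner i) = corner (if i < k then i else Suc i)"
  by (rule ext) (auto simp: simplical_face_def corner_def)

text \<open>A labelling lab of the points of a space turns a singular simplex into the set of the labels of its
corners. Discarding the degenerate case, in which two corners have the same label, yields a map from
singular chains to mod 2 chains of abstract simplices; label_eval is its transpose, which evaluates a
cochain v on a singular chain.\<close>

definition label_set :: "('a \<Rightarrow> 'b) \<Rightarrow> nat \<Rightarrow> ((nat \<Rightarrow> real) \<Rightarrow> 'a) \<Rightarrow> 'b set" where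
  "label_set lab p s = (\<lambda>i. lab (s (corner i))) ` {..p}"

definition label_value :: "('a \<Rightarrow> 'b) \<Rightarrow> ('b set \<Rightarrow> bit) \<Rightarrow> nat \<Rightarrow> ((nat \<Rightarrow> real) \<Rightarrow> 'a) \<Rightarrow> bit" where
  "label_value lab v p s = (if card (label_set lab p s) = Suc p then v (label_set lab p s) else 0)"

definition label_eval :: "('a \<Rightarrow> 'b) \<Rightarrow> ('b set \<Rightarrow> bit) \<Rightarrow> nat \<Rightarrow> 'a chain \<Rightarrow> bit" where
  "label_eval lab v p c =
     (\<Sum>s\<in>Poly_Mapping.keys c. of_int (Poly_Mapping.lookup c s) * label_value lab v p s)"

lemma label_eval_superset:
  assumes "finite S" "Poly_Mapping.keys c \<subseteq> S"
  shows "label_eval lab v p c = (\<Sum>s\<in>S. of_int (Poly_Mapping.lookup c s) * label_value lab v p s)"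
  unfolding label_eval_def
  using assms by (intro sum.mono_neutral_left) (auto simp: in_keys_iff)

lemma label_eval_add: "label_eval lab v p (c + d) = label_eval lab v p c + label_eval lab v p d"
proof -
  let ?S = "Poly_Mapping.keys c \<union> Poly_Mapping.keys d"
  have "label_eval lab v p (c + d)
      = (\<Sum>s\<in>?S. of_int (Poly_Mapping.lookup (c + d) s) * label_value lab v p s)"
    using keys_add[of c d] by (intro label_eval_superset) auto
  also have "\<dots> = (\<Sum>s\<in>?S. of_int (Poly_Mapping.lookup c s) * label_value lab v p s)
      + (\<Sum>s\<in>?S. of_int (Poly_Mapping.lookup d s) * label_value lab v p s)"
    by (simp only: lookup_add of_int_add distrib_right sum.distrib)
  also have "\<dots> = label_eval lab v p c + label_eval lab v p d"
    using label_eval_superset[of ?S c lab v p] label_eval_superset[of ?S d lab v p] by simp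
  finally show ?thesis .
qed

lemma label_eval_of [simp]: "label_eval lab v p (frag_of s) = label_value lab v p s"
  by (cases "label_value lab v p s") (simp_all add: label_eval_def)

lemma label_eval_0 [simp]: "label_eval lab v p 0 = 0"
  by (simp add: label_eval_def)

lemma label_eval_minus: "label_eval lab v p (- c) = label_eval lab v p c"
proof -
  have "label_eval lab v p c + label_eval lab v p (- c) = 0"
    unfolding label_eval_add[symmetric] by (simp add: label_eval_def)
  then show ?thesis by (cases "label_eval lab v p c"; cases "label_eval lab v p (- c)") auto
qed

lemma label_eval_diff: "label_eval lab v p (c - d) = label_eval lab v p c + label_eval lab v p d"
  by (metis label_eval_add label_eval_minus diff_conv_add_uminus)

lemma label_eval_sum: "label_eval lab v p (\<Sum>i\<in>I. f i) = (\<Sum>i\<in>I. label_eval lab v p (f i))"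
  by (induction I rule: infinite_finite_induct) (simp_all only: label_eval_add sum.infinite sum.empty sum.insert label_eval_0 not_False_eq_True)

lemma label_eval_cmul: "label_eval lab v p (frag_cmul n c) = of_int n * label_eval lab v p c"
proof -
  have "label_eval lab v p (frag_cmul n c)
      = (\<Sum>s\<in>Poly_Mapping.keys c. of_int (Poly_Mapping.lookup (frag_cmul n c) s) * label_value lab v p s)"
    by (rule label_eval_superset) (simp_all add: keys_cmul)
  then show ?thesis
    by (simp only: lookup_frag_cmul of_int_mult mult.assoc sum_distrib_left label_eval_def)
qed

lemma label_eval_sign: "label_eval lab v p (frag_cmul ((-1) ^ k) c) = label_eval lab v p c"
proof -
  have "(of_int ((-1) ^ k) :: bit) = 1" by (cases "even k") auto
  then show ?thesis by (simp only: label_eval_cmul mult_1_left)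
qed

text \<open>If two of the labels x 0, ..., x (p+1) agree, then only the two faces opposite to them can have p+1
different labels, and these two faces have the same labels, so that they cancel modulo 2.\<close>

lemma cobound_of_faces:
  fixes x :: "nat \<Rightarrow> 'b"
  shows "(\<Sum>k\<le>Suc p. if card (x ` ({..Suc p} - {k})) = Suc p then v (x ` ({..Suc p} - {k})) else 0)
       = (if card (x ` {..Suc p}) = Suc (Suc p) then cobound v (x ` {..Suc p}) else (0::bit))"
proof (cases "inj_on x {..Suc p}")
  case True
  have img: "x ` ({..Suc p} - {k}) = x ` {..Suc p} - {x k}" if "k \<le> Suc p" for k
    using True that by (simp add: inj_on_image_set_diff[where C = "{..Suc p}"])
  have card: "card (x ` {..Suc p}) = Suc (Suc p)"
    using card_image[OF True] by simp
  have "(\<Sum>k\<le>Suc p. if card (x ` ({..Suc p} - {k})) = Suc p then v (x ` ({..Suc p} - {k})) else 0)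
      = (\<Sum>k\<le>Suc p. v (x ` {..Suc p} - {x k}))"
    by (intro sum.cong refl) (use card in \<open>simp add: img\<close>)
  also have "\<dots> = (\<Sum>a\<in>x ` {..Suc p}. v (x ` {..Suc p} - {a}))"
    using True by (simp add: sum.reindex)
  finally show ?thesis using card by (simp add: cobound_def)
next
  case False
  then obtain i j where ij: "i \<noteq> j" "i \<le> Suc p" "j \<le> Suc p" "x i = x j"
    by (auto simp: inj_on_def)
  have ncard: "card (x ` {..Suc p}) \<noteq> Suc (Suc p)"
    using eq_card_imp_inj_on[of "{..Suc p}" x] False by auto
  let ?f = "\<lambda>k. if card (x ` ({..Suc p} - {k})) = Suc p then v (x ` ({..Suc p} - {k})) else 0"
  have zero: "?f k = 0" if k: "k \<in> {..Suc p} - {i,j}" for k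
  proof -
    have "{..Suc p} - {k} = insert i ({..Suc p} - {k} - {i})" using ij k by auto
    moreover have "x i \<in> x ` ({..Suc p} - {k} - {i})"
      by (rule image_eqI[of _ _ j]) (use ij k in auto)
    ultimately have "x ` ({..Suc p} - {k}) = x ` ({..Suc p} - {k} - {i})"
      by (metis image_insert insert_absorb)
    then have "card (x ` ({..Suc p} - {k})) \<le> card ({..Suc p} - {k} - {i})"
      by (simp add: card_image_le)
    also have "\<dots> = p" using ij k by (simp add: card_Diff_singleton_if)
    finally show ?thesis by simp
  qed
  have same: "x ` ({..Suc p} - {i}) = x ` ({..Suc p} - {j})"
  proof -
    have "{..Suc p} - {i} = insert j ({..Suc p} - {i,j})" "{..Suc p} - {j} = insert i ({..Suc p} - {i,j})"
      using ij by auto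
    then show ?thesis by (metis image_insert ij(4))
  qed
  have "(\<Sum>k\<le>Suc p. ?f k) = (\<Sum>k\<in>{i,j}. ?f k)"
    by (rule sum.mono_neutral_right) (use ij zero in auto)
  also have "\<dots> = ?f i + ?f j" using ij(1) by simp
  also have "\<dots> = 0" by (simp only: same bit_add_self)
  finally show ?thesis using ncard by simp
qed

lemma image_skip: "(\<lambda>i. f (if i < k then i else Suc i)) ` {..p} = f ` ({..Suc p} - {k})" if "k \<le> Suc p"
proof -
  have "(\<lambda>i. if i < k then i else Suc i) ` {..p} = {..Suc p} - {k}"
  proof (intro equalityI subsetI)
    fix j assume j: "j \<in> {..Suc p} - {k}"
    show "j \<in> (\<lambda>i. if i < k then i else Suc i) ` {..p}"
      by (rule image_eqI[of _ _ "if j < k then j else j - 1"]) (use j that in auto)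
  qed (use that in \<open>auto split: if_splits\<close>)
  then show ?thesis by (metis image_image)
qed

lemma label_set_singular_face:
  assumes "k \<le> Suc p"
  shows "label_set lab p (singular_face (Suc p) k s) = (\<lambda>i. lab (s (corner i))) ` ({..Suc p} - {k})"
proof -
  have "label_set lab p (singular_face (Suc p) k s)
     = (\<lambda>i. lab (s (corner (if i < k then i else Suc i)))) ` {..p}"
    unfolding label_set_def
    by (intro image_cong refl) (simp add: singular_face_def simplical_face_corner)
  then show ?thesis using image_skip[OF assms, of "\<lambda>i. lab (s (corner i))"] by simp
qed

text \<open>Passing to label sets is a chain map: the boundary of a degenerate simplex is degenerate modulo 2,
and the signs of the singular boundary disappear.\<close>

lemma label_eval_boundary:
  "label_eval lab v p (chain_boundary (Suc p) c) = label_eval lab (cobound v) (Suc p) c"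
proof (rule frag_induction[of c UNIV])
  fix s :: "(nat \<Rightarrow> real) \<Rightarrow> 'a"
  have "label_eval lab v p (chain_boundary (Suc p) (frag_of s))
     = (\<Sum>k\<le>Suc p. label_value lab v p (singular_face (Suc p) k s))"
    by (simp add: chain_boundary_of label_eval_sum label_eval_sign del: sum.atMost_Suc)
  also have "\<dots> = label_value lab (cobound v) (Suc p) s"
  proof -
    have "(\<Sum>k\<le>Suc p. label_value lab v p (singular_face (Suc p) k s))
       = (\<Sum>k\<le>Suc p. if card ((\<lambda>i. lab (s (corner i))) ` ({..Suc p} - {k})) = Suc p
            then v ((\<lambda>i. lab (s (corner i))) ` ({..Suc p} - {k})) else 0)"
      by (intro sum.cong refl) (simp add: label_value_def label_set_singular_face)
    then show ?thesis
      by (simp only: cobound_of_faces label_value_def label_set_def)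
  qed
  finally show "label_eval lab v p (chain_boundary (Suc p) (frag_of s))
     = label_eval lab (cobound v) (Suc p) (frag_of s)" by simp
qed (simp_all only: chain_boundary_diff label_eval_diff chain_boundary_0 label_eval_0 subset_UNIV)

lemma even_chain_half:
  fixes c :: "'a chain"
  assumes "\<And>s. even (Poly_Mapping.lookup c s)" "singular_chain p X c"
  obtains w where "singular_chain p X w" "c = w + w"
proof
  let ?w = "Poly_Mapping.map (\<lambda>n. n div 2) c"
  show "c = ?w + ?w"
    by (rule poly_mapping_eqI) (use assms(1) in \<open>auto simp: lookup_add Poly_Mapping.map.rep_eq when_def\<close>)
  show "singular_chain p X ?w"
    using assms(2) unfolding singular_chain_def
    by (auto simp: in_keys_iff Poly_Mapping.map.rep_eq when_def subset_iff split: if_splits)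
qed

lemma double_chain_eq_0: "w = 0" if "w + w = 0" for w :: "'a chain"
proof (rule poly_mapping_eqI)
  fix s
  have "Poly_Mapping.lookup (w + w) s = 0" by (simp add: that)
  then show "Poly_Mapping.lookup w s = Poly_Mapping.lookup 0 s" by (simp add: lookup_add)
qed

section \<open>Homology modulo 2 of contractible spaces\<close>

lemma chain_map_const:
  assumes "singular_chain p X c" "a \<in> topspace X"
  shows "singular_chain p (subtopology X {a}) (chain_map p (\<lambda>x. a) c)"
  by (rule singular_chain_chain_map[OF assms(1)]) (use assms(2) in auto)

lemma singleton_topspace: "a \<in> topspace X \<Longrightarrow> topspace (subtopology X {a}) = {a}"
  by auto

lemma cycle_homologous_const:
  assumes con: "homotopic_with (\<lambda>h. True) X X id (\<lambda>x. a)"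
    and c: "singular_relcycle p X {} c"
  shows "singular_relboundary p X {} (c - chain_map p (\<lambda>x. a) c)"
proof -
  have "homologous_rel p X {} (chain_map p id c) (chain_map p (\<lambda>x. a) c)"
    by (rule homotopic_imp_homologous_rel_chain_maps[OF _ c]) (use con in simp)
  moreover have "chain_map p id c = c"
    by (rule chain_map_id_gen[of p X]) (use c in \<open>auto simp: singular_cycle\<close>)
  ultimately show ?thesis by (simp add: homologous_rel_def)
qed

lemma boundary_from_point:
  assumes "singular_relboundary p (subtopology X {a}) {} c"
  shows "singular_relboundary p X {} c"
  using singular_boundary_mono[of "{a}" UNIV p X c] assms by simp

lemma contractible_cycle_is_boundary:
  assumes con: "homotopic_with (\<lambda>h. True) X X id (\<lambda>x. a)" and a: "a \<in> topspace X"
    and c: "singular_relcycle p X {} c" and p: "1 \<le> p"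
  shows "singular_relboundary p X {} c"
proof -
  let ?k = "chain_map p (\<lambda>x. a) c"
  have "singular_relcycle p (subtopology X {a}) {} ?k"
    by (rule singular_relcycle_chain_map[OF c]) (use a in auto)
  then have "singular_relboundary p (subtopology X {a}) {} ?k"
    using singular_boundary_eq_cycle_singleton[OF singleton_topspace[OF a] p] by simp
  then have "singular_relboundary p X {} ?k" by (rule boundary_from_point)
  with cycle_homologous_const[OF con c] have "singular_relboundary p X {} (c - ?k + ?k)"
    by (rule singular_relboundary_add)
  then show ?thesis by simp
qed

text \<open>Triviality of the mod 2 homology of a contractible space, deduced from integral homology. If the
boundary of c is 2w, then w is a cycle, hence the boundary of some u, and c - 2u is an integral
cycle, hence a boundary. In degree zero one has to know that the sum of the coefficients of c is
even; the labelling by the one-point type computes its parity. The same condition is hidden in degree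
one: there w has augmentation zero because its double is a boundary, and this is why w is compared
with its image under the constant map instead of being treated as a cycle of positive degree.\<close>

lemma contractible_mod2_cycle_is_boundary:
  assumes con: "homotopic_with (\<lambda>h. True) X X id (\<lambda>x. a)" and a: "a \<in> topspace X"
    and c: "singular_chain p X c"
    and bd: "p = 0 \<Longrightarrow> label_eval (\<lambda>_. ()) (\<lambda>_. 1) 0 c = 0"
      "p \<noteq> 0 \<Longrightarrow> \<exists>w. singular_chain (p - 1) X w \<and> chain_boundary p c = w + w"
  obtains d e where "singular_chain (Suc p) X d" "c = chain_boundary (Suc p) d + (e + e)"
proof (cases "p = 0")
  case True
  let ?k = "chain_map 0 (\<lambda>x. a) c"
  have c0: "singular_relcycle 0 X {} c" using c True by (simp add: singular_cycle chain_boundary_def)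
  from cycle_homologous_const[OF con c0] obtain d
    where d: "singular_chain 1 X d" "c - ?k = chain_boundary 1 d"
    by (auto simp: singular_boundary)
  have "singular_chain 0 (subtopology X {a}) ?k"
    by (rule chain_map_const) (use c True a in auto)
  then obtain b where b: "?k = frag_cmul b (frag_of (restrict (\<lambda>x. a) (standard_simplex 0)))"
    using singular_chain_singleton[OF singleton_topspace[OF a]] by blast
  have one_point: "card (S :: unit set) \<noteq> Suc (Suc 0)" for S
    using card_mono[of UNIV S] by auto
  have "label_eval (\<lambda>_. ()) (\<lambda>_. 1) 0 (chain_boundary (Suc 0) d) = 0"
    unfolding label_eval_boundary
    unfolding label_eval_def label_value_def using one_point by simp
  then have "label_eval (\<lambda>_. ()) (\<lambda>_. 1) 0 ?k = 0"
    using bd(1)[OF True] d(2) label_eval_diff[of "\<lambda>_. ()" "\<lambda>_. 1" 0 c ?k] by simp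
  then have "(of_int b :: bit) = 0"
    unfolding b by (simp add: label_eval_cmul label_value_def label_set_def)
  then have "even b" by (metis even_of_int_iff even_zero)
  then obtain m where m: "b = m + m" by (metis evenE mult_2)
  let ?e = "frag_cmul m (frag_of (restrict (\<lambda>x. a) (standard_simplex 0)))"
  show thesis
  proof (rule that[of d ?e])
    have "c = chain_boundary 1 d + ?k" using d(2) by (simp add: algebra_simps)
    also have "?k = ?e + ?e" unfolding b m by (rule frag_cmul_distrib)
    finally show "c = chain_boundary (Suc p) d + (?e + ?e)" using True by simp
  qed (use d True in simp)
next
  case False
  then obtain q where p: "p = Suc q" using not0_implies_Suc by blast
  with bd(2) obtain w where w: "singular_chain q X w" "chain_boundary p c = w + w" by auto
  have "chain_boundary q w + chain_boundary q w = 0"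
    using chain_boundary_boundary_alt[of q X c] c p w(2)
    by (simp add: chain_boundary_add)
  then have wc: "singular_relcycle q X {} w"
    using w(1) double_chain_eq_0 by (auto simp: singular_cycle)
  let ?k = "chain_map q (\<lambda>x. a) w"
  have kc: "singular_chain q (subtopology X {a}) ?k" 
    by (rule chain_map_const) (use w a in auto)
  have "singular_relboundary q (subtopology X {a}) {} ?k"
  proof (cases "odd q")
    case True
    then show ?thesis using kc singular_boundary_singleton[OF singleton_topspace[OF a]] by simp
  next
    case False
    have "singular_chain p (subtopology X {a}) (chain_map p (\<lambda>x. a) c)"
      by (rule chain_map_const) (use c a in auto)
    then have "chain_boundary p (chain_map p (\<lambda>x. a) c) = 0"
      using chain_boundary_of_singleton[OF singleton_topspace[OF a]] False p by simp
    moreover have "chain_boundary p (chain_map p (\<lambda>x. a) c) = ?k + ?k"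
      using chain_boundary_chain_map[OF c, of "\<lambda>x. a"] w(2) p by (simp add: chain_map_add)
    ultimately have "?k = 0" using double_chain_eq_0 by metis
    then show ?thesis by simp
  qed
  then have "singular_relboundary q X {} ?k" by (rule boundary_from_point)
  with cycle_homologous_const[OF con wc] have "singular_relboundary q X {} (w - ?k + ?k)"
    by (rule singular_relboundary_add)
  then obtain u where u: "singular_chain p X u" "chain_boundary p u = w"
    by (auto simp: singular_boundary p)
  have "singular_relcycle p X {} (c - (u + u))"
    using c u w(2) by (simp add: singular_cycle singular_chain_diff singular_chain_add chain_boundary_diff chain_boundary_add)
  then have "singular_relboundary p X {} (c - (u + u))"
    by (rule contractible_cycle_is_boundary[OF con a]) (use p in simp)
  then obtain d where d: "singular_chain (Suc p) X d" "chain_boundary (Suc p) d = c - (u + u)"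
    by (auto simp: singular_boundary)
  show thesis by (rule that[of d u]) (use d in \<open>simp_all add: algebra_simps\<close>)
qed

section \<open>Coverings of simplicial complexes\<close>

lemma coord_add [simp]: "apply_bcontfun (x + y) v = apply_bcontfun x v + apply_bcontfun y v"
  by (simp add: plus_bcontfun.rep_eq)

lemma coord_scaleR [simp]: "apply_bcontfun (c *\<^sub>R x) v = c *\<^sub>R apply_bcontfun x v"
  by (simp add: scaleR_bcontfun.rep_eq)

definition vertex :: "nat \<Rightarrow> linfty" where
  "vertex v = Bcontfun (\<lambda>w. if w = v then 1 else 0)"

lemma coord_vertex [simp]: "apply_bcontfun (vertex v) w = (if w = v then 1 else 0)"
proof -
  have "(\<lambda>w. if w = v then 1 else 0 :: real) \<in> bcontfun"
    by (rule bcontfun_normI[where b = 1]) auto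
  then show ?thesis by (simp add: vertex_def Bcontfun_inverse)
qed

lemma vertex_eq_iff [simp]: "vertex v = vertex w \<longleftrightarrow> v = w"
proof
  assume "vertex v = vertex w"
  then have "apply_bcontfun (vertex v) v = apply_bcontfun (vertex w) v" by simp
  then show "v = w" by (simp split: if_splits)
qed simp

definition supp :: "linfty \<Rightarrow> nat set" where
  "supp x = {v. apply_bcontfun x v \<noteq> 0}"

lemma supp_vertex [simp]: "supp (vertex v) = {v}"
  by (auto simp: supp_def)

definition cell :: "nat set \<Rightarrow> linfty set" where
  "cell \<sigma> = {x. (\<forall>v. 0 \<le> apply_bcontfun x v) \<and> supp x \<subseteq> \<sigma> \<and> (\<Sum>v\<in>\<sigma>. apply_bcontfun x v) = 1}"

lemma vertex_in_cell [simp]: "finite \<sigma> \<Longrightarrow> vertex v \<in> cell \<sigma> \<longleftrightarrow> v \<in> \<sigma>"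
  by (auto simp: cell_def)

lemma convex_cell: "convex (cell \<sigma>)"
proof (rule convexI)
  fix x y :: linfty and a b :: real
  assume *: "x \<in> cell \<sigma>" "y \<in> cell \<sigma>" "0 \<le> a" "0 \<le> b" "a + b = 1"
  have "supp (a *\<^sub>R x + b *\<^sub>R y) \<subseteq> \<sigma>" using * by (auto simp: cell_def supp_def subset_iff) (metis mult_zero_right add_0)
  moreover have "(\<Sum>v\<in>\<sigma>. a * apply_bcontfun x v + b * apply_bcontfun y v) = 1"
    using * by (simp add: sum.distrib cell_def flip: sum_distrib_left)
  ultimately show "a *\<^sub>R x + b *\<^sub>R y \<in> cell \<sigma>" using * by (auto simp: cell_def)
qed

lemma cell_mono: "finite \<sigma> \<Longrightarrow> \<tau> \<subseteq> \<sigma> \<Longrightarrow> cell \<tau> \<subseteq> cell \<sigma>"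
proof
  fix x assume *: "finite \<sigma>" "\<tau> \<subseteq> \<sigma>" "x \<in> cell \<tau>"
  then have "(\<Sum>v\<in>\<tau>. apply_bcontfun x v) = (\<Sum>v\<in>\<sigma>. apply_bcontfun x v)"
    by (intro sum.mono_neutral_left) (auto simp: cell_def supp_def)
  with * show "x \<in> cell \<sigma>" by (auto simp: cell_def)
qed

lemma cell_supp: "x \<in> cell \<sigma> \<Longrightarrow> finite \<sigma> \<Longrightarrow> x \<in> cell (supp x)"
proof -
  assume *: "x \<in> cell \<sigma>" "finite \<sigma>"
  then have "(\<Sum>v\<in>supp x. apply_bcontfun x v) = (\<Sum>v\<in>\<sigma>. apply_bcontfun x v)"
    by (intro sum.mono_neutral_left) (auto simp: cell_def supp_def)
  with * show "x \<in> cell (supp x)" by (auto simp: cell_def)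
qed

lemma realization_eq: "realization K = {x. supp x \<in> K \<and> x \<in> cell (supp x)}"
  by (auto simp: realization_def cell_def supp_def)

lemma supp_nonempty: "x \<in> cell \<sigma> \<Longrightarrow> supp x \<noteq> {}"
proof
  assume "x \<in> cell \<sigma>" "supp x = {}"
  then have "(\<Sum>v\<in>\<sigma>. apply_bcontfun x v) = 0" "(\<Sum>v\<in>\<sigma>. apply_bcontfun x v) = 1"
    by (auto simp: cell_def supp_def)
  then show False by simp
qed

text \<open>A vertex with the largest barycentric coordinate; this coordinate is bounded below on the
whole complex.\<close>

definition peak :: "linfty \<Rightarrow> nat" where
  "peak x = (SOME v. v \<in> supp x \<and> (\<forall>w. apply_bcontfun x w \<le> apply_bcontfun x v))"

lemma peak:
  assumes "x \<in> cell \<sigma>" "finite \<sigma>"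
  shows "peak x \<in> supp x" "apply_bcontfun x w \<le> apply_bcontfun x (peak x)"
proof -
  have fin: "finite (supp x)" using assms finite_subset by (auto simp: cell_def)
  define m where "m = Max (apply_bcontfun x ` supp x)"
  have "m \<in> apply_bcontfun x ` supp x"
    unfolding m_def using fin supp_nonempty[OF assms(1)] by (intro Max_in) auto
  then obtain v where v: "v \<in> supp x" "apply_bcontfun x v = m" by auto
  have "apply_bcontfun x w \<le> m" for w
  proof (cases "w \<in> supp x")
    case True then show ?thesis unfolding m_def using fin by (intro Max_ge) auto
  next
    case False then show ?thesis using v assms(1) by (auto simp: supp_def cell_def)
  qed
  with v have "\<exists>v. v \<in> supp x \<and> (\<forall>w. apply_bcontfun x w \<le> apply_bcontfun x v)" by auto
  from someI_ex[OF this] show "peak x \<in> supp x" "apply_bcontfun x w \<le> apply_bcontfun x (peak x)"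
    unfolding peak_def by auto
qed

lemma peak_ge:
  assumes "x \<in> cell \<sigma>" "finite \<sigma>" "card \<sigma> \<le> N"
  shows "1 \<le> real N * apply_bcontfun x (peak x)"
proof -
  have "1 = (\<Sum>v\<in>\<sigma>. apply_bcontfun x v)" using assms by (simp add: cell_def)
  also have "\<dots> \<le> (\<Sum>v\<in>\<sigma>. apply_bcontfun x (peak x))"
    by (intro sum_mono peak[OF assms(1,2)])
  also have "\<dots> = real (card \<sigma>) * apply_bcontfun x (peak x)" by simp
  also have "\<dots> \<le> real N * apply_bcontfun x (peak x)"
    using assms by (intro mult_right_mono) (auto simp: cell_def)
  finally show ?thesis .
qed

text \<open>A covering space of a finite complex inherits a triangulation. Its simplices are the images of the
closed cells under sections of the covering, and such sections exist and are unique because cells are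
convex.\<close>

locale covered_complex =
  fixes K :: "nat set set" and E :: "linfty set" and p :: "linfty \<Rightarrow> linfty"
  assumes complex: "finite_simplicial_complex K"
    and cov: "covering_space E p (realization K)"
begin

lemma finite_simplex: "\<sigma> \<in> K \<Longrightarrow> finite \<sigma>"
  and simplex_nonempty: "\<sigma> \<in> K \<Longrightarrow> \<sigma> \<noteq> {}"
  and face_in: "\<sigma> \<in> K \<Longrightarrow> \<tau> \<subseteq> \<sigma> \<Longrightarrow> \<tau> \<noteq> {} \<Longrightarrow> \<tau> \<in> K"
proof -
  note c = complex[unfolded finite_simplicial_complex_def, THEN conjunct2]
  note conjunct1[OF c] conjunct2[OF c]
  then show "\<sigma> \<in> K \<Longrightarrow> finite \<sigma>" "\<sigma> \<in> K \<Longrightarrow> \<sigma> \<noteq> {}"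
    "\<sigma> \<in> K \<Longrightarrow> \<tau> \<subseteq> \<sigma> \<Longrightarrow> \<tau> \<noteq> {} \<Longrightarrow> \<tau> \<in> K"
    by blast+
qed

lemma cell_subset: "\<sigma> \<in> K \<Longrightarrow> cell \<sigma> \<subseteq> realization K"
proof
  fix x assume x: "\<sigma> \<in> K" "x \<in> cell \<sigma>"
  then have "supp x \<in> K" using face_in[of \<sigma> "supp x"] supp_nonempty[of x \<sigma>] by (auto simp: cell_def)
  then show "x \<in> realization K" using x cell_supp finite_simplex by (auto simp: realization_eq)
qed

lemma covered_point: "e \<in> E \<Longrightarrow> p e \<in> realization K"
  using covering_space_imp_surjective[OF cov] by blast

lemma covered_supp: "e \<in> E \<Longrightarrow> supp (p e) \<in> K" "e \<in> E \<Longrightarrow> p e \<in> cell (supp (p e))"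
  using covered_point by (auto simp: realization_eq)

definition is_section :: "nat set \<Rightarrow> (linfty \<Rightarrow> linfty) \<Rightarrow> bool" where
  "is_section \<sigma> f \<longleftrightarrow> continuous_on (cell \<sigma>) f \<and> f \<in> cell \<sigma> \<rightarrow> E \<and> (\<forall>x\<in>cell \<sigma>. p (f x) = x)"

lemma section_unique:
  assumes "is_section \<sigma> f" "is_section \<sigma> g" "\<sigma> \<in> K" "x \<in> cell \<sigma>" "f x = g x" "y \<in> cell \<sigma>"
  shows "f y = g y"
proof (rule covering_space_lift_unique[OF cov, of f x g "cell \<sigma>" "\<lambda>x. x" y])
  show "connected (cell \<sigma>)" by (rule convex_connected[OF convex_cell])
  show "(\<lambda>x. x) \<in> cell \<sigma> \<rightarrow> realization K" using cell_subset[OF assms(3)] by blast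
qed (use assms(1,2,4-6) in \<open>simp_all add: is_section_def\<close>)

lemma section_exists:
  assumes "\<sigma> \<in> K" "e \<in> E" "p e \<in> cell \<sigma>"
  obtains f where "is_section \<sigma> f" "f (p e) = e"
proof (rule covering_space_lift_strong[OF cov assms(2,3), of "\<lambda>x. x"])
  show "simply_connected (cell \<sigma>)" by (rule convex_imp_simply_connected[OF convex_cell])
  show "locally path_connected (cell \<sigma>)" by (rule convex_imp_locally_path_connected[OF convex_cell])
  show "(\<lambda>x. x) \<in> cell \<sigma> \<rightarrow> realization K" using cell_subset[OF assms(1)] by auto
  fix f assume "continuous_on (cell \<sigma>) f" "f \<in> cell \<sigma> \<rightarrow> E" "f (p e) = e"
    "\<And>y. y \<in> cell \<sigma> \<Longrightarrow> p (f y) = y"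
  then show thesis by (intro that[of f]) (simp_all add: is_section_def)
qed simp_all

definition sheet :: "nat set \<Rightarrow> linfty \<Rightarrow> linfty \<Rightarrow> linfty" where
  "sheet \<sigma> e = (SOME f. is_section \<sigma> f \<and> f (p e) = e)"

lemma sheet:
  assumes "\<sigma> \<in> K" "e \<in> E" "p e \<in> cell \<sigma>"
  shows "is_section \<sigma> (sheet \<sigma> e)" "sheet \<sigma> e (p e) = e"
proof -
  have "\<exists>f. is_section \<sigma> f \<and> f (p e) = e" using section_exists[OF assms] by blast
  then have "is_section \<sigma> (sheet \<sigma> e) \<and> sheet \<sigma> e (p e) = e"
    unfolding sheet_def by (rule someI_ex)
  then show "is_section \<sigma> (sheet \<sigma> e)" "sheet \<sigma> e (p e) = e" by simp_all
qed

lemma is_section_mono: "is_section \<sigma> f \<Longrightarrow> finite \<sigma> \<Longrightarrow> \<tau> \<subseteq> \<sigma> \<Longrightarrow> is_section \<tau> f"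
  using cell_mono[of \<sigma> \<tau>] unfolding is_section_def
  by (auto intro: continuous_on_subset)

lemma sheet_eq_section:
  assumes "is_section \<sigma> f" "\<tau> \<subseteq> \<sigma>" "\<sigma> \<in> K" "x \<in> cell \<tau>" "y \<in> cell \<tau>" "\<tau> \<noteq> {}"
  shows "sheet \<tau> (f x) y = f y"
proof -
  have f: "is_section \<tau> f" using assms is_section_mono finite_simplex by blast
  have tau: "\<tau> \<in> K" using assms face_in by blast
  have fx: "f x \<in> E" "p (f x) = x" using f assms(4) by (auto simp: is_section_def)
  show ?thesis
    using section_unique[OF sheet(1)[OF tau, of "f x"] f tau assms(4) _ assms(5)]
      sheet(2)[OF tau, of "f x"] fx assms(4) by simp
qed

text \<open>The vertex of E over v that lies in the same lifted cell as e. It is meaningful when the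
barycentric coordinate of p e at v is positive.\<close>

definition to_vertex :: "linfty \<Rightarrow> nat \<Rightarrow> linfty" where
  "to_vertex e v = sheet (supp (p e)) e (vertex v)"

lemma to_vertex_section:
  assumes "is_section \<sigma> f" "\<sigma> \<in> K" "x \<in> cell \<sigma>" "v \<in> supp x"
  shows "to_vertex (f x) v = f (vertex v)"
proof -
  have "p (f x) = x" "supp x \<subseteq> \<sigma>" using assms by (auto simp: is_section_def cell_def)
  moreover have "finite (supp x)" "x \<in> cell (supp x)"
    using assms finite_simplex finite_subset \<open>supp x \<subseteq> \<sigma>\<close> cell_supp by blast+
  ultimately show ?thesis unfolding to_vertex_def
    using assms by (auto intro!: sheet_eq_section)
qed

text \<open>A path in the open star of v is contracted to v along straight lines, and this homotopy is lifted
to E. The endpoints of the lifted lines form a path in the fibre over v, which must be constant.\<close>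

lemma to_vertex_constant_along_path:
  assumes "path g" "path_image g \<subseteq> E"
    and pos: "\<And>e. e \<in> path_image g \<Longrightarrow> apply_bcontfun (p e) v > 0"
  shows "to_vertex (pathstart g) v = to_vertex (pathfinish g) v"
proof -
  have gE: "g t \<in> E" if "t \<in> {0..1}" for t using assms that by (auto simp: path_image_def)
  have posg: "apply_bcontfun (p (g t)) v > 0" if "t \<in> {0..1}" for t
    using pos that by (auto simp: path_image_def)
  have contg: "continuous_on {0..1} g" using assms by (simp add: path_def)
  have contpg: "continuous_on {0..1} (\<lambda>t. p (g t))"
    by (rule continuous_on_compose2[OF covering_space_imp_continuous[OF cov] contg]) (use gE in auto)
  (* The straight-line contraction of the projected path to the vertex. *)
  define h where "h = (\<lambda>(u, t). (1 - u) *\<^sub>R p (g t) + u *\<^sub>R vertex v)"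
  have v: "vertex v \<in> cell (supp (p (g t)))" if "t \<in> {0..1}" for t
  proof -
    have "v \<in> supp (p (g t))" using posg[OF that] by (simp add: supp_def)
    then show ?thesis using finite_simplex[OF covered_supp(1)[OF gE[OF that]]] by simp
  qed
  have hcell: "h (u, t) \<in> cell (supp (p (g t)))" if "t \<in> {0..1}" "u \<in> {0..1}" for u t
    unfolding h_def using convexD[OF convex_cell covered_supp(2)[OF gE[OF that(1)]] v[OF that(1)]] that by auto
  have hreal: "h (u, t) \<in> realization K" if "t \<in> {0..1}" "u \<in> {0..1}" for u t
    using hcell[OF that] cell_subset covered_supp(1)[OF gE[OF that(1)]] by blast
  have conth: "continuous_on ({0..1} \<times> {0..1}) h"
  proof -
    have "continuous_on ({0..1} \<times> {0..1}) (\<lambda>z :: real \<times> real. p (g (snd z)))"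
      by (rule continuous_on_compose2[OF contpg]) (auto intro: continuous_intros)
    then show ?thesis unfolding h_def case_prod_unfold by (intro continuous_intros)
  qed
  obtain k where k: "continuous_on ({0..1} \<times> {0..1}) k" "k \<in> {0..1} \<times> {0..1} \<rightarrow> E"
      "\<And>t. t \<in> {0..1} \<Longrightarrow> k (0, t) = g t" "\<And>z. z \<in> {0..1} \<times> {0..1} \<Longrightarrow> h z = p (k z)"
    by (rule covering_space_lift_homotopy[OF cov conth, of g])
       (use hreal contg gE in \<open>auto simp: h_def\<close>)
  have end_eq: "k (1, t) = to_vertex (g t) v" if t: "t \<in> {0..1}" for t
  proof -
    let ?\<sigma> = "supp (p (g t))"
    note sh = sheet[OF covered_supp(1)[OF gE[OF t]] gE[OF t] covered_supp(2)[OF gE[OF t]]]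
    have conth_t: "continuous_on {0..1} (\<lambda>u. h (u, t))"
      by (rule continuous_on_compose2[OF conth]) (use t in \<open>auto intro: continuous_intros\<close>)
    have "k (1, t) = sheet ?\<sigma> (g t) (h (1, t))"
    proof (rule covering_space_lift_unique[OF cov, of "\<lambda>u. k (u, t)" 0 "\<lambda>u. sheet ?\<sigma> (g t) (h (u, t))" "{0..1}" "\<lambda>u. h (u, t)"])
      show "k (0, t) = sheet ?\<sigma> (g t) (h (0, t))" using k(3)[OF t] sh(2) by (simp add: h_def)
      show "continuous_on {0..1} (\<lambda>u. k (u, t))"
        by (rule continuous_on_compose2[OF k(1)]) (use t in \<open>auto intro: continuous_intros\<close>)
      show "continuous_on {0..1} (\<lambda>u. sheet ?\<sigma> (g t) (h (u, t)))"
        by (rule continuous_on_compose2[OF _ conth_t, of "cell ?\<sigma>"])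
           (use sh(1) hcell t in \<open>auto simp: is_section_def\<close>)
    qed (use k t sh(1) hcell hreal conth_t in \<open>auto simp: is_section_def\<close>)
    then show ?thesis by (simp add: h_def to_vertex_def)
  qed
  have "k (1, 1) = k (1, 0)"
  proof (rule covering_space_lift_unique[OF cov, of "\<lambda>t. k (1, t)" 0 "\<lambda>t. k (1, 0)" "{0..1}" "\<lambda>t. vertex v" 1])
    show "continuous_on {0..1} (\<lambda>t. k (1, t))"
      by (rule continuous_on_compose2[OF k(1)]) (auto intro: continuous_intros)
    show "(\<lambda>t. vertex v) \<in> {0..1} \<rightarrow> realization K" using hreal[of 0 1] by (auto simp: h_def)
    show "vertex v = p (k (1, t))" if "t \<in> {0..1}" for t using k(4)[of "(1, t)"] that by (simp add: h_def)
    show "vertex v = p (k (1, 0))" using k(4)[of "(1, 0)"] by (simp add: h_def)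
  qed (use k(2) in auto)
  then show ?thesis using end_eq[of 0] end_eq[of 1] by (simp add: pathstart_def pathfinish_def)
qed

end

section \<open>The lifted triangulation\<close>

definition barycentric :: "(nat \<Rightarrow> nat) \<Rightarrow> nat \<Rightarrow> (nat \<Rightarrow> real) \<Rightarrow> linfty" where
  "barycentric l n t = (\<Sum>j\<le>n. t j *\<^sub>R vertex (l j))"

lemma barycentric_corner: "i \<le> n \<Longrightarrow> barycentric l n (corner i) = vertex (l i)"
  unfolding barycentric_def corner_def by (simp add: if_distrib[of "\<lambda>c. c *\<^sub>R _"] cong: if_cong)

lemma barycentric_in_cell:
  assumes "t \<in> standard_simplex n" "finite \<sigma>" "\<And>j. j \<le> n \<Longrightarrow> l j \<in> \<sigma>"
  shows "barycentric l n t \<in> cell \<sigma>"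
  unfolding barycentric_def
  by (rule convex_sum[OF _ convex_cell]) (use assms in \<open>auto simp: standard_simplex_def\<close>)

lemma continuous_barycentric: "continuous_on S (barycentric l n)"
  unfolding barycentric_def
  by (intro continuous_intros continuous_on_subset[OF continuous_on_product_coordinates]) auto

lemma sum_simplical_face:
  fixes g :: "nat \<Rightarrow> 'b::real_vector"
  assumes "k \<le> Suc n"
  shows "(\<Sum>j\<le>Suc n. simplical_face k t j *\<^sub>R g j) = (\<Sum>j\<le>n. t j *\<^sub>R g (if j < k then j else Suc j))"
proof -
  let ?r = "\<lambda>j. if j < k then j else Suc j"
  have img: "?r ` {..n} = {..Suc n} - {k}"
    using image_skip[OF assms, of "\<lambda>j. j"] by simp
  have inj: "inj_on ?r {..n}" by (auto simp: inj_on_def split: if_splits)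
  have "(\<Sum>j\<le>Suc n. simplical_face k t j *\<^sub>R g j) = (\<Sum>j\<in>{..Suc n} - {k}. simplical_face k t j *\<^sub>R g j)"
    by (rule sum.mono_neutral_right) (auto simp: simplical_face_def)
  also have "\<dots> = (\<Sum>j\<le>n. simplical_face k t (?r j) *\<^sub>R g (?r j))"
    unfolding img[symmetric] by (rule sum.reindex[OF inj, unfolded o_def])
  also have "\<dots> = (\<Sum>j\<le>n. t j *\<^sub>R g (?r j))"
    by (intro sum.cong refl) (auto simp: simplical_face_def)
  finally show ?thesis .
qed

text \<open>The vertices of a simplex are listed in increasing order, so the list of a face arises by deleting an
entry; this is what makes faces of parametrized simplices parametrized in the same way.\<close>

lemma nth_sorted_remove:
  assumes "finite \<sigma>" "k < card \<sigma>" "j < card \<sigma> - 1"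
  shows "sorted_list_of_set (\<sigma> - {sorted_list_of_set \<sigma> ! k}) ! j
       = sorted_list_of_set \<sigma> ! (if j < k then j else Suc j)"
proof -
  let ?l = "sorted_list_of_set \<sigma>"
  have len: "length ?l = card \<sigma>" by simp
  define l' where "l' = take k ?l @ drop (Suc k) ?l"
  have split: "?l = take k ?l @ ?l ! k # drop (Suc k) ?l"
    using assms len by (simp add: id_take_nth_drop)
  have "distinct (take k ?l @ ?l ! k # drop (Suc k) ?l)" "sorted (take k ?l @ ?l ! k # drop (Suc k) ?l)"
    using assms by (simp_all only: split[symmetric]) simp_all
  then have "distinct l'" "sorted l'" "?l ! k \<notin> set l'"
    unfolding l'_def by (auto simp: sorted_append)
  moreover have "set l' = \<sigma> - {?l ! k}"
  proof -
    have "set ?l = insert (?l ! k) (set l')"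
      by (subst split) (auto simp: l'_def)
    then show ?thesis using assms(1) \<open>?l ! k \<notin> set l'\<close> by auto
  qed
  ultimately have "sorted_list_of_set (\<sigma> - {?l ! k}) = l'"
    using sorted_list_of_set.idem_if_sorted_distinct[of l'] by simp
  then show ?thesis using assms len by (auto simp: l'_def nth_append min_def)
qed

context covered_complex
begin

text \<open>A simplicial approximation to the identity of E, with values in the vertices over K.\<close>

definition nearest_vertex :: "linfty \<Rightarrow> linfty" where
  "nearest_vertex e = to_vertex e (peak (p e))"

text \<open>The simplices of the triangulation of E, as sets of vertices; shadow and chart recover the simplex
of K below and the section that a lifted simplex comes from.\<close>

definition lifted :: "linfty set set" where
  "lifted = {f ` vertex ` \<sigma> | \<sigma> f. \<sigma> \<in> K \<and> is_section \<sigma> f}"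

definition shadow :: "linfty set \<Rightarrow> nat set" where
  "shadow A = {v. vertex v \<in> p ` A}"

definition chart :: "linfty set \<Rightarrow> linfty \<Rightarrow> linfty" where
  "chart A = (SOME f. is_section (shadow A) f \<and> f ` vertex ` shadow A = A)"

lemma section_vertex:
  assumes "is_section \<sigma> f" "\<sigma> \<in> K" "v \<in> \<sigma>"
  shows "f (vertex v) \<in> E" "p (f (vertex v)) = vertex v"
proof -
  have "vertex v \<in> cell \<sigma>" using assms finite_simplex by simp
  then show "f (vertex v) \<in> E" "p (f (vertex v)) = vertex v" using assms(1) by (auto simp: is_section_def)
qed

lemma shadow_section:
  assumes "is_section \<sigma> f" "\<sigma> \<in> K"
  shows "shadow (f ` vertex ` \<sigma>) = \<sigma>"
proof -
  have "p ` f ` vertex ` \<sigma> = vertex ` \<sigma>"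
    unfolding image_image by (rule image_cong[OF refl]) (rule section_vertex(2)[OF assms])
  then show ?thesis unfolding shadow_def by auto
qed

lemma inj_section:
  assumes "is_section \<sigma> f" "\<sigma> \<in> K"
  shows "inj_on (\<lambda>v. f (vertex v)) \<sigma>"
proof (rule inj_onI)
  fix v w assume vw: "v \<in> \<sigma>" "w \<in> \<sigma>" "f (vertex v) = f (vertex w)"
  have "vertex v = p (f (vertex v))" by (rule section_vertex(2)[OF assms vw(1), symmetric])
  also have "\<dots> = p (f (vertex w))" by (simp only: vw(3))
  also have "\<dots> = vertex w" by (rule section_vertex(2)[OF assms vw(2)])
  finally show "v = w" by simp
qed

lemma lifted_section: "is_section \<sigma> f \<Longrightarrow> \<sigma> \<in> K \<Longrightarrow> f ` vertex ` \<sigma> \<in> lifted"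
  by (auto simp: lifted_def)

lemma chart:
  assumes "A \<in> lifted"
  shows "shadow A \<in> K" "is_section (shadow A) (chart A)" "chart A ` vertex ` shadow A = A"
    "card (shadow A) = card A"
proof -
  from assms obtain \<sigma> f where f: "\<sigma> \<in> K" "is_section \<sigma> f" "A = f ` vertex ` \<sigma>" by (auto simp: lifted_def)
  then have sh: "shadow A = \<sigma>" using shadow_section by simp
  then have "\<exists>f. is_section (shadow A) f \<and> f ` vertex ` shadow A = A" using f by blast
  then have "is_section (shadow A) (chart A) \<and> chart A ` vertex ` shadow A = A"
    unfolding chart_def by (rule someI_ex)
  then show "is_section (shadow A) (chart A)" "chart A ` vertex ` shadow A = A" by simp_all
  show "shadow A \<in> K" using sh f by simp
  show "card (shadow A) = card A"
    using card_image[OF inj_section[OF f(2,1)]] f(3) sh by (simp add: image_image)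
qed

lemma lifted_finite: "A \<in> lifted \<Longrightarrow> finite A \<and> A \<noteq> {}"
  using finite_simplex simplex_nonempty by (auto simp: lifted_def)

lemma chart_section:
  assumes "is_section \<sigma> f" "\<sigma> \<in> K" "x \<in> cell \<sigma>"
  shows "chart (f ` vertex ` \<sigma>) x = f x"
proof -
  let ?A = "f ` vertex ` \<sigma>"
  note c = chart[OF lifted_section[OF assms(1,2)], unfolded shadow_section[OF assms(1,2)]]
  obtain v where v: "v \<in> \<sigma>" using simplex_nonempty assms(2) by blast
  have "chart ?A (vertex v) \<in> ?A" using c(3) v by blast
  then obtain w where w: "w \<in> \<sigma>" "chart ?A (vertex v) = f (vertex w)" by auto
  then have "p (chart ?A (vertex v)) = vertex w" using section_vertex(2)[OF assms(1,2)] by simp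
  then have "v = w" using section_vertex(2)[OF c(2,1) v] by simp
  then have eq: "chart ?A (vertex v) = f (vertex v)" using w by simp
  have "vertex v \<in> cell \<sigma>" using v finite_simplex assms(2) by simp
  from section_unique[OF c(2) assms(1,2) this eq assms(3)] show ?thesis .
qed

definition nth_vertex :: "linfty set \<Rightarrow> nat \<Rightarrow> nat" where
  "nth_vertex A j = sorted_list_of_set (shadow A) ! j"

definition affine_simplex :: "nat \<Rightarrow> linfty set \<Rightarrow> (nat \<Rightarrow> real) \<Rightarrow> linfty" where
  "affine_simplex n A = restrict (\<lambda>t. chart A (barycentric (nth_vertex A) n t)) (standard_simplex n)"

lemma nth_vertex_bij:
  assumes "A \<in> lifted" "card A = Suc n"
  shows "bij_betw (nth_vertex A) {..n} (shadow A)"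
proof -
  have "finite (shadow A)" using chart(1)[OF assms(1)] finite_simplex by simp
  then have "bij_betw (\<lambda>j. sorted_list_of_set (shadow A) ! j) {..<length (sorted_list_of_set (shadow A))} (shadow A)"
    by (intro bij_betw_nth) auto
  then show ?thesis unfolding nth_vertex_def
    using chart(4)[OF assms(1)] assms(2) by (simp add: lessThan_Suc_atMost)
qed

lemma nth_vertex_in: "A \<in> lifted \<Longrightarrow> card A = Suc n \<Longrightarrow> j \<le> n \<Longrightarrow> nth_vertex A j \<in> shadow A"
  using nth_vertex_bij[of A n] by (auto simp: bij_betw_def)

lemma barycentric_nth_vertex:
  assumes "A \<in> lifted" "card A = Suc n" "t \<in> standard_simplex n"
  shows "barycentric (nth_vertex A) n t \<in> cell (shadow A)"
  by (rule barycentric_in_cell[OF assms(3)])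
     (use chart(1)[OF assms(1)] finite_simplex nth_vertex_in[OF assms(1,2)] in auto)

lemma singular_simplex_affine_simplex:
  assumes "A \<in> lifted" "card A = Suc n"
  shows "singular_simplex n (subtopology (top_of_set E) (chart A ` cell (shadow A))) (affine_simplex n A)"
proof -
  have c: "is_section (shadow A) (chart A)" using chart[OF assms(1)] by simp
  have "continuous_on (standard_simplex n) (\<lambda>t. chart A (barycentric (nth_vertex A) n t))"
    by (rule continuous_on_compose2[OF _ continuous_barycentric, of "cell (shadow A)"])
       (use c barycentric_nth_vertex[OF assms] in \<open>auto simp: is_section_def\<close>)
  then have "continuous_on (standard_simplex n) (affine_simplex n A)"
    by (rule continuous_on_eq) (simp add: affine_simplex_def)
  then show ?thesis
    unfolding singular_simplex_def
    using c barycentric_nth_vertex[OF assms]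
    by (auto simp: affine_simplex_def continuous_map_in_subtopology euclidean_product_topology is_section_def)
qed

lemma lifted_face:
  assumes "A \<in> lifted" "a \<in> A" "2 \<le> card A"
  shows "A - {a} \<in> lifted"
proof -
  note c = chart[OF assms(1)]
  obtain v where v: "v \<in> shadow A" "a = chart A (vertex v)" using c(3) assms(2) by blast
  have eq: "A - {a} = chart A ` vertex ` (shadow A - {v})"
  proof -
    have "(\<lambda>w. chart A (vertex w)) ` (shadow A - {v}) = A - {a}"
      using inj_on_image_set_diff[OF inj_section[OF c(2,1)], of "shadow A" "{v}"] v c(3)
      by (simp add: image_image)
    then show ?thesis by (simp add: image_image)
  qed
  have "shadow A - {v} \<noteq> {}"
  proof
    assume "shadow A - {v} = {}"
    then have "shadow A = {v}" using v by blast
    then show False using c(4) assms(3) by simp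
  qed
  then have "shadow A - {v} \<in> K" by (rule face_in[OF c(1) Diff_subset])
  moreover have "is_section (shadow A - {v}) (chart A)"
    by (rule is_section_mono[OF c(2) finite_simplex[OF c(1)] Diff_subset])
  ultimately show ?thesis unfolding eq by (rule lifted_section[rotated])
qed

text \<open>A face of the parametrized simplex over A is the parametrized simplex over the corresponding face
of A, since both sections agree on the smaller cell.\<close>

lemma singular_face_affine_simplex:
  assumes A: "A \<in> lifted" "card A = Suc (Suc n)" and k: "k \<le> Suc n"
  shows "singular_face (Suc n) k (affine_simplex (Suc n) A) = affine_simplex n (A - {chart A (vertex (nth_vertex A k))})"
proof -
  note c = chart[OF A(1)]
  let ?\<sigma> = "shadow A" and ?v = "nth_vertex A k"
  let ?B = "A - {chart A (vertex ?v)}"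
  have v: "?v \<in> ?\<sigma>" using nth_vertex_in[OF A k] .
  have fin: "finite ?\<sigma>" using finite_simplex c(1) by simp
  have B: "?B = chart A ` vertex ` (?\<sigma> - {?v})"
  proof -
    have "(\<lambda>w. chart A (vertex w)) ` (?\<sigma> - {?v}) = A - {chart A (vertex ?v)}"
      using inj_on_image_set_diff[OF inj_section[OF c(2,1)], of "shadow A" "{?v}"] v c(3)
      by (simp add: image_image)
    then show ?thesis by (simp add: image_image)
  qed
  have sec: "is_section (?\<sigma> - {?v}) (chart A)" by (rule is_section_mono[OF c(2) fin]) blast
  have "card (?\<sigma> - {?v}) = Suc n" using c(4) A(2) v by (simp add: card_Diff_singleton_if)
  then have "?\<sigma> - {?v} \<noteq> {}" by (metis card.empty nat.distinct(1))
  then have sigK: "?\<sigma> - {?v} \<in> K" by (rule face_in[OF c(1) Diff_subset])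
  have "chart A (vertex ?v) \<in> A" using c(3) v by blast
  then have BL: "?B \<in> lifted" "card ?B = Suc n"
    using lifted_face[OF A(1), of "chart A (vertex ?v)"] A(2) by (simp_all add: card_Diff_singleton_if)
  have shB: "shadow ?B = ?\<sigma> - {?v}" unfolding B by (rule shadow_section[OF sec sigK])
  have "barycentric (nth_vertex A) (Suc n) (simplical_face k t) = barycentric (nth_vertex ?B) n t" for t
  proof -
    have "nth_vertex A (if j < k then j else Suc j) = nth_vertex ?B j" if "j \<le> n" for j
    proof -
      have "nth_vertex ?B j = sorted_list_of_set (?\<sigma> - {?v}) ! j"
        by (simp only: nth_vertex_def[of ?B] shB)
      then show ?thesis
        using nth_sorted_remove[OF fin, of k j] k that c(4) A(2) by (simp add: nth_vertex_def)
    qed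
    then show ?thesis unfolding barycentric_def sum_simplical_face[OF k] by (intro sum.cong refl) simp
  qed
  moreover have "chart A x = chart ?B x" if "x \<in> cell (?\<sigma> - {?v})" for x
    unfolding B using chart_section[OF sec sigK that] by simp
  ultimately show ?thesis
    using simplical_face_in_standard_simplex[of "Suc n" k] k barycentric_nth_vertex[OF BL] shB
    unfolding singular_face_def affine_simplex_def by (intro ext) (auto simp: restrict_def)
qed

lemma sum_faces:
  assumes A: "A \<in> lifted" "card A = Suc n"
  shows "(\<Sum>k\<le>n. F (A - {chart A (vertex (nth_vertex A k))})) = (\<Sum>a\<in>A. F (A - {a}))"
proof -
  note c = chart[OF A(1)]
  have "bij_betw (\<lambda>k. chart A (vertex (nth_vertex A k))) {..n} A"
  proof -
    have "bij_betw (\<lambda>v. chart A (vertex v)) (shadow A) A"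
      using inj_section[OF c(2,1)] c(3) by (simp add: bij_betw_def image_image)
    from bij_betw_trans[OF nth_vertex_bij[OF A] this] show ?thesis by (simp add: o_def)
  qed
  then show ?thesis by (rule sum.reindex_bij_betw)
qed

lemma nearest_vertex_section:
  assumes "is_section \<sigma> f" "\<sigma> \<in> K" "x \<in> cell \<sigma>"
  shows "nearest_vertex (f x) \<in> f ` vertex ` \<sigma>"
proof -
  have x: "p (f x) = x" using assms by (auto simp: is_section_def)
  have pk: "peak x \<in> supp x" by (rule peak[OF assms(3)]) (rule finite_simplex[OF assms(2)])
  then have "nearest_vertex (f x) = f (vertex (peak x))" 
    unfolding nearest_vertex_def x by (rule to_vertex_section[OF assms])
  moreover have "peak x \<in> \<sigma>" using pk assms(3) by (auto simp: cell_def)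
  ultimately show ?thesis by blast
qed

lemma nearest_vertex_of_vertex:
  assumes "is_section \<sigma> f" "\<sigma> \<in> K" "v \<in> \<sigma>"
  shows "nearest_vertex (f (vertex v)) = f (vertex v)"
proof -
  have v: "vertex v \<in> cell \<sigma>" using assms finite_simplex by simp
  have "peak (vertex v) = v" using peak(1)[OF v finite_simplex[OF assms(2)]] by simp
  then show ?thesis
    unfolding nearest_vertex_def section_vertex(2)[OF assms] using to_vertex_section[OF assms(1,2) v] by simp
qed

end

section \<open>Acyclicity of the lifted triangulation\<close>

abbreviation subdivide :: "nat \<Rightarrow> nat \<Rightarrow> 'a chain \<Rightarrow> 'a chain" where
  "subdivide m n \<equiv> singular_subdivision n ^^ m"

lemma singular_chain_subdivide: "singular_chain n X c \<Longrightarrow> singular_chain n X (subdivide m n c)"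
  by (induction m) (auto intro: singular_chain_singular_subdivision)

lemma chain_boundary_subdivide:
  "singular_chain (Suc n) X c \<Longrightarrow> chain_boundary (Suc n) (subdivide m (Suc n) c) = subdivide m n (chain_boundary (Suc n) c)"
proof (induction m)
  case (Suc m)
  then show ?case
    using chain_boundary_singular_subdivision[OF singular_chain_subdivide[of "Suc n" X c m]] by simp
qed simp

lemma subdivide_0_dim: "singular_chain 0 X c \<Longrightarrow> subdivide m 0 c = c"
  by (induction m) (simp_all add: singular_subdivision_zero)

definition subdivided_eval where
  "subdivided_eval lab v m n c = label_eval lab v n (subdivide m n c)"

lemma subdivided_eval_0 [simp]: "subdivided_eval lab v m n 0 = 0"
  by (simp add: subdivided_eval_def)

lemma subdivided_eval_diff:
  "subdivided_eval lab v m n (c - d) = subdivided_eval lab v m n c + subdivided_eval lab v m n d"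
  by (simp only: subdivided_eval_def singular_subdivision_power_diff label_eval_diff)

lemma subdivided_eval_minus: "subdivided_eval lab v m n (- c) = subdivided_eval lab v m n c"
  using subdivided_eval_diff[of lab v m n 0 c] by simp

lemma subdivided_eval_add:
  "subdivided_eval lab v m n (c + d) = subdivided_eval lab v m n c + subdivided_eval lab v m n d"
  using subdivided_eval_diff[of lab v m n c "- d"] by (simp only: subdivided_eval_minus diff_minus_eq_add)

lemma subdivided_eval_sum:
  "subdivided_eval lab v m n (\<Sum>i\<in>I. f i) = (\<Sum>i\<in>I. subdivided_eval lab v m n (f i))"
  by (induction I rule: infinite_finite_induct)
     (simp_all only: subdivided_eval_add sum.infinite sum.empty sum.insert subdivided_eval_0 not_False_eq_True)

lemma subdivided_eval_sign:
  "subdivided_eval lab v m n (frag_cmul ((-1) ^ k) c) = subdivided_eval lab v m n c"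
proof (cases "even k")
  case False
  then have "frag_cmul ((-1) ^ k) c = - c" by simp
  then show ?thesis by (simp only: subdivided_eval_minus)
qed simp

lemma subdivided_eval_boundary:
  assumes "singular_chain (Suc n) X c"
  shows "subdivided_eval lab v m n (chain_boundary (Suc n) c) = subdivided_eval lab (cobound v) m (Suc n) c"
  unfolding subdivided_eval_def chain_boundary_subdivide[OF assms, symmetric] by (rule label_eval_boundary)

lemma bit_of_int_eq_0_iff: "(of_int n :: bit) = 0 \<longleftrightarrow> even n"
  by (metis even_of_int_iff even_zero bit_not_one_iff odd_one)

context covered_complex
begin

lemma boundary_affine_simplex:
  assumes "A \<in> lifted" "card A = Suc (Suc n)"
  shows "chain_boundary (Suc n) (frag_of (affine_simplex (Suc n) A))
       = (\<Sum>k\<le>Suc n. frag_cmul ((-1) ^ k) (frag_of (affine_simplex n (A - {chart A (vertex (nth_vertex A k))}))))"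
  unfolding chain_boundary_of
  by (auto simp: singular_face_affine_simplex[OF assms] simp del: sum.atMost_Suc intro!: sum.cong)

lemma subdivided_eval_boundary_affine_simplex:
  assumes "A \<in> lifted" "card A = Suc (Suc n)"
  shows "subdivided_eval nearest_vertex v m n (chain_boundary (Suc n) (frag_of (affine_simplex (Suc n) A)))
       = (\<Sum>a\<in>A. subdivided_eval nearest_vertex v m n (frag_of (affine_simplex n (A - {a}))))"
  unfolding boundary_affine_simplex[OF assms]
  using sum_faces[OF assms, of "\<lambda>B. subdivided_eval nearest_vertex v m n (frag_of (affine_simplex n B))"]
  by (simp only: subdivided_eval_sum subdivided_eval_sign)

lemma singular_chain_affine_simplex:
  assumes "A \<in> lifted" "card A = Suc n"
  shows "singular_chain n (subtopology (top_of_set E) (chart A ` cell (shadow A))) (frag_of (affine_simplex n A))"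
    "singular_chain n (top_of_set E) (frag_of (affine_simplex n A))"
  using singular_simplex_affine_simplex[OF assms] by (simp_all add: singular_chain_of singular_simplex_subtopology)

lemma label_set_in_cell:
  assumes "A \<in> lifted" "singular_simplex n (subtopology (top_of_set E) (chart A ` cell (shadow A))) s"
  shows "label_set nearest_vertex n s \<subseteq> A"
proof -
  note c = chart[OF assms(1)]
  have "nearest_vertex (s (corner i)) \<in> A" if "i \<le> n" for i
  proof -
    have "s (corner i) \<in> chart A ` cell (shadow A)"
      using assms(2) that by (auto simp: singular_simplex_subtopology)
    then obtain x where "x \<in> cell (shadow A)" "s (corner i) = chart A x" by blast
    then show ?thesis using nearest_vertex_section[OF c(2,1)] c(3) by simp
  qed
  then show ?thesis by (auto simp: label_set_def)
qed

text \<open>All corners in a subdivision of the simplex over A have labels in A, so the only possible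
nondegenerate label set in full dimension is A itself, and v enters only through v A.\<close>

lemma sperner_proportional:
  assumes "A \<in> lifted" "card A = Suc n"
  shows "subdivided_eval nearest_vertex v m n (frag_of (affine_simplex n A))
       = v A * subdivided_eval nearest_vertex (\<lambda>_. 1) m n (frag_of (affine_simplex n A))"
proof -
  let ?c = "subdivide m n (frag_of (affine_simplex n A))"
  have keys: "singular_chain n (subtopology (top_of_set E) (chart A ` cell (shadow A))) ?c"
    by (rule singular_chain_subdivide[OF singular_chain_affine_simplex(1)[OF assms]])
  have val: "label_value nearest_vertex v n s = v A * label_value nearest_vertex (\<lambda>_. 1) n s" if "s \<in> Poly_Mapping.keys ?c" for s
  proof (cases "card (label_set nearest_vertex n s) = Suc n")
    case True
    have "label_set nearest_vertex n s \<subseteq> A"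
      using keys that assms(1) by (intro label_set_in_cell) (auto simp: singular_chain_def)
    then have "label_set nearest_vertex n s = A"
      using True assms lifted_finite by (intro card_subset_eq) auto
    then show ?thesis by (simp add: label_value_def)
  qed (simp add: label_value_def)
  show ?thesis
    unfolding subdivided_eval_def label_eval_def sum_distrib_left
    by (intro sum.cong refl) (simp only: val mult.left_commute)
qed

text \<open>Sperner's lemma: the number of simplices with label set A in a subdivision of the simplex over A is
odd. By the preceding lemma the labelled subdivision is a multiple of A, and by induction its boundary is
the boundary of A. Testing with the cochain that is 1 only on one facet shows that the factor is 1.\<close>

lemma sperner:
  assumes "A \<in> lifted" "card A = Suc n"
  shows "subdivided_eval nearest_vertex v m n (frag_of (affine_simplex n A)) = v A"
  using assms
proof (induction n arbitrary: A v)
  case 0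
  note c = chart[OF 0(1)]
  have v: "nth_vertex A 0 \<in> shadow A" using nth_vertex_in[OF 0] by simp
  have "card (shadow A) = Suc 0" using c(4) 0(2) by simp
  then have sh: "shadow A = {nth_vertex A 0}" using v by (auto simp: card_Suc_eq)
  have "subdivide m 0 (frag_of (affine_simplex 0 A)) = frag_of (affine_simplex 0 A)"
    by (rule subdivide_0_dim[OF singular_chain_affine_simplex(2)[OF 0]])
  moreover have "affine_simplex 0 A (corner 0) = chart A (vertex (nth_vertex A 0))"
    by (simp add: affine_simplex_def barycentric_corner)
  then have "label_set nearest_vertex 0 (affine_simplex 0 A) = A"
    using nearest_vertex_of_vertex[OF c(2,1) v] c(3) sh by (simp add: label_set_def)
  ultimately show ?case using 0(2) by (simp add: subdivided_eval_def label_value_def)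
next
  case (Suc n)
  obtain a where a: "a \<in> A" using Suc.prems by fastforce
  (* The test cochain: the facet opposite to a. *)
  define \<delta> :: "linfty set \<Rightarrow> bit" where "\<delta> B = (if B = A - {a} then 1 else 0)" for B
  have fin: "finite A" using lifted_finite Suc.prems by blast
  have IH: "subdivided_eval nearest_vertex \<delta> m n (frag_of (affine_simplex n (A - {b}))) = \<delta> (A - {b})" if "b \<in> A" for b
    by (rule Suc.IH) (use lifted_face[OF Suc.prems(1) that] Suc.prems(2) that fin in auto)
  have cb: "cobound \<delta> A = 1"
  proof -
    have "cobound \<delta> A = (\<Sum>b\<in>A. if b = a then 1 else 0)"
      unfolding cobound_def \<delta>_def by (intro sum.cong refl) (use a in auto)
    then show ?thesis using a fin by simp
  qed
  let ?eps = "subdivided_eval nearest_vertex (\<lambda>_. 1) m (Suc n) (frag_of (affine_simplex (Suc n) A))"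
  have "cobound \<delta> A * ?eps = subdivided_eval nearest_vertex (cobound \<delta>) m (Suc n) (frag_of (affine_simplex (Suc n) A))"
    by (rule sperner_proportional[OF Suc.prems, symmetric])
  also have "\<dots> = subdivided_eval nearest_vertex \<delta> m n (chain_boundary (Suc n) (frag_of (affine_simplex (Suc n) A)))"
    by (rule subdivided_eval_boundary[OF singular_chain_affine_simplex(2)[OF Suc.prems], symmetric])
  also have "\<dots> = (\<Sum>b\<in>A. \<delta> (A - {b}))"
    unfolding subdivided_eval_boundary_affine_simplex[OF Suc.prems] by (intro sum.cong refl IH)
  also have "\<dots> = 1" using cb by (simp only: cobound_def)
  finally have "?eps = 1" by (simp only: cb mult_1_left)
  then show ?case using sperner_proportional[OF Suc.prems, of v m] by (simp only: mult_1_right)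
qed

text \<open>The largest barycentric coordinate of a point is at least 1/n, where n is the number of vertices,
and the coordinates of two points of a ball of this radius differ by less than 1/n.\<close>

definition mesh :: real where "mesh = 1 / (2 * (real (card (\<Union>K)) + 1))"

lemma mesh_pos: "mesh > 0" by (simp add: mesh_def add_pos_nonneg)

lemma peak_large:
  assumes "e \<in> E"
  shows "2 * mesh \<le> apply_bcontfun (p e) (peak (p e))"
proof -
  note s = covered_supp[OF assms]
  have "finite (\<Union>K)" using complex finite_simplex by (auto simp: finite_simplicial_complex_def)
  then have "card (supp (p e)) \<le> card (\<Union>K)" using s(1) by (intro card_mono) auto
  then have "card (supp (p e)) \<le> card (\<Union>K) + 1" by simp
  from peak_ge[OF s(2) finite_simplex[OF s(1)] this]
  show ?thesis by (simp add: mesh_def field_simps)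
qed

text \<open>If the image of a singular simplex in K is small, then the coordinates that are largest at one of
the corners stay positive on the entire simplex. Hence all the labels can be computed by sliding to
a common point e0, where they appear as vertices of the lifted cell of e0.\<close>

lemma small_label_set:
  assumes s: "singular_simplex n (top_of_set E) s"
    and small: "\<And>t. t \<in> standard_simplex n \<Longrightarrow> dist (p (s t)) x0 < mesh"
  shows "label_set nearest_vertex n s \<in> lifted"
proof -
  let ?D = "standard_simplex n"
  have sE: "s t \<in> E" if "t \<in> ?D" for t
    using s that by (auto simp: singular_simplex_def continuous_map_def)
  let ?e0 = "s (corner 0)"
  let ?\<sigma> = "supp (p ?e0)"
  let ?v = "\<lambda>i. peak (p (s (corner i)))"
  have e0: "?e0 \<in> E" by (rule sE) simp
  note sh = sheet[OF covered_supp(1)[OF e0] e0 covered_supp(2)[OF e0]]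
  have pos: "apply_bcontfun (p (s t)) (?v i) > 0" if "i \<le> n" "t \<in> ?D" for i t
  proof -
    have "\<bar>apply_bcontfun (p (s t)) (?v i) - apply_bcontfun (p (s (corner i))) (?v i)\<bar>
      \<le> dist (p (s t)) (p (s (corner i)))"
      using dist_bounded[of "p (s t)" "?v i" "p (s (corner i))"] by (simp add: dist_real_def)
    also have "\<dots> \<le> dist (p (s t)) x0 + dist (p (s (corner i))) x0" by (rule dist_triangle2)
    also have "\<dots> < 2 * mesh" using small[of t] small[of "corner i"] that by simp
    finally show ?thesis using peak_large[OF sE, of "corner i"] that by simp
  qed
  have pc: "path_connected (s ` ?D)"
  proof -
    have "path_connectedin (top_of_set E) (s ` ?D)"
      using path_connectedin_continuous_map_image[of "subtopology (powertop_real UNIV) ?D" "top_of_set E" s ?D]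
        s path_connectedin_standard_simplex[of n]
      by (simp add: singular_simplex_def path_connectedin_subtopology)
    then show ?thesis by (simp add: path_connectedin_subtopology)
  qed
  have nearest_vertex: "nearest_vertex (s (corner i)) = sheet ?\<sigma> ?e0 (vertex (?v i))" if i: "i \<le> n" for i
  proof -
    have "s (corner i) \<in> s ` ?D" "?e0 \<in> s ` ?D" using i by auto
    with pc obtain g where g: "path g" "path_image g \<subseteq> s ` ?D" "pathstart g = s (corner i)" "pathfinish g = ?e0"
      unfolding path_connected_def by blast
    have "to_vertex (pathstart g) (?v i) = to_vertex (pathfinish g) (?v i)"
    proof (rule to_vertex_constant_along_path[OF g(1)])
      show "path_image g \<subseteq> E" using g(2) sE by blast
      show "apply_bcontfun (p e) (?v i) > 0" if "e \<in> path_image g" for e using g(2) that pos[OF i] by blast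
    qed
    then show ?thesis by (simp add: nearest_vertex_def g to_vertex_def)
  qed
  have "label_set nearest_vertex n s = sheet ?\<sigma> ?e0 ` vertex ` (?v ` {..n})"
    unfolding label_set_def image_image by (intro image_cong refl) (use nearest_vertex in auto)
  moreover have sub: "?v ` {..n} \<subseteq> ?\<sigma>"
  proof
    fix v assume "v \<in> ?v ` {..n}"
    then obtain i where "i \<le> n" "v = ?v i" by auto
    then show "v \<in> ?\<sigma>" using pos[of i "corner 0"] by (simp add: supp_def)
  qed
  moreover have "?v ` {..n} \<in> K" by (rule face_in[OF covered_supp(1)[OF e0] sub]) auto
  moreover have "is_section (?v ` {..n}) (sheet ?\<sigma> ?e0)"
    by (rule is_section_mono[OF sh(1) finite_simplex[OF covered_supp(1)[OF e0]] sub])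
  ultimately show ?thesis using lifted_section by simp
qed

text \<open>The cycle Z is realized as a singular chain c, which is a cycle modulo 2 and therefore the boundary
of a chain d modulo 2. After subdivision d consists of small simplices, whose labels span lifted
simplices, so the cocycle u vanishes on the boundary of the subdivided d. By Sperner's lemma, the value of u
on the subdivided c is its value on Z.\<close>

lemma homologically_trivial_lifted:
  assumes contr: "contractible E" and ne: "E \<noteq> {}"
  shows "homologically_trivial lifted"
  unfolding homologically_trivial_def
proof (intro allI impI)
  fix u :: "linfty set \<Rightarrow> bit" and Z :: "linfty set set" and n :: nat
  assume u: "\<forall>A\<in>lifted. 2 \<le> card A \<longrightarrow> cobound u A = 0"
    and Z: "finite Z" "Z \<subseteq> lifted" "\<forall>A\<in>Z. card A = Suc n" "\<forall>v. (\<Sum>A\<in>Z. cobound v A) = 0"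
  let ?X = "top_of_set E"
  from contr obtain a where hom: "homotopic_with (\<lambda>h. True) ?X ?X id (\<lambda>x. a)"
    unfolding contractible_def by auto
  have a: "a \<in> topspace ?X"
  proof -
    obtain x where "x \<in> E" using ne by blast
    moreover have "continuous_map ?X ?X (\<lambda>x. a)" using homotopic_with_imp_continuous_maps[OF hom] by blast
    ultimately show ?thesis by (auto simp del: continuous_map_const simp: continuous_map_def)
  qed
  define c where "c = (\<Sum>A\<in>Z. frag_of (affine_simplex n A))"
  have cc: "singular_chain n ?X c"
    unfolding c_def using Z by (intro singular_chain_sum singular_chain_affine_simplex) auto
  have aug: "label_eval (\<lambda>_. ()) (\<lambda>_. 1) 0 c = 0" if n: "n = 0"
  proof -
    have "label_eval (\<lambda>_. ()) (\<lambda>_. 1) 0 c = (\<Sum>A\<in>Z. 1)"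
      unfolding c_def label_eval_sum by (intro sum.cong refl) (simp add: label_value_def label_set_def)
    also have "\<dots> = (\<Sum>A\<in>Z. cobound (\<lambda>_. 1) A)"
      by (intro sum.cong refl) (use Z(3) n in \<open>simp add: cobound_def\<close>)
    finally show ?thesis using Z(4) by simp
  qed
  have half: "\<exists>w. singular_chain (n - 1) ?X w \<and> chain_boundary n c = w + w" if "n \<noteq> 0"
  proof -
    from that obtain q where q: "n = Suc q" using not0_implies_Suc by blast
    have "even (Poly_Mapping.lookup (chain_boundary n c) s)" for s
    proof -
      (* This cochain counts the facets whose parametrization is s, hence computes the coefficient at s. *)
      define v :: "linfty set \<Rightarrow> bit" where "v B = of_bool (affine_simplex q B = s)" for B
      have sgn: "(of_int (Poly_Mapping.lookup (frag_cmul ((-1) ^ k) (frag_of (affine_simplex q B))) s) :: bit) = v B" for k B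
      proof -
        have "(of_int ((-1) ^ k) :: bit) = 1" by (cases "even k") auto
        then show ?thesis unfolding lookup_frag_cmul of_int_mult v_def by simp
      qed
      have "(of_int (Poly_Mapping.lookup (chain_boundary n (frag_of (affine_simplex n A))) s) :: bit) = cobound v A"
        if A: "A \<in> Z" for A
      proof -
        have L: "A \<in> lifted" "card A = Suc (Suc q)" using A Z q by auto
        have "(of_int (Poly_Mapping.lookup (chain_boundary n (frag_of (affine_simplex n A))) s) :: bit)
           = (\<Sum>k\<le>Suc q. v (A - {chart A (vertex (nth_vertex A k))}))"
          unfolding q boundary_affine_simplex[OF L] by (simp only: lookup_sum of_int_sum sgn)
        then show ?thesis using sum_faces[OF L, of v] by (simp only: cobound_def)
      qed
      then have "(of_int (Poly_Mapping.lookup (chain_boundary n c) s) :: bit) = (\<Sum>A\<in>Z. cobound v A)"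
        unfolding c_def chain_boundary_sum o_def lookup_sum of_int_sum by (intro sum.cong refl)
      then show ?thesis using Z(4) by (simp only: bit_of_int_eq_0_iff[symmetric])
    qed
    moreover have "singular_chain (n - 1) ?X (chain_boundary n c)"
      using singular_chain_boundary[OF cc] by simp
    ultimately show ?thesis by (metis even_chain_half)
  qed
  obtain d e where de: "singular_chain (Suc n) ?X d" "c = chain_boundary (Suc n) d + (e + e)"
    by (rule contractible_mod2_cycle_is_boundary[OF hom a cc aug half])
  (* Open sets whose images in K are small. *)
  define \<C> where "\<C> = range (\<lambda>x0. E \<inter> p -` ball x0 mesh)"
  have opn: "openin ?X U" if "U \<in> \<C>" for U
  proof -
    obtain x0 where "U = E \<inter> p -` ball x0 mesh" using \<open>U \<in> \<C>\<close> by (auto simp: \<C>_def)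
    then show ?thesis
      using continuous_openin_preimage_gen[OF covering_space_imp_continuous[OF cov] open_ball] by simp
  qed
  have cover: "topspace ?X \<subseteq> \<Union>\<C>" 
  proof
    fix e assume "e \<in> topspace ?X"
    then have "e \<in> E \<inter> p -` ball (p e) mesh" using mesh_pos by simp
    then show "e \<in> \<Union>\<C>" unfolding \<C>_def by blast
  qed
  obtain m where m: "\<And>k f. m \<le> k \<Longrightarrow> f \<in> Poly_Mapping.keys (subdivide k (Suc n) d)
      \<Longrightarrow> \<exists>V\<in>\<C>. f \<in> standard_simplex (Suc n) \<rightarrow> V"
    using sufficient_iterated_singular_subdivision_exists[OF opn cover de(1)] by metis
  have keys: "singular_chain (Suc n) ?X (subdivide m (Suc n) d)"
    by (rule singular_chain_subdivide[OF de(1)])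
  have "label_value nearest_vertex (cobound u) (Suc n) s = 0" if s: "s \<in> Poly_Mapping.keys (subdivide m (Suc n) d)" for s
  proof -
    obtain V where "V \<in> \<C>" "s \<in> standard_simplex (Suc n) \<rightarrow> V" using m[OF order_refl s] by blast
    then obtain x0 where "s \<in> standard_simplex (Suc n) \<rightarrow> E \<inter> p -` ball x0 mesh"
      unfolding \<C>_def by blast
    then have x0: "dist (p (s t)) x0 < mesh" if "t \<in> standard_simplex (Suc n)" for t
      using that by (auto simp: Pi_iff dist_commute)
    have "label_set nearest_vertex (Suc n) s \<in> lifted"
      by (rule small_label_set[OF _ x0]) (use keys s in \<open>auto simp: singular_chain_def\<close>)
    then show ?thesis using u by (simp add: label_value_def)
  qed
  then have "subdivided_eval nearest_vertex (cobound u) m (Suc n) d = 0"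
    unfolding subdivided_eval_def label_eval_def by (intro sum.neutral ballI) simp
  then have "subdivided_eval nearest_vertex u m n (chain_boundary (Suc n) d) = 0"
    by (simp only: subdivided_eval_boundary[OF de(1)])
  then have "subdivided_eval nearest_vertex u m n c = 0"
    unfolding de(2) by (simp only: subdivided_eval_add bit_add_self add_0_left)
  moreover have "subdivided_eval nearest_vertex u m n c = (\<Sum>A\<in>Z. u A)"
    unfolding c_def subdivided_eval_sum by (intro sum.cong refl sperner) (use Z in auto)
  ultimately show "(\<Sum>A\<in>Z. u A) = 0" by simp
qed

end

section \<open>Fibres and the fundamental group\<close>

definition path_in :: "'a::topological_space set \<Rightarrow> 'a \<Rightarrow> 'a \<Rightarrow> (real \<Rightarrow> 'a) \<Rightarrow> bool" where
  "path_in X a b q \<longleftrightarrow> path q \<and> path_image q \<subseteq> X \<and> pathstart q = a \<and> pathfinish q = b"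

lemma path_in_join: "path_in X a b q \<Longrightarrow> path_in X b c r \<Longrightarrow> path_in X a c (q +++ r)"
  by (auto simp: path_in_def path_image_join)

lemma path_in_reverse: "path_in X a b q \<Longrightarrow> path_in X b a (reversepath q)"
  by (auto simp: path_in_def)

lemma homotopic_join_cong:
  "homotopic_paths X q q' \<Longrightarrow> homotopic_paths X r r' \<Longrightarrow> path_in X a b q \<Longrightarrow> path_in X b c r
    \<Longrightarrow> homotopic_paths X (q +++ r) (q' +++ r')"
  by (rule homotopic_paths_join) (auto simp: path_in_def)

lemma homotopic_refl: "path_in X a b q \<Longrightarrow> homotopic_paths X q q"
  by (simp add: path_in_def)

lemma homotopic_assoc:
  "path_in X a b q \<Longrightarrow> path_in X b c r \<Longrightarrow> path_in X c d s
    \<Longrightarrow> homotopic_paths X (q +++ (r +++ s)) ((q +++ r) +++ s)"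
  by (rule homotopic_paths_assoc) (auto simp: path_in_def)

lemma homotopic_cancel:
  fixes X :: "'a::real_normed_vector set"
  assumes q: "path_in X a b q" and r: "path_in X c b r"
  shows "homotopic_paths X ((q +++ reversepath r) +++ r) q"
proof -
  have "homotopic_paths X ((q +++ reversepath r) +++ r) (q +++ (reversepath r +++ r))"
    using homotopic_assoc[OF q path_in_reverse[OF r] r] by (rule homotopic_paths_sym)
  also have "homotopic_paths X (q +++ (reversepath r +++ r)) (q +++ linepath b b)"
    by (rule homotopic_join_cong[OF homotopic_refl[OF q] _ q path_in_join[OF path_in_reverse[OF r] r]])
       (use homotopic_paths_linv[of r X] r in \<open>auto simp: path_in_def\<close>)
  also have "homotopic_paths X (q +++ linepath b b) q"
    using homotopic_paths_rid[of q X] q by (simp add: path_in_def)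
  finally show ?thesis .
qed

lemma homotopic_cancel_rev:
  fixes X :: "'a::real_normed_vector set"
  assumes q: "path_in X a b q" and r: "path_in X b c r"
  shows "homotopic_paths X ((q +++ r) +++ reversepath r) q"
  using homotopic_cancel[OF q path_in_reverse[OF r]] by simp

lemma homotopic_cancel_right:
  fixes X :: "'a::real_normed_vector set"
  assumes q: "path_in X a b q" and q': "path_in X a b q'" and r: "path_in X b c r"
    and hom: "homotopic_paths X (q +++ r) (q' +++ r)"
  shows "homotopic_paths X q q'"
proof -
  have "homotopic_paths X q ((q +++ r) +++ reversepath r)"
    using homotopic_cancel_rev[OF q r] by (rule homotopic_paths_sym)
  also have "homotopic_paths X ((q +++ r) +++ reversepath r) ((q' +++ r) +++ reversepath r)"
    by (rule homotopic_join_cong[OF hom homotopic_refl[OF path_in_reverse[OF r]] path_in_join[OF q r] path_in_reverse[OF r]])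
  also have "homotopic_paths X ((q' +++ r) +++ reversepath r) q'"
    by (rule homotopic_cancel_rev[OF q' r])
  finally show ?thesis .
qed

definition loop_class :: "'a::topological_space set \<Rightarrow> (real \<Rightarrow> 'a) \<Rightarrow> (real \<Rightarrow> 'a) set" where
  "loop_class X l = {r. homotopic_paths X l r}"

lemma loop_class_eq:
  assumes "path_in X a b l"
  shows "loop_class X l = loop_class X m \<longleftrightarrow> homotopic_paths X l m"
proof
  assume "loop_class X l = loop_class X m"
  moreover have "l \<in> loop_class X l" using homotopic_refl[OF assms] by (simp add: loop_class_def)
  ultimately have "homotopic_paths X m l" by (simp add: loop_class_def)
  then show "homotopic_paths X l m" by (rule homotopic_paths_sym)
next
  assume "homotopic_paths X l m"
  then show "loop_class X l = loop_class X m"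
    unfolding loop_class_def using homotopic_paths_trans homotopic_paths_sym by blast
qed

lemma carrier_fundamental_group:
  "carrier (fundamental_group X x) = {loop_class X l | l. path_in X x x l}"
  unfolding fundamental_group_def quotient_def based_loops_def loop_class_def path_in_def by auto

lemma mult_fundamental_group:
  assumes l: "path_in X x x l" and m: "path_in X x x m"
  shows "loop_class X l \<otimes>\<^bsub>fundamental_group X x\<^esub> loop_class X m = loop_class X (l +++ m)"
proof -
  have "homotopic_paths X (l +++ m) r"
    if "homotopic_paths X l q" "homotopic_paths X m s" "homotopic_paths X (q +++ s) r" for q s r
    using homotopic_join_cong[OF that(1,2) l m] that(3) by (rule homotopic_paths_trans)
  then have "{r. \<exists>q\<in>loop_class X l. \<exists>s\<in>loop_class X m. homotopic_paths X (q +++ s) r}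
      = loop_class X (l +++ m)"
    using homotopic_refl[OF l] homotopic_refl[OF m] unfolding loop_class_def by blast
  then show ?thesis by (simp add: fundamental_group_def)
qed

text \<open>For a simply connected covering, the fibre over a vertex is identified with the group. The point
marked by an element is the end of the lift of a loop representing its inverse, followed by a fixed path
to the vertex. The inverse turns the right multiplication that results from prolonging paths into a left
multiplication, which commutes with the shift.\<close>

locale marked_cover = covered_complex +
  fixes \<Gamma> :: "('g, 'm) monoid_scheme" (structure) and x0 e0 :: linfty and \<Phi> :: "'g \<Rightarrow> (real \<Rightarrow> linfty) set"
  assumes group: "group \<Gamma>" and sc: "simply_connected E"
    and e0: "e0 \<in> E" and pe0: "p e0 = x0"
    and iso: "\<Phi> \<in> iso \<Gamma> (fundamental_group (realization K) x0)"
begin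

abbreviation "X \<equiv> realization K"

definition lifts_to :: "(real \<Rightarrow> linfty) \<Rightarrow> linfty \<Rightarrow> bool" where
  "lifts_to q e \<longleftrightarrow> (\<exists>r. path_in E e0 e r \<and> (\<forall>t\<in>{0..1}. p (r t) = q t))"

lemma lifts_exist:
  assumes "path_in X x0 b q"
  obtains e where "lifts_to q e" "e \<in> E" "p e = b"
proof -
  obtain h where h: "path h" "path_image h \<subseteq> E" "pathstart h = e0" "\<And>t. t \<in> {0..1} \<Longrightarrow> p (h t) = q t"
    by (rule covering_space_lift_path_strong[OF cov e0, of q]) (use assms pe0 in \<open>auto simp: path_in_def\<close>)
  show thesis
  proof (rule that[of "pathfinish h"])
    show "lifts_to q (pathfinish h)" using h by (auto simp: lifts_to_def path_in_def)
    show "pathfinish h \<in> E" using h by blast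
    show "p (pathfinish h) = b" using h(4)[of 1] assms by (simp add: path_in_def pathfinish_def)
  qed
qed

lemma lifts_unique:
  assumes "lifts_to q e" "lifts_to q' e'" "homotopic_paths X q q'"
  shows "e = e'"
proof -
  obtain r r' where r: "path_in E e0 e r" "\<And>t. t \<in> {0..1} \<Longrightarrow> p (r t) = q t"
     "path_in E e0 e' r'" "\<And>t. t \<in> {0..1} \<Longrightarrow> p (r' t) = q' t"
    using assms(1,2) unfolding lifts_to_def by blast
  have "pathfinish r = pathfinish r'"
    by (rule covering_space_monodromy[OF cov _ _ _ _ assms(3)])
       (use r homotopic_paths_imp_path[OF assms(3)] homotopic_paths_imp_subset[OF assms(3)] in \<open>auto simp: path_in_def\<close>)
  then show ?thesis using r by (simp add: path_in_def)
qed

lemma lifts_homotopic: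
  assumes "lifts_to q e" "lifts_to q' e" "path q" "path q'"
  shows "homotopic_paths X q q'"
proof -
  obtain r r' where r: "path_in E e0 e r" "\<And>t. t \<in> {0..1} \<Longrightarrow> p (r t) = q t"
     "path_in E e0 e r'" "\<And>t. t \<in> {0..1} \<Longrightarrow> p (r' t) = q' t"
    using assms(1,2) unfolding lifts_to_def by blast
  have "homotopic_paths E r r'"
    using sc r(1,3) unfolding simply_connected_eq_homotopic_paths path_in_def by metis
  then have mid: "homotopic_paths X (p \<circ> r) (p \<circ> r')"
    by (rule homotopic_paths_continuous_image[OF _ covering_space_imp_continuous[OF cov]])
       (use covered_point in auto)
  have sub: "path_image (p \<circ> r) \<subseteq> X" "path_image (p \<circ> r') \<subseteq> X" "path (p \<circ> r)" "path (p \<circ> r')"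
    using homotopic_paths_imp_path[OF mid] homotopic_paths_imp_subset[OF mid] by auto
  have "homotopic_paths X (p \<circ> r) q" "homotopic_paths X (p \<circ> r') q'"
    by (rule homotopic_paths_eq[OF sub(3,1)], simp add: r(2),
        rule homotopic_paths_eq[OF sub(4,2)], simp add: r(4))
  then show ?thesis using mid homotopic_paths_sym homotopic_paths_trans by blast
qed

lemma every_point_is_lift:
  assumes "e \<in> E"
  obtains q where "lifts_to q e" "path_in X x0 (p e) q"
proof -
  have "path_connected E" using sc by (rule simply_connected_imp_path_connected)
  then obtain r where r: "path_in E e0 e r"
    using e0 assms unfolding path_connected_def path_in_def by blast
  show thesis
  proof (rule that[of "p \<circ> r"])
    show "lifts_to (p \<circ> r) e" using r by (auto simp: lifts_to_def)
    have "continuous_on (path_image r) p"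
      using r covering_space_imp_continuous[OF cov] continuous_on_subset by (auto simp: path_in_def)
    then have "path (p \<circ> r)" using r path_continuous_image by (auto simp: path_in_def)
    moreover have "path_image (p \<circ> r) \<subseteq> X"
      using r covered_point unfolding path_in_def path_image_compose by blast
    ultimately show "path_in X x0 (p e) (p \<circ> r)"
      using r pe0 by (simp add: path_in_def pathstart_compose pathfinish_compose)
  qed
qed

lemma edge_path:
  assumes "\<sigma> \<in> K" "v \<in> \<sigma>" "w \<in> \<sigma>"
  shows "path_in X (vertex v) (vertex w) (linepath (vertex v) (vertex w))"
proof -
  have "vertex v \<in> cell \<sigma>" "vertex w \<in> cell \<sigma>" using assms finite_simplex by auto
  then have "closed_segment (vertex v) (vertex w) \<subseteq> cell \<sigma>"
    by (rule closed_segment_subset[OF _ _ convex_cell])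
  then show ?thesis using cell_subset[OF assms(1)] by (auto simp: path_in_def)
qed

lemma lift_along_edge:
  assumes q: "lifts_to q e" "pathfinish q = vertex v" and s: "\<sigma> \<in> K" "v \<in> \<sigma>" "w \<in> \<sigma>"
  shows "lifts_to (q +++ linepath (vertex v) (vertex w)) (sheet \<sigma> e (vertex w))"
proof -
  obtain r where r: "path_in E e0 e r" "\<And>t. t \<in> {0..1} \<Longrightarrow> p (r t) = q t"
    using q unfolding lifts_to_def by blast
  let ?l = "linepath (vertex v) (vertex w)"
  have vw: "vertex v \<in> cell \<sigma>" "vertex w \<in> cell \<sigma>" using s finite_simplex by auto
  then have seg: "closed_segment (vertex v) (vertex w) \<subseteq> cell \<sigma>"
    by (rule closed_segment_subset[OF _ _ convex_cell])
  have e: "e \<in> E" using r(1) by (auto simp: path_in_def)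
  have pe: "p e = vertex v" using r(1) r(2)[of 1] q(2) by (simp add: path_in_def pathfinish_def)
  have sh: "is_section \<sigma> (sheet \<sigma> e)" "sheet \<sigma> e (vertex v) = e"
    using sheet[OF s(1) e] pe vw by simp_all
  have lin: "?l t \<in> cell \<sigma>" if "t \<in> {0..1}" for t
    using seg that by (metis linepath_in_path path_image_linepath subset_iff)
  have "path_in E e (sheet \<sigma> e (vertex w)) (sheet \<sigma> e \<circ> ?l)"
  proof -
    have "continuous_on (path_image ?l) (sheet \<sigma> e)"
      using sh(1) seg continuous_on_subset by (auto simp: is_section_def)
    then have "path (sheet \<sigma> e \<circ> ?l)" using path_continuous_image path_linepath by blast
    moreover have "path_image (sheet \<sigma> e \<circ> ?l) \<subseteq> E"
      using sh(1) seg unfolding path_image_compose by (auto simp: is_section_def)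
    ultimately show ?thesis using sh(2) by (simp add: path_in_def pathstart_compose pathfinish_compose)
  qed
  from path_in_join[OF r(1) this]
  have "path_in E e0 (sheet \<sigma> e (vertex w)) (r +++ (sheet \<sigma> e \<circ> ?l))" .
  moreover have "p ((r +++ (sheet \<sigma> e \<circ> ?l)) t) = (q +++ ?l) t" if "t \<in> {0..1}" for t
    using r(2)[of "2 * t"] lin[of "2 * t - 1"] sh(1) that
    by (auto simp: joinpaths_def is_section_def)
  ultimately show ?thesis unfolding lifts_to_def by blast
qed

definition spoke :: "nat \<Rightarrow> real \<Rightarrow> linfty" where
  "spoke v = (SOME q. path_in X x0 (vertex v) q)"

lemma spoke: "{v} \<in> K \<Longrightarrow> path_in X x0 (vertex v) (spoke v)"
proof -
  assume "{v} \<in> K"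
  then have "vertex v \<in> X" using cell_subset[of "{v}"] by auto
  then have "vertex v \<in> p ` E" using covering_space_imp_surjective[OF cov] by simp
  then obtain e where "e \<in> E" "p e = vertex v" by auto
  then have "\<exists>q. path_in X x0 (vertex v) q" using every_point_is_lift[of e] by auto
  then show ?thesis unfolding spoke_def by (rule someI_ex)
qed

definition represents :: "(real \<Rightarrow> linfty) \<Rightarrow> 'g \<Rightarrow> bool" where
  "represents l \<gamma> \<longleftrightarrow> path_in X x0 x0 l \<and> loop_class X l = \<Phi> (inv \<gamma>)"

lemma represents_exists:
  assumes "\<gamma> \<in> carrier \<Gamma>"
  obtains l where "represents l \<gamma>"
proof -
  have "\<Phi> (inv \<gamma>) \<in> carrier (fundamental_group X x0)"
    using iso assms group by (auto simp: iso_def hom_def Pi_iff)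
  then show thesis using that by (auto simp: carrier_fundamental_group represents_def)
qed

lemma represented:
  assumes "path_in X x0 x0 l"
  obtains \<gamma> where "\<gamma> \<in> carrier \<Gamma>" "represents l \<gamma>"
proof -
  have "loop_class X l \<in> carrier (fundamental_group X x0)"
    using assms by (auto simp: carrier_fundamental_group)
  then have "loop_class X l \<in> \<Phi> ` carrier \<Gamma>" using iso by (simp add: iso_def bij_betw_def)
  then obtain \<delta> where "\<delta> \<in> carrier \<Gamma>" "loop_class X l = \<Phi> \<delta>" by blast
  then show thesis using that[of "inv \<delta>"] assms group by (simp add: represents_def)
qed

lemma represents_homotopic:
  assumes "represents l \<gamma>" "represents m \<gamma>"
  shows "homotopic_paths X l m"
  using assms loop_class_eq[of X x0 x0 l m] by (simp add: represents_def)

lemma represents_inj: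
  assumes "represents l \<gamma>" "represents m \<delta>" "homotopic_paths X l m" "\<gamma> \<in> carrier \<Gamma>" "\<delta> \<in> carrier \<Gamma>"
  shows "\<gamma> = \<delta>"
proof -
  have "\<Phi> (inv \<gamma>) = \<Phi> (inv \<delta>)"
    using assms loop_class_eq[of X x0 x0 l m] by (simp add: represents_def)
  moreover have "inj_on \<Phi> (carrier \<Gamma>)" using iso by (simp add: iso_def bij_betw_def)
  ultimately have "inv \<gamma> = inv \<delta>" using assms(4,5) group by (auto dest: inj_onD)
  then show ?thesis using assms(4,5) group by (metis group.inv_inv)
qed

lemma represents_mult:
  assumes "represents l \<gamma>" "represents m \<delta>" "\<gamma> \<in> carrier \<Gamma>" "\<delta> \<in> carrier \<Gamma>"
  shows "represents (l +++ m) (\<delta> \<otimes> \<gamma>)"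
proof -
  have "\<Phi> (inv (\<delta> \<otimes> \<gamma>)) = \<Phi> (inv \<gamma> \<otimes> inv \<delta>)"
    using group assms(3,4) by (simp add: group.inv_mult_group)
  also have "\<dots> = \<Phi> (inv \<gamma>) \<otimes>\<^bsub>fundamental_group X x0\<^esub> \<Phi> (inv \<delta>)"
    using iso group assms(3,4) by (simp add: iso_def hom_def)
  also have "\<dots> = loop_class X (l +++ m)"
    using assms(1,2) mult_fundamental_group[of X x0 l m] by (simp add: represents_def)
  finally show ?thesis using assms(1,2) path_in_join[of X x0 x0 l x0 m] by (simp add: represents_def)
qed

definition mark :: "nat \<Rightarrow> 'g \<Rightarrow> linfty" where
  "mark v \<gamma> = (SOME e. \<exists>l. represents l \<gamma> \<and> lifts_to (l +++ spoke v) e)"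

lemma loop_spoke: "represents l \<gamma> \<Longrightarrow> {v} \<in> K \<Longrightarrow> path_in X x0 (vertex v) (l +++ spoke v)"
  unfolding represents_def by (rule path_in_join[OF conjunct1 spoke])

lemma lifts_mark:
  assumes "represents l \<gamma>" "{v} \<in> K"
  shows "lifts_to (l +++ spoke v) (mark v \<gamma>)" "mark v \<gamma> \<in> E" "p (mark v \<gamma>) = vertex v"
proof -
  obtain e where e: "lifts_to (l +++ spoke v) e" "e \<in> E" "p e = vertex v"
    using lifts_exist[OF loop_spoke[OF assms]] .
  then have "\<exists>e l. represents l \<gamma> \<and> lifts_to (l +++ spoke v) e" using assms(1) by blast
  from someI_ex[OF this] obtain m where m: "represents m \<gamma>" "lifts_to (m +++ spoke v) (mark v \<gamma>)"
    unfolding mark_def by blast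
  have "homotopic_paths X (l +++ spoke v) (m +++ spoke v)"
    by (rule homotopic_join_cong[OF represents_homotopic[OF assms(1) m(1)] homotopic_refl _ spoke])
       (use assms spoke[OF assms(2)] in \<open>auto simp: represents_def\<close>)
  then have "e = mark v \<gamma>" by (rule lifts_unique[OF e(1) m(2)])
  then show "lifts_to (l +++ spoke v) (mark v \<gamma>)" "mark v \<gamma> \<in> E" "p (mark v \<gamma>) = vertex v"
    using e by simp_all
qed

lemma mark_bij:
  assumes v: "{v} \<in> K"
  shows "bij_betw (mark v) (carrier \<Gamma>) {e \<in> E. p e = vertex v}"
  unfolding bij_betw_def
proof
  show "inj_on (mark v) (carrier \<Gamma>)"
  proof (rule inj_onI)
    fix \<gamma> \<delta> assume gd: "\<gamma> \<in> carrier \<Gamma>" "\<delta> \<in> carrier \<Gamma>" "mark v \<gamma> = mark v \<delta>"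
    obtain l where l: "represents l \<gamma>" by (rule represents_exists[OF gd(1)])
    obtain m where m: "represents m \<delta>" by (rule represents_exists[OF gd(2)])
    have hom: "homotopic_paths X (l +++ spoke v) (m +++ spoke v)"
      using lifts_mark(1)[OF l v] lifts_mark(1)[OF m v] gd(3) loop_spoke[OF l v] loop_spoke[OF m v]
      by (intro lifts_homotopic[of _ "mark v \<gamma>"]) (simp_all add: path_in_def)
    have "path_in X x0 x0 l" "path_in X x0 x0 m" using l m by (simp_all add: represents_def)
    then have "homotopic_paths X l m" by (rule homotopic_cancel_right[OF _ _ spoke[OF v] hom])
    then show "\<gamma> = \<delta>" by (rule represents_inj[OF l m _ gd(1,2)])
  qed
  show "mark v ` carrier \<Gamma> = {e \<in> E. p e = vertex v}"
  proof (intro equalityI subsetI)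
    fix e assume "e \<in> mark v ` carrier \<Gamma>"
    then obtain \<gamma> where g: "\<gamma> \<in> carrier \<Gamma>" "e = mark v \<gamma>" by blast
    obtain l where "represents l \<gamma>" by (rule represents_exists[OF g(1)])
    from lifts_mark(2,3)[OF this v] show "e \<in> {e \<in> E. p e = vertex v}" using g(2) by simp
  next
    fix e assume "e \<in> {e \<in> E. p e = vertex v}"
    then obtain q where q: "lifts_to q e" "path_in X x0 (vertex v) q"
      using every_point_is_lift[of e] by auto
    let ?l = "q +++ reversepath (spoke v)"
    have "path_in X x0 x0 ?l" using path_in_join[OF q(2) path_in_reverse[OF spoke[OF v]]] .
    then obtain \<gamma> where g: "\<gamma> \<in> carrier \<Gamma>" "represents ?l \<gamma>" by (rule represented)
    have "mark v \<gamma> = e"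
      by (rule lifts_unique[OF lifts_mark(1)[OF g(2) v] q(1) homotopic_cancel[OF q(2) spoke[OF v]]])
    then show "e \<in> mark v ` carrier \<Gamma>" using g(1) by blast
  qed
qed

text \<open>Passing from v to w inside a lifted cell prolongs the path by an edge. Up to homotopy this amounts to
multiplying the loop on the right by the fixed loop that goes to v along its path, across the edge, and
back from w.\<close>

lemma mark_transition:
  assumes s: "\<sigma> \<in> K" "v \<in> \<sigma>" "w \<in> \<sigma>"
  obtains g where "g \<in> carrier \<Gamma>"
    "\<And>\<gamma>. \<gamma> \<in> carrier \<Gamma> \<Longrightarrow> sheet \<sigma> (mark v \<gamma>) (vertex w) = mark w (g \<otimes> \<gamma>)"
proof -
  have v: "{v} \<in> K" and w: "{w} \<in> K" using face_in[OF s(1)] s by auto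
  let ?e = "linepath (vertex v) (vertex w)"
  note edge = edge_path[OF s] and av = spoke[OF v] and aw = spoke[OF w]
  (* The loop across the edge; its class gives the transition element. *)
  let ?b = "(spoke v +++ ?e) +++ reversepath (spoke w)"
  have b: "path_in X x0 x0 ?b" using path_in_join[OF path_in_join[OF av edge] path_in_reverse[OF aw]] .
  then obtain g where g: "g \<in> carrier \<Gamma>" "represents ?b g" by (rule represented)
  show thesis
  proof (rule that[OF g(1)])
    fix \<gamma> assume gam: "\<gamma> \<in> carrier \<Gamma>"
    obtain l where l: "represents l \<gamma>" using represents_exists[OF gam] .
    then have lp: "path_in X x0 x0 l" by (simp add: represents_def)
    have 1: "lifts_to ((l +++ spoke v) +++ ?e) (sheet \<sigma> (mark v \<gamma>) (vertex w))"
      by (rule lift_along_edge[OF lifts_mark(1)[OF l v] _ s]) (use loop_spoke[OF l v] in \<open>simp add: path_in_def\<close>)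
    have 2: "lifts_to ((l +++ ?b) +++ spoke w) (mark w (g \<otimes> \<gamma>))"
      by (rule lifts_mark(1)[OF represents_mult[OF l g(2) gam g(1)] w])
    have 3: "homotopic_paths X ((l +++ ?b) +++ spoke w) ((l +++ spoke v) +++ ?e)"
    proof -
      have "homotopic_paths X ((l +++ ?b) +++ spoke w) (l +++ (?b +++ spoke w))"
        using homotopic_assoc[OF lp b aw] by (rule homotopic_paths_sym)
      also have "homotopic_paths X (l +++ (?b +++ spoke w)) (l +++ (spoke v +++ ?e))"
        by (rule homotopic_join_cong[OF homotopic_refl[OF lp] homotopic_cancel[OF path_in_join[OF av edge] aw] lp path_in_join[OF b aw]])
      also have "homotopic_paths X (l +++ (spoke v +++ ?e)) ((l +++ spoke v) +++ ?e)"
        by (rule homotopic_assoc[OF lp av edge])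
      finally show ?thesis .
    qed
    show "sheet \<sigma> (mark v \<gamma>) (vertex w) = mark w (g \<otimes> \<gamma>)"
      by (rule lifts_unique[OF 1 2 homotopic_paths_sym[OF 3]])
  qed
qed

end

section \<open>Entropy of linear cellular automata\<close>

text \<open>The alphabets have to be groups of natural numbers. The group of all bit vectors indexed by I
is therefore transported along an enumeration of its elements; a vector is first cut off outside I,
which makes the coding independent of values outside I.\<close>

definition bit_vectors :: "'i set \<Rightarrow> ('i \<Rightarrow> bit) set" where
  "bit_vectors I = {w. \<forall>i. i \<notin> I \<longrightarrow> w i = 0}"

definition vector_code :: "'i set \<Rightarrow> ('i \<Rightarrow> bit) \<Rightarrow> nat" where
  "vector_code I w = to_nat_on (bit_vectors I) (\<lambda>i. if i \<in> I then w i else 0)"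

definition code_vector :: "'i set \<Rightarrow> nat \<Rightarrow> 'i \<Rightarrow> bit" where
  "code_vector I n = from_nat_into (bit_vectors I) n"

definition vector_group :: "'i set \<Rightarrow> nat monoid" where
  "vector_group I = \<lparr>carrier = range (vector_code I),
     monoid.mult = (\<lambda>m n. vector_code I (\<lambda>i. code_vector I m i + code_vector I n i)),
     one = vector_code I (\<lambda>i. 0)\<rparr>"

lemma card_bit_vectors:
  assumes "finite I"
  shows "finite (bit_vectors I)" "card (bit_vectors I) = 2 ^ card I"
proof -
  have "bij_betw (\<lambda>w. {i. w i = 1}) (bit_vectors I) (Pow I)"
    by (rule bij_betw_byWitness[where f' = "\<lambda>S i. if i \<in> S then 1 else 0"])
       (auto simp: bit_vectors_def fun_eq_iff)
  then show "finite (bit_vectors I)" "card (bit_vectors I) = 2 ^ card I"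
    using assms bij_betw_finite bij_betw_same_card by (fastforce simp: card_Pow)+
qed

lemma code_vector_code:
  assumes "finite I"
  shows "code_vector I (vector_code I w) = (\<lambda>i. if i \<in> I then w i else 0)"
  unfolding code_vector_def vector_code_def
  by (rule from_nat_into_to_nat_on[OF countable_finite[OF card_bit_vectors(1)[OF assms]]])
     (simp add: bit_vectors_def)

lemma vector_code_cong: "(\<And>i. i \<in> I \<Longrightarrow> v i = w i) \<Longrightarrow> vector_code I v = vector_code I w"
  unfolding vector_code_def by (intro arg_cong[of _ _ "to_nat_on (bit_vectors I)"] ext) simp

lemma vector_code_eq_iff:
  assumes "finite I"
  shows "vector_code I v = vector_code I w \<longleftrightarrow> (\<forall>i\<in>I. v i = w i)"
proof
  assume "vector_code I v = vector_code I w"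
  then have "code_vector I (vector_code I v) = code_vector I (vector_code I w)" by simp
  then show "\<forall>i\<in>I. v i = w i" unfolding code_vector_code[OF assms] by (metis (full_types))
qed (auto intro: vector_code_cong)

lemma carrier_vector_group: "n \<in> carrier (vector_group I) \<longleftrightarrow> (\<exists>w. n = vector_code I w)"
  by (auto simp: vector_group_def)

lemma mult_vector_group:
  assumes "finite I"
  shows "vector_code I v \<otimes>\<^bsub>vector_group I\<^esub> vector_code I w = vector_code I (\<lambda>i. v i + w i)"
  unfolding vector_group_def monoid.simps code_vector_code[OF assms] by (rule vector_code_cong) simp

lemma one_vector_group: "\<one>\<^bsub>vector_group I\<^esub> = vector_code I (\<lambda>i. 0)"
  by (simp add: vector_group_def)

lemma vector_group_finite_abelian:
  assumes "finite I"
  shows "finite_abelian_group (vector_group I)" "card (carrier (vector_group I)) = 2 ^ card I"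
proof -
  note m = mult_vector_group[OF assms] and c = carrier_vector_group and o = one_vector_group
  have "comm_group (vector_group I)"
  proof (rule comm_groupI)
    fix x assume "x \<in> carrier (vector_group I)"
    then obtain w where w: "x = vector_code I w" by (auto simp: c)
    have "x \<otimes>\<^bsub>vector_group I\<^esub> x = \<one>\<^bsub>vector_group I\<^esub>" unfolding w m o by (rule vector_code_cong) (rule bit_add_self)
    then show "\<exists>y\<in>carrier (vector_group I). y \<otimes>\<^bsub>vector_group I\<^esub> x = \<one>\<^bsub>vector_group I\<^esub>" using w c by blast
  qed (auto simp: c m o intro!: vector_code_cong simp: ac_simps)
  moreover have car: "carrier (vector_group I) = to_nat_on (bit_vectors I) ` bit_vectors I"
  proof (intro equalityI subsetI)
    fix n assume "n \<in> to_nat_on (bit_vectors I) ` bit_vectors I"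
    then obtain w where w: "w \<in> bit_vectors I" "n = to_nat_on (bit_vectors I) w" by blast
    have "(\<lambda>i. if i \<in> I then w i else 0) = w" using w(1) by (auto simp: bit_vectors_def)
    then have "n = vector_code I w" by (simp add: vector_code_def w(2))
    then show "n \<in> carrier (vector_group I)" by (auto simp: c)
  qed (auto simp: c vector_code_def bit_vectors_def)
  ultimately show "finite_abelian_group (vector_group I)"
    using card_bit_vectors(1)[OF assms] by (simp add: finite_abelian_group_def)
  show "card (carrier (vector_group I)) = 2 ^ card I"
    unfolding car using card_bit_vectors[OF assms] by (simp add: card_image inj_on_to_nat_on countable_finite)
qed

lemma set_eq_via_range:
  assumes "A \<subseteq> range f" "B \<subseteq> range f" "\<And>c. f c \<in> A \<longleftrightarrow> f c \<in> B"
  shows "A = B"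
proof (rule Set.set_eqI)
  fix x
  show "x \<in> A \<longleftrightarrow> x \<in> B"
  proof (cases "x \<in> range f")
    case True then show ?thesis using assms(3) by blast
  next
    case False then show ?thesis using assms(1,2) by blast
  qed
qed

locale bit_shifts =
  fixes \<Gamma> :: "('g, 'm) monoid_scheme" (structure)
  assumes group: "group \<Gamma>"
begin

definition configuration :: "'i set \<Rightarrow> ('i \<Rightarrow> 'g \<Rightarrow> bit) \<Rightarrow> 'g \<Rightarrow> nat" where
  "configuration I u = (\<lambda>\<gamma>\<in>carrier \<Gamma>. vector_code I (\<lambda>i. u i \<gamma>))"

definition cochain :: "'i set \<Rightarrow> ('g \<Rightarrow> nat) \<Rightarrow> 'i \<Rightarrow> 'g \<Rightarrow> bit" where
  "cochain I \<tau> i \<gamma> = code_vector I (\<tau> \<gamma>) i"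

abbreviation "config_space I \<equiv> full_shift \<Gamma> (vector_group I)"

lemma configuration_eq_iff:
  assumes "finite I"
  shows "configuration I u = configuration I v \<longleftrightarrow> (\<forall>i\<in>I. \<forall>\<gamma>\<in>carrier \<Gamma>. u i \<gamma> = v i \<gamma>)"
proof
  assume eq: "configuration I u = configuration I v"
  show "\<forall>i\<in>I. \<forall>\<gamma>\<in>carrier \<Gamma>. u i \<gamma> = v i \<gamma>"
  proof (intro ballI)
    fix i \<gamma> assume "i \<in> I" "\<gamma> \<in> carrier \<Gamma>"
    then show "u i \<gamma> = v i \<gamma>"
      using fun_cong[OF eq, of \<gamma>] vector_code_eq_iff[OF assms, of "\<lambda>i. u i \<gamma>" "\<lambda>i. v i \<gamma>"]
      by (simp add: configuration_def)
  qed
qed (auto simp: configuration_def intro!: restrict_ext vector_code_cong)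

lemma carrier_config_space: "carrier (config_space I) = range (configuration I)"
proof (intro equalityI subsetI)
  fix \<tau> assume t: "\<tau> \<in> carrier (config_space I)"
  then have "\<forall>\<gamma>\<in>carrier \<Gamma>. \<exists>w. \<tau> \<gamma> = vector_code I w"
    by (auto simp: full_shift_def PiE_iff carrier_vector_group)
  then obtain w where w: "\<And>\<gamma>. \<gamma> \<in> carrier \<Gamma> \<Longrightarrow> \<tau> \<gamma> = vector_code I (w \<gamma>)" by metis
  have "\<tau> = configuration I (\<lambda>i \<gamma>. w \<gamma> i)"
    using t w by (intro ext) (auto simp: configuration_def full_shift_def PiE_iff extensional_def restrict_def)
  then show "\<tau> \<in> range (configuration I)" by blast
qed (auto simp: full_shift_def configuration_def carrier_vector_group)

lemma cochain_configuration:
  assumes "finite I" "\<gamma> \<in> carrier \<Gamma>"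
  shows "cochain I (configuration I u) i \<gamma> = (if i \<in> I then u i \<gamma> else 0)"
  using assms by (simp add: cochain_def configuration_def code_vector_code)

lemma mult_config_space:
  assumes "finite I"
  shows "configuration I u \<otimes>\<^bsub>config_space I\<^esub> configuration I v = configuration I (\<lambda>i \<gamma>. u i \<gamma> + v i \<gamma>)"
  unfolding full_shift_def mult_product_group configuration_def
  by (rule restrict_ext) (simp add: mult_vector_group[OF assms])

lemma one_config_space: "\<one>\<^bsub>config_space I\<^esub> = configuration I (\<lambda>i \<gamma>. 0)"
  by (simp add: full_shift_def configuration_def one_vector_group)

lemma shift_configuration:
  assumes "\<delta> \<in> carrier \<Gamma>"
  shows "shift \<Gamma> \<delta> (configuration I u) = configuration I (\<lambda>i \<gamma>. u i (\<gamma> \<otimes> \<delta>))"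
  unfolding shift_def configuration_def
  using assms group by (intro restrict_ext) (simp add: group.is_monoid monoid.m_closed)

lemma group_config_space: "finite I \<Longrightarrow> Group.group (config_space I)"
  unfolding full_shift_def
  by (rule product_group) (use vector_group_finite_abelian in \<open>auto simp: finite_abelian_group_def comm_group_def\<close>)

text \<open>A matrix over the group ring of the group with coefficients in the field of two elements: the entry
in row j and column i is the formal sum of the elements g with (i, g) in M j. It acts from the
left, and this commutes with shifts, which act from the right.\<close>

definition matrix :: "'i set \<Rightarrow> 'j set \<Rightarrow> ('j \<Rightarrow> ('i \<times> 'g) set) \<Rightarrow> bool" where
  "matrix I J M \<longleftrightarrow> finite I \<and> finite J \<and> (\<forall>j\<in>J. finite (M j) \<and> M j \<subseteq> I \<times> carrier \<Gamma>)"

definition mat_apply :: "('j \<Rightarrow> ('i \<times> 'g) set) \<Rightarrow> ('i \<Rightarrow> 'g \<Rightarrow> bit) \<Rightarrow> 'j \<Rightarrow> 'g \<Rightarrow> bit" where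
  "mat_apply M u j \<gamma> = (\<Sum>(i, g)\<in>M j. u i (g \<otimes> \<gamma>))"

definition automaton :: "'i set \<Rightarrow> 'j set \<Rightarrow> ('j \<Rightarrow> ('i \<times> 'g) set) \<Rightarrow> ('g \<Rightarrow> nat) \<Rightarrow> 'g \<Rightarrow> nat" where
  "automaton I J M \<tau> = configuration J (mat_apply M (cochain I \<tau>))"

lemma mat_apply_cong:
  assumes "matrix I J M" "j \<in> J" "\<gamma> \<in> carrier \<Gamma>"
    and "\<And>i \<gamma>. i \<in> I \<Longrightarrow> \<gamma> \<in> carrier \<Gamma> \<Longrightarrow> u i \<gamma> = v i \<gamma>"
  shows "mat_apply M u j \<gamma> = mat_apply M v j \<gamma>"
  unfolding mat_apply_def
  using assms group by (intro sum.cong refl) (auto simp: matrix_def group.is_monoid monoid.m_closed subset_iff)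

lemma automaton_configuration:
  assumes "matrix I J M"
  shows "automaton I J M (configuration I u) = configuration J (mat_apply M u)"
proof -
  have "finite I" "finite J" using assms by (auto simp: matrix_def)
  then show ?thesis
    unfolding automaton_def configuration_eq_iff[OF \<open>finite J\<close>]
    by (intro ballI mat_apply_cong[OF assms]) (simp_all add: cochain_configuration)
qed

lemma mat_apply_add: "mat_apply M (\<lambda>i \<gamma>. u i \<gamma> + v i \<gamma>) j \<gamma> = mat_apply M u j \<gamma> + mat_apply M v j \<gamma>"
  unfolding mat_apply_def by (simp only: case_prod_unfold sum.distrib)

lemma automaton_hom:
  assumes "matrix I J M"
  shows "group_hom (config_space I) (config_space J) (automaton I J M)"
proof -
  have fin: "finite I" "finite J" using assms by (auto simp: matrix_def)
  have "automaton I J M \<in> hom (config_space I) (config_space J)"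
  proof (rule homI)
    fix \<tau> \<tau>' assume "\<tau> \<in> carrier (config_space I)" "\<tau>' \<in> carrier (config_space I)"
    then obtain u v where uv: "\<tau> = configuration I u" "\<tau>' = configuration I v"
      by (auto simp: carrier_config_space)
    have "configuration J (mat_apply M (\<lambda>i \<gamma>. u i \<gamma> + v i \<gamma>))
        = configuration J (\<lambda>j \<gamma>. mat_apply M u j \<gamma> + mat_apply M v j \<gamma>)"
      by (intro arg_cong[of _ _ "configuration J"] ext mat_apply_add)
    then show "automaton I J M (\<tau> \<otimes>\<^bsub>config_space I\<^esub> \<tau>')
        = automaton I J M \<tau> \<otimes>\<^bsub>config_space J\<^esub> automaton I J M \<tau>'"
      by (simp only: uv mult_config_space[OF fin(1)] mult_config_space[OF fin(2)] automaton_configuration[OF assms])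
  qed (auto simp: carrier_config_space automaton_configuration[OF assms])
  then show ?thesis
    using group_config_space[OF fin(1)] group_config_space[OF fin(2)] by (simp add: group_hom_def group_hom_axioms_def)
qed

lemma automaton_equivariant:
  assumes "matrix I J M" "\<tau> \<in> carrier (config_space I)" "\<delta> \<in> carrier \<Gamma>"
  shows "automaton I J M (shift \<Gamma> \<delta> \<tau>) = shift \<Gamma> \<delta> (automaton I J M \<tau>)"
proof -
  have fin: "finite I" "finite J" using assms by (auto simp: matrix_def)
  obtain u where u: "\<tau> = configuration I u" using assms(2) by (auto simp: carrier_config_space)
  show ?thesis
    unfolding u shift_configuration[OF assms(3)] automaton_configuration[OF assms(1)] configuration_eq_iff[OF fin(2)]
    unfolding mat_apply_def using assms(1,3) group
    by (intro ballI sum.cong refl) (auto simp: matrix_def group.is_monoid monoid.m_assoc subset_iff)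
qed

lemma topspace_config: "topspace (full_shift_topology \<Gamma> S) = carrier (full_shift \<Gamma> S)"
  by (simp add: full_shift_topology_def full_shift_def)

text \<open>A symbol of the image configuration depends on finitely many symbols of the configuration.\<close>

lemma automaton_continuous:
  assumes "matrix I J M"
  shows "continuous_map (full_shift_topology \<Gamma> (vector_group I)) (full_shift_topology \<Gamma> (vector_group J)) (automaton I J M)"
proof -
  let ?X = "full_shift_topology \<Gamma> (vector_group I)"
  interpret G: group_hom "config_space I" "config_space J" "automaton I J M" by (rule automaton_hom[OF assms])
  have fin: "finite I" "finite J" using assms by (auto simp: matrix_def)
  have car: "automaton I J M \<tau> \<in> (\<Pi>\<^sub>E i\<in>carrier \<Gamma>. carrier (vector_group J))" if "\<tau> \<in> topspace ?X" for \<tau>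
  proof -
    have "automaton I J M \<tau> \<in> carrier (config_space J)"
      using G.hom_closed[of \<tau>] that by (simp add: topspace_config)
    then show ?thesis by (simp add: full_shift_def)
  qed
  have "continuous_map ?X (discrete_topology (carrier (vector_group J))) (\<lambda>\<tau>. automaton I J M \<tau> \<gamma>)"
    if \<gamma>: "\<gamma> \<in> carrier \<Gamma>" for \<gamma>
  proof -
    (* The finite window on which the symbol at the given position depends. *)
    define F where "F = (\<lambda>(i, g). g \<otimes> \<gamma>) ` (\<Union>j\<in>J. M j)"
    have F: "finite F" "F \<subseteq> carrier \<Gamma>"
      unfolding F_def using assms fin \<gamma> group
      by (auto simp: matrix_def group.is_monoid monoid.m_closed subset_iff) 
    have loc: "automaton I J M \<tau> \<gamma> = automaton I J M \<tau>' \<gamma>" if "\<And>g. g \<in> F \<Longrightarrow> \<tau> g = \<tau>' g" for \<tau> \<tau>'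
    proof -
      have "mat_apply M (cochain I \<tau>) j \<gamma> = mat_apply M (cochain I \<tau>') j \<gamma>" if "j \<in> J" for j
        unfolding mat_apply_def cochain_def
        by (intro sum.cong refl) (use that \<open>\<And>g. g \<in> F \<Longrightarrow> \<tau> g = \<tau>' g\<close> in \<open>force simp: F_def\<close>)
      then show ?thesis using \<gamma> by (auto simp: automaton_def configuration_def intro: vector_code_cong)
    qed
    have "openin ?X {\<tau> \<in> topspace ?X. automaton I J M \<tau> \<gamma> \<in> U}" for U
    proof (subst openin_subopen, intro ballI)
      fix \<tau> assume t: "\<tau> \<in> {\<tau> \<in> topspace ?X. automaton I J M \<tau> \<gamma> \<in> U}"
      define T where "T = (\<Pi>\<^sub>E g\<in>carrier \<Gamma>. if g \<in> F then {\<tau> g} else carrier (vector_group I))"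
      have tc: "\<tau> \<in> (\<Pi>\<^sub>E g\<in>carrier \<Gamma>. carrier (vector_group I))"
        using t by (simp add: full_shift_topology_def)
      have "openin ?X T"
        unfolding T_def full_shift_topology_def openin_PiE_gen using F tc
        by (intro disjI2 conjI ballI) (auto intro: finite_subset[OF _ F(1)] simp: PiE_iff)
      moreover have "\<tau> \<in> T" using tc by (auto simp: T_def PiE_iff)
      moreover have "T \<subseteq> {\<tau> \<in> topspace ?X. automaton I J M \<tau> \<gamma> \<in> U}"
      proof
        fix \<tau>' assume t': "\<tau>' \<in> T"
        have "\<tau>' g \<in> carrier (vector_group I)" if "g \<in> carrier \<Gamma>" for g
          using t' tc that by (cases "g \<in> F") (auto simp: T_def PiE_iff)
        then have "\<tau>' \<in> topspace ?X"
          using t' by (auto simp: T_def full_shift_topology_def PiE_iff)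
        moreover have "\<tau> g = \<tau>' g" if "g \<in> F" for g
        proof -
          have "\<tau>' g \<in> (if g \<in> F then {\<tau> g} else carrier (vector_group I))"
            using t' subsetD[OF F(2) that] unfolding T_def by (rule PiE_mem)
          then show ?thesis using that by simp
        qed
        then have "automaton I J M \<tau> \<gamma> = automaton I J M \<tau>' \<gamma>" by (rule loc)
        ultimately show "\<tau>' \<in> {\<tau> \<in> topspace ?X. automaton I J M \<tau> \<gamma> \<in> U}" using t by simp
      qed
      ultimately show "\<exists>T. openin ?X T \<and> \<tau> \<in> T \<and> T \<subseteq> {\<tau> \<in> topspace ?X. automaton I J M \<tau> \<gamma> \<in> U}" by blast
    qed
    moreover have "automaton I J M \<tau> \<gamma> \<in> carrier (vector_group J)" if "\<tau> \<in> topspace ?X" for \<tau>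
      using car[OF that] \<gamma> by auto
    ultimately show ?thesis by (auto simp: continuous_map_def)
  qed
  then show ?thesis
    unfolding full_shift_topology_def[of _ "vector_group J"] continuous_map_componentwise
    using car by (auto simp: PiE_iff)
qed

lemma Hausdorff_full_shift: "Hausdorff_space (full_shift_topology \<Gamma> S)"
  by (simp add: full_shift_topology_def Hausdorff_space_product_topology)

lemma shift_closed:
  assumes "\<tau> \<in> carrier (config_space I)" "\<delta> \<in> carrier \<Gamma>"
  shows "shift \<Gamma> \<delta> \<tau> \<in> carrier (config_space I)"
  using assms by (auto simp: carrier_config_space shift_configuration)

definition kernel_shift :: "'i set \<Rightarrow> 'j set \<Rightarrow> ('j \<Rightarrow> ('i \<times> 'g) set) \<Rightarrow> ('g \<Rightarrow> nat) set" where
  "kernel_shift I J M = kernel (config_space I) (config_space J) (automaton I J M)"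

lemma shift_one: "\<delta> \<in> carrier \<Gamma> \<Longrightarrow> shift \<Gamma> \<delta> \<one>\<^bsub>config_space I\<^esub> = \<one>\<^bsub>config_space I\<^esub>"
  by (simp add: one_config_space shift_configuration)

lemma linear_subshift_full:
  assumes "finite I"
  shows "linear_subshift \<Gamma> (vector_group I) (carrier (config_space I))"
  unfolding linear_subshift_def
  using vector_group_finite_abelian(1)[OF assms] group.subgroup_self[OF group_config_space[OF assms]] shift_closed[of _ I]
    closedin_topspace[of "full_shift_topology \<Gamma> (vector_group I)"]
  by (simp add: topspace_config)

text \<open>The kernel is closed because it is the preimage of a point of a Hausdorff space.\<close>

lemma linear_subshift_kernel:
  assumes "matrix I J M"
  shows "linear_subshift \<Gamma> (vector_group I) (kernel_shift I J M)"
proof -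
  have fin: "finite I" "finite J" using assms by (auto simp: matrix_def)
  interpret G: group_hom "config_space I" "config_space J" "automaton I J M" by (rule automaton_hom[OF assms])
  have "\<one>\<^bsub>config_space J\<^esub> \<in> topspace (full_shift_topology \<Gamma> (vector_group J))"
    using G.H.one_closed by (simp add: topspace_config)
  then have "closedin (full_shift_topology \<Gamma> (vector_group J)) {\<one>\<^bsub>config_space J\<^esub>}"
    using closedin_Hausdorff_sing_eq[OF Hausdorff_full_shift] by blast
  from closedin_continuous_map_preimage[OF automaton_continuous[OF assms] this]
  have "closedin (full_shift_topology \<Gamma> (vector_group I)) (kernel_shift I J M)"
    by (simp add: kernel_shift_def kernel_def topspace_config)
  then show ?thesis
    unfolding linear_subshift_def using vector_group_finite_abelian(1)[OF fin(1)] G.subgroup_kernel shift_closed[of _ I]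
    by (auto simp: kernel_shift_def kernel_def automaton_equivariant[OF assms] shift_one)
qed

lemma linear_subshift_finite_image:
  assumes "matrix I J M" "linear_subshift \<Gamma> (vector_group I) \<phi>" "finite (automaton I J M ` \<phi>)"
  shows "linear_subshift \<Gamma> (vector_group J) (automaton I J M ` \<phi>)"
proof -
  have fin: "finite I" "finite J" using assms by (auto simp: matrix_def)
  interpret G: group_hom "config_space I" "config_space J" "automaton I J M" by (rule automaton_hom[OF assms(1)])
  have sub: "subgroup \<phi> (config_space I)" using assms(2) by (simp add: linear_subshift_def)
  then have car: "\<phi> \<subseteq> carrier (config_space I)" by (rule subgroup.subset)
  then have "automaton I J M ` \<phi> \<subseteq> topspace (full_shift_topology \<Gamma> (vector_group J))"
    using G.hom_closed by (auto simp: topspace_config)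
  then have "closedin (full_shift_topology \<Gamma> (vector_group J)) (automaton I J M ` \<phi>)"
    using assms(3) by (intro compactin_imp_closedin[OF Hausdorff_full_shift] finite_imp_compactin)
  moreover have "shift \<Gamma> \<delta> (automaton I J M \<tau>) \<in> automaton I J M ` \<phi>" if "\<tau> \<in> \<phi>" "\<delta> \<in> carrier \<Gamma>" for \<tau> \<delta>
  proof (rule image_eqI)
    show "shift \<Gamma> \<delta> (automaton I J M \<tau>) = automaton I J M (shift \<Gamma> \<delta> \<tau>)"
      using automaton_equivariant[OF assms(1), of \<tau> \<delta>] that car by auto
    show "shift \<Gamma> \<delta> \<tau> \<in> \<phi>" using that assms(2) by (simp add: linear_subshift_def)
  qed
  ultimately show ?thesis
    unfolding linear_subshift_def using vector_group_finite_abelian(1)[OF fin(2)] G.subgroup_img_is_subgroup[OF sub]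
    by auto
qed

lemma entropy_additive:
  assumes h: "entropy \<Gamma> h" and M: "matrix I J M"
    and phi: "linear_subshift \<Gamma> (vector_group I) \<phi>"
    and psi: "linear_subshift \<Gamma> (vector_group J) (automaton I J M ` \<phi>)"
  shows "h (vector_group I) (\<phi> \<inter> kernel_shift I J M) + h (vector_group J) (automaton I J M ` \<phi>) = h (vector_group I) \<phi>"
proof -
  interpret G: group_hom "config_space I" "config_space J" "automaton I J M" by (rule automaton_hom[OF M])
  let ?T = "automaton I J M"
  let ?G = "subshift_group \<Gamma> (vector_group I) \<phi>" and ?H = "subshift_group \<Gamma> (vector_group J) (?T ` \<phi>)"
  have car: "\<phi> \<subseteq> carrier (config_space I)" using phi subgroup.subset by (auto simp: linear_subshift_def)
  have 1: "?T \<in> hom ?G ?H"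
    unfolding subshift_group_def
    by (rule homI) (use car in \<open>auto intro: G.hom_mult\<close>)
  have 2: "continuous_map (subshift_topology \<Gamma> (vector_group I) \<phi>) (subshift_topology \<Gamma> (vector_group J) (?T ` \<phi>)) ?T"
    unfolding subshift_topology_def
    using continuous_map_from_subtopology[OF automaton_continuous[OF M], of \<phi>]
    by (auto simp: continuous_map_in_subtopology)
  have 3: "shift_equivariant \<Gamma> \<phi> ?T"
    unfolding shift_equivariant_def using automaton_equivariant[OF M] car by blast
  have "kernel ?G ?H ?T = \<phi> \<inter> kernel_shift I J M"
    using car by (auto simp: kernel_def kernel_shift_def subshift_group_def)
  then show ?thesis
    using h[unfolded entropy_def, THEN conjunct2, THEN conjunct2, THEN conjunct2, THEN conjunct2,
        rule_format, of "vector_group I" \<phi> "vector_group J" "?T ` \<phi>" ?T] phi psi 1 2 3 by simp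
qed

lemma entropy_full:
  assumes "entropy \<Gamma> h" "finite I"
  shows "h (vector_group I) (carrier (config_space I)) = card I"
  using assms(1)[unfolded entropy_def, THEN conjunct1, rule_format, OF vector_group_finite_abelian(1)[OF assms(2)]]
  by (simp add: vector_group_finite_abelian(2)[OF assms(2)] log_nat_power)

lemma entropy_finite:
  assumes "entropy \<Gamma> h" "linear_subshift \<Gamma> S \<phi>" "finite \<phi>"
  shows "h S \<phi> = 0"
  using assms(1)[unfolded entropy_def, THEN conjunct2, THEN conjunct2, THEN conjunct2, THEN conjunct1] assms(2,3) by blast

text \<open>The rank-nullity formula for entropy. The image is required to be a kernel, as this shows that it is
a closed subgroup.\<close>

lemma rank_eq:
  assumes h: "entropy \<Gamma> h" and M: "matrix I J M" and N: "matrix J I' N"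
    and exact: "automaton I J M ` carrier (config_space I) = kernel_shift J I' N"
  shows "h (vector_group I) (kernel_shift I J M) + h (vector_group J) (kernel_shift J I' N) = card I"
proof -
  have fin: "finite I" using M by (simp add: matrix_def)
  have "carrier (config_space I) \<inter> kernel_shift I J M = kernel_shift I J M"
    by (auto simp: kernel_shift_def kernel_def)
  then show ?thesis
    using entropy_additive[OF h M linear_subshift_full[OF fin]] linear_subshift_kernel[OF N] entropy_full[OF h fin]
    by (simp add: exact)
qed

lemma configuration_in_kernel:
  assumes "matrix I J M"
  shows "configuration I u \<in> kernel_shift I J M \<longleftrightarrow> (\<forall>j\<in>J. \<forall>\<gamma>\<in>carrier \<Gamma>. mat_apply M u j \<gamma> = 0)"
proof -
  have fin: "finite J" using assms by (simp add: matrix_def)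
  show ?thesis
    by (simp add: kernel_shift_def kernel_def carrier_config_space automaton_configuration[OF assms]
        one_config_space configuration_eq_iff[OF fin])
qed

lemma exact_image:
  assumes M: "matrix I J M" and N: "matrix J I' N"
    and "\<And>c. (\<forall>i\<in>I'. \<forall>\<gamma>\<in>carrier \<Gamma>. mat_apply N c i \<gamma> = 0) \<longleftrightarrow>
         (\<exists>b. \<forall>j\<in>J. \<forall>\<gamma>\<in>carrier \<Gamma>. c j \<gamma> = mat_apply M b j \<gamma>)"
  shows "automaton I J M ` carrier (config_space I) = kernel_shift J I' N"
proof -
  have fin: "finite J" using M by (simp add: matrix_def)
  have "configuration J c \<in> automaton I J M ` carrier (config_space I) \<longleftrightarrow> configuration J c \<in> kernel_shift J I' N" for c
    unfolding configuration_in_kernel[OF N] assms(3) configuration_eq_iff[OF fin, symmetric]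
    by (auto simp: carrier_config_space image_iff automaton_configuration[OF M])
  moreover have "automaton I J M ` carrier (config_space I) \<subseteq> range (configuration J)"
    by (auto simp: carrier_config_space automaton_configuration[OF M])
  moreover have "kernel_shift J I' N \<subseteq> range (configuration J)"
    by (auto simp: kernel_shift_def kernel_def carrier_config_space)
  ultimately show ?thesis by (intro set_eq_via_range[of _ "configuration J"])
qed

text \<open>A two-periodic complex of full shifts that is exact up to a finite defect has Euler characteristic zero.
In the application I and J index the cells of even and of odd dimension and I0 the vertices. The kernel
of M exceeds the image of N by the locally constant functions on the vertices. They form a finite
subshift, which has entropy zero; so the kernel of M and the image of N have the same entropy. The image of
N is itself a kernel, of the matrix M' that records also the values on I0.\<close>

theorem exact_pair_card_eq:
  fixes I J I0 :: "'i set"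
  assumes h: "entropy \<Gamma> h" and M: "matrix I J M" and N: "matrix J I N" and I0: "I0 \<subseteq> I" and disj: "I \<inter> J = {}"
    and exact1: "\<And>c. (\<forall>i\<in>I. \<forall>\<gamma>\<in>carrier \<Gamma>. mat_apply N c i \<gamma> = 0) \<longleftrightarrow>
         (\<exists>b. \<forall>j\<in>J. \<forall>\<gamma>\<in>carrier \<Gamma>. c j \<gamma> = mat_apply M b j \<gamma>)"
    and exact2: "\<And>c. (\<forall>j\<in>J. \<forall>\<gamma>\<in>carrier \<Gamma>. mat_apply M c j \<gamma> = 0) \<and> (\<forall>i\<in>I0. \<forall>\<gamma>\<in>carrier \<Gamma>. c i \<gamma> = 0) \<longleftrightarrow>
         (\<exists>b. \<forall>i\<in>I. \<forall>\<gamma>\<in>carrier \<Gamma>. c i \<gamma> = mat_apply N b i \<gamma>)"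
    and const: "\<And>c. (\<forall>j\<in>J. \<forall>\<gamma>\<in>carrier \<Gamma>. mat_apply M c j \<gamma> = 0) \<Longrightarrow> \<exists>a. \<forall>i\<in>I0. \<forall>\<gamma>\<in>carrier \<Gamma>. c i \<gamma> = a"
  shows "card I = card J"
proof -
  have fin: "finite I" "finite J" "finite I0" using M I0 finite_subset by (auto simp: matrix_def)
  have one: "\<one> \<in> carrier \<Gamma>" and l_one: "\<And>\<gamma>. \<gamma> \<in> carrier \<Gamma> \<Longrightarrow> \<one> \<otimes> \<gamma> = \<gamma>"
    using group by (auto simp: group.is_monoid monoid.one_closed monoid.l_one)
  define R where "R i = {(i, \<one>)}" for i :: 'i
  define M' where "M' j = (if j \<in> J then M j else R j)" for j
  have R: "matrix I I0 R" using fin I0 one by (auto simp: matrix_def R_def)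
  have M': "matrix I (J \<union> I0) M'" using fin I0 one M by (auto simp: matrix_def R_def M'_def)
  have applyR: "mat_apply R c i \<gamma> = c i \<gamma>" if "\<gamma> \<in> carrier \<Gamma>" for c i \<gamma>
    using l_one[OF that] by (simp add: mat_apply_def R_def)
  have kernel': "(\<forall>j\<in>J \<union> I0. \<forall>\<gamma>\<in>carrier \<Gamma>. mat_apply M' c j \<gamma> = 0) \<longleftrightarrow>
      (\<forall>j\<in>J. \<forall>\<gamma>\<in>carrier \<Gamma>. mat_apply M c j \<gamma> = 0) \<and> (\<forall>i\<in>I0. \<forall>\<gamma>\<in>carrier \<Gamma>. c i \<gamma> = 0)" for c
  proof -
    have "mat_apply M' c j = mat_apply M c j" if "j \<in> J" for j
      using that by (simp add: mat_apply_def M'_def fun_eq_iff)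
    moreover have "mat_apply M' c i = mat_apply R c i" if "i \<in> I0" for i
      using that I0 disj by (auto simp: mat_apply_def M'_def fun_eq_iff)
    ultimately show ?thesis by (simp add: ball_Un applyR)
  qed
  let ?k = "h (vector_group I) (kernel_shift I J M)"
  have "?k + h (vector_group J) (kernel_shift J I N) = card I"
    by (rule rank_eq[OF h M N exact_image[OF M N exact1]])
  moreover have "h (vector_group J) (kernel_shift J I N) + h (vector_group I) (kernel_shift I (J \<union> I0) M') = card J"
    by (rule rank_eq[OF h N M' exact_image[OF N M']]) (simp only: kernel' exact2)
  moreover have "?k = h (vector_group I) (kernel_shift I (J \<union> I0) M')"
  proof -
    have "automaton I I0 R ` kernel_shift I J M \<subseteq> (\<lambda>a. configuration I0 (\<lambda>i \<gamma>. a)) ` {0, 1}"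
    proof
      fix \<tau> assume "\<tau> \<in> automaton I I0 R ` kernel_shift I J M"
      then obtain c where c: "\<tau> = automaton I I0 R (configuration I c)" "configuration I c \<in> kernel_shift I J M"
        by (auto simp: kernel_shift_def kernel_def carrier_config_space)
      have "\<exists>a. \<forall>i\<in>I0. \<forall>\<gamma>\<in>carrier \<Gamma>. c i \<gamma> = a"
        by (rule const) (rule c(2)[unfolded configuration_in_kernel[OF M]])
      then obtain a where a: "\<forall>i\<in>I0. \<forall>\<gamma>\<in>carrier \<Gamma>. c i \<gamma> = a" ..
      have "\<tau> = configuration I0 (\<lambda>i \<gamma>. a)"
        unfolding c(1) automaton_configuration[OF R] configuration_eq_iff[OF fin(3)] using a by (simp add: applyR)
      moreover have "a \<in> {0, 1}" by (cases a) auto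
      ultimately show "\<tau> \<in> (\<lambda>a. configuration I0 (\<lambda>i \<gamma>. a)) ` {0, 1}" by blast
    qed
    then have finimg: "finite (automaton I I0 R ` kernel_shift I J M)" by (rule finite_subset) simp
    note sub = linear_subshift_kernel[OF M]
    note img = linear_subshift_finite_image[OF R sub finimg]
    have "kernel_shift I J M \<inter> kernel_shift I I0 R = kernel_shift I (J \<union> I0) M'"
    proof -
      have "configuration I c \<in> kernel_shift I J M \<inter> kernel_shift I I0 R \<longleftrightarrow> configuration I c \<in> kernel_shift I (J \<union> I0) M'" for c
        unfolding Int_iff configuration_in_kernel[OF M] configuration_in_kernel[OF R] configuration_in_kernel[OF M'] kernel'
        by (simp add: applyR)
      moreover have "kernel_shift I J' L \<subseteq> range (configuration I)" for J' :: "'i set" and L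
        by (auto simp: kernel_shift_def kernel_def carrier_config_space)
      ultimately show ?thesis by (intro set_eq_via_range[of _ "configuration I"] le_infI1)
    qed
    then show ?thesis
      using entropy_additive[OF h R sub img] entropy_finite[OF h img finimg] by simp
  qed
  ultimately show ?thesis by simp
qed

end

section \<open>The equivariant cochain complex\<close>

text \<open>The simplices of the triangulation of E over a simplex of K are indexed by the group, by means of the
vertex over their smallest vertex. In these coordinates the coboundary becomes a matrix
over the group ring.\<close>

context marked_cover
begin

sublocale bit_shifts \<Gamma> by (rule bit_shifts.intro[OF group])

definition leaf :: "nat set \<Rightarrow> 'g \<Rightarrow> linfty \<Rightarrow> linfty" where
  "leaf \<sigma> \<gamma> = sheet \<sigma> (mark (Min \<sigma>) \<gamma>)"

definition translate :: "nat set \<Rightarrow> 'g \<Rightarrow> linfty set" where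
  "translate \<sigma> \<gamma> = leaf \<sigma> \<gamma> ` vertex ` \<sigma>"

lemma Min_in_simplex: "\<sigma> \<in> K \<Longrightarrow> Min \<sigma> \<in> \<sigma>" "\<sigma> \<in> K \<Longrightarrow> {Min \<sigma>} \<in> K"
proof -
  assume s: "\<sigma> \<in> K"
  then show m: "Min \<sigma> \<in> \<sigma>" by (intro Min_in finite_simplex simplex_nonempty)
  show "{Min \<sigma>} \<in> K" by (rule face_in[OF s]) (use m in auto)
qed

lemma leaf:
  assumes s: "\<sigma> \<in> K" and g: "\<gamma> \<in> carrier \<Gamma>"
  shows "is_section \<sigma> (leaf \<sigma> \<gamma>)" "leaf \<sigma> \<gamma> (vertex (Min \<sigma>)) = mark (Min \<sigma>) \<gamma>"
proof -
  have "mark (Min \<sigma>) \<gamma> \<in> {e \<in> E. p e = vertex (Min \<sigma>)}"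
    using bij_betwE[OF mark_bij[OF Min_in_simplex(2)[OF s]]] g by blast
  then have m: "mark (Min \<sigma>) \<gamma> \<in> E" "p (mark (Min \<sigma>) \<gamma>) = vertex (Min \<sigma>)" by auto
  have "vertex (Min \<sigma>) \<in> cell \<sigma>" using Min_in_simplex(1)[OF s] finite_simplex[OF s] by simp
  then show "is_section \<sigma> (leaf \<sigma> \<gamma>)" "leaf \<sigma> \<gamma> (vertex (Min \<sigma>)) = mark (Min \<sigma>) \<gamma>"
    using sheet[OF s m(1)] m(2) by (simp_all add: leaf_def)
qed

lemma translate_lifted:
  assumes "\<sigma> \<in> K" "\<gamma> \<in> carrier \<Gamma>"
  shows "translate \<sigma> \<gamma> \<in> lifted" "shadow (translate \<sigma> \<gamma>) = \<sigma>" "card (translate \<sigma> \<gamma>) = card \<sigma>"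
proof -
  show 1: "translate \<sigma> \<gamma> \<in> lifted" unfolding translate_def by (rule lifted_section[OF leaf(1)[OF assms] assms(1)])
  show 2: "shadow (translate \<sigma> \<gamma>) = \<sigma>" unfolding translate_def by (rule shadow_section[OF leaf(1)[OF assms] assms(1)])
  show "card (translate \<sigma> \<gamma>) = card \<sigma>" using chart(4)[OF 1] 2 by simp
qed

lemma translate_inj:
  assumes s: "\<sigma> \<in> K" and g: "\<gamma> \<in> carrier \<Gamma>" "\<delta> \<in> carrier \<Gamma>" and eq: "translate \<sigma> \<gamma> = translate \<sigma> \<delta>"
  shows "\<gamma> = \<delta>"
proof -
  have c: "vertex (Min \<sigma>) \<in> cell \<sigma>" using Min_in_simplex(1)[OF s] finite_simplex[OF s] by simp
  have "mark (Min \<sigma>) \<gamma> = chart (translate \<sigma> \<gamma>) (vertex (Min \<sigma>))"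
    unfolding translate_def chart_section[OF leaf(1)[OF s g(1)] s c] leaf(2)[OF s g(1)] ..
  also have "\<dots> = chart (translate \<sigma> \<delta>) (vertex (Min \<sigma>))" by (simp only: eq)
  also have "\<dots> = mark (Min \<sigma>) \<delta>"
    unfolding translate_def chart_section[OF leaf(1)[OF s g(2)] s c] leaf(2)[OF s g(2)] ..
  finally show ?thesis
    using mark_bij[OF Min_in_simplex(2)[OF s]] g by (auto simp: bij_betw_def dest: inj_onD)
qed

lemma translate_surj:
  assumes A: "A \<in> lifted"
  obtains \<gamma> where "\<gamma> \<in> carrier \<Gamma>" "A = translate (shadow A) \<gamma>"
proof -
  let ?s = "shadow A"
  note c = chart[OF A]
  note m = Min_in_simplex[OF c(1)]
  have cell: "vertex v \<in> cell ?s" if "v \<in> ?s" for v using that finite_simplex[OF c(1)] by simp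
  have "chart A (vertex (Min ?s)) \<in> {e \<in> E. p e = vertex (Min ?s)}"
    using section_vertex[OF c(2,1) m(1)] by simp
  then have "chart A (vertex (Min ?s)) \<in> mark (Min ?s) ` carrier \<Gamma>"
    using bij_betw_imp_surj_on[OF mark_bij[OF m(2)]] by simp
  then obtain \<gamma> where g: "\<gamma> \<in> carrier \<Gamma>" "chart A (vertex (Min ?s)) = mark (Min ?s) \<gamma>" by blast
  have "leaf ?s \<gamma> (vertex v) = chart A (vertex v)" if "v \<in> ?s" for v
    unfolding leaf_def g(2)[symmetric]
    by (rule sheet_eq_section[OF c(2) subset_refl c(1) cell[OF m(1)] cell[OF that] simplex_nonempty[OF c(1)]])
  then have "translate ?s \<gamma> = chart A ` vertex ` ?s"
    unfolding translate_def image_image by (intro image_cong refl)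
  then show thesis using that[OF g(1)] c(3) by simp
qed

text \<open>Deleting the smallest vertex of a simplex moves the base vertex, and then the index of the face differs
from that of the simplex; in all other cases the transition element acts as the identity.\<close>

definition transition :: "nat set \<Rightarrow> nat \<Rightarrow> 'g" where
  "transition \<sigma> v = (SOME g. g \<in> carrier \<Gamma> \<and>
     (\<forall>\<gamma>\<in>carrier \<Gamma>. leaf \<sigma> \<gamma> (vertex (Min (\<sigma> - {v}))) = mark (Min (\<sigma> - {v})) (g \<otimes> \<gamma>)))"

lemma face_nonempty:
  assumes "2 \<le> card \<sigma>"
  shows "\<sigma> - {v} \<noteq> {}"
proof
  assume "\<sigma> - {v} = {}"
  then have "card \<sigma> \<le> card {v}" by (intro card_mono) auto
  then show False using assms by simp
qed

lemma face_simplex: "\<sigma> \<in> K \<Longrightarrow> 2 \<le> card \<sigma> \<Longrightarrow> \<sigma> - {v} \<in> K"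
  by (rule face_in[OF _ Diff_subset face_nonempty])

lemma transition:
  assumes "\<sigma> \<in> K" "2 \<le> card \<sigma>"
  shows "transition \<sigma> v \<in> carrier \<Gamma>"
    "\<gamma> \<in> carrier \<Gamma> \<Longrightarrow> leaf \<sigma> \<gamma> (vertex (Min (\<sigma> - {v}))) = mark (Min (\<sigma> - {v})) (transition \<sigma> v \<otimes> \<gamma>)"
proof -
  have m: "Min (\<sigma> - {v}) \<in> \<sigma>" using Min_in_simplex(1)[OF face_simplex[OF assms, of v]] by blast
  obtain g where g: "g \<in> carrier \<Gamma>"
    "\<And>\<gamma>. \<gamma> \<in> carrier \<Gamma> \<Longrightarrow> sheet \<sigma> (mark (Min \<sigma>) \<gamma>) (vertex (Min (\<sigma> - {v}))) = mark (Min (\<sigma> - {v})) (g \<otimes> \<gamma>)"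
    by (rule mark_transition[OF assms(1) Min_in_simplex(1)[OF assms(1)] m]) (rule that)
  have "\<exists>g. g \<in> carrier \<Gamma> \<and>
     (\<forall>\<gamma>\<in>carrier \<Gamma>. leaf \<sigma> \<gamma> (vertex (Min (\<sigma> - {v}))) = mark (Min (\<sigma> - {v})) (g \<otimes> \<gamma>))"
    unfolding leaf_def by (intro exI[of _ g] conjI ballI g)
  from someI_ex[OF this] show "transition \<sigma> v \<in> carrier \<Gamma>"
    "\<gamma> \<in> carrier \<Gamma> \<Longrightarrow> leaf \<sigma> \<gamma> (vertex (Min (\<sigma> - {v}))) = mark (Min (\<sigma> - {v})) (transition \<sigma> v \<otimes> \<gamma>)"
    unfolding transition_def[symmetric] by simp_all
qed

lemma translate_face:
  assumes s: "\<sigma> \<in> K" "2 \<le> card \<sigma>" and g: "\<gamma> \<in> carrier \<Gamma>" and v: "v \<in> \<sigma>"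
  shows "translate \<sigma> \<gamma> - {leaf \<sigma> \<gamma> (vertex v)} = translate (\<sigma> - {v}) (transition \<sigma> v \<otimes> \<gamma>)"
proof -
  let ?t = "\<sigma> - {v}" and ?f = "leaf \<sigma> \<gamma>"
  note t = face_simplex[OF s, of v]
  have cell: "vertex w \<in> cell ?t" if "w \<in> ?t" for w using that finite_simplex[OF t] by simp
  have "leaf ?t (transition \<sigma> v \<otimes> \<gamma>) (vertex w) = ?f (vertex w)" if "w \<in> ?t" for w
    unfolding leaf_def[of ?t] transition(2)[OF s g, symmetric]
    by (rule sheet_eq_section[OF leaf(1)[OF s(1) g] Diff_subset s(1) cell[OF Min_in_simplex(1)[OF t]]
          cell[OF that] simplex_nonempty[OF t]])
  then have "translate ?t (transition \<sigma> v \<otimes> \<gamma>) = (\<lambda>w. ?f (vertex w)) ` (\<sigma> - {v})"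
    unfolding translate_def image_image by (intro image_cong refl)
  also have "\<dots> = (\<lambda>w. ?f (vertex w)) ` \<sigma> - (\<lambda>w. ?f (vertex w)) ` {v}"
    by (rule inj_on_image_set_diff[OF inj_section[OF leaf(1)[OF s(1) g] s(1)]]) (use v in auto)
  finally show ?thesis by (simp add: translate_def image_image)
qed

text \<open>Facets of vertices are excluded: the empty simplex of the augmented complex is invariant under the
group and has no free orbit.\<close>

definition incidence :: "nat set \<Rightarrow> (nat set \<times> 'g) set" where
  "incidence \<sigma> = (if 2 \<le> card \<sigma> then (\<lambda>v. (\<sigma> - {v}, transition \<sigma> v)) ` \<sigma> else {})"

lemma simplex_card: "\<sigma> \<in> K \<Longrightarrow> \<not> 2 \<le> card \<sigma> \<Longrightarrow> card \<sigma> = 1"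
  using finite_simplex[of \<sigma>] simplex_nonempty[of \<sigma>] card_gt_0_iff[of \<sigma>] by linarith

text \<open>The condition u {} = 0 compensates for the missing augmentation in the incidence matrix.\<close>

lemma incidence_is_coboundary:
  assumes s: "\<sigma> \<in> K" and g: "\<gamma> \<in> carrier \<Gamma>" and u0: "u {} = 0"
    and c: "\<And>v \<gamma>. v \<in> \<sigma> \<Longrightarrow> 2 \<le> card \<sigma> \<Longrightarrow> \<gamma> \<in> carrier \<Gamma> \<Longrightarrow> c (\<sigma> - {v}) \<gamma> = u (translate (\<sigma> - {v}) \<gamma>)"
  shows "mat_apply incidence c \<sigma> \<gamma> = cobound u (translate \<sigma> \<gamma>)"
proof (cases "2 \<le> card \<sigma>")
  case True
  have "inj_on (\<lambda>v. (\<sigma> - {v}, transition \<sigma> v)) \<sigma>" by (auto simp: inj_on_def)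
  then have "mat_apply incidence c \<sigma> \<gamma> = (\<Sum>v\<in>\<sigma>. c (\<sigma> - {v}) (transition \<sigma> v \<otimes> \<gamma>))"
    using True by (simp add: mat_apply_def incidence_def sum.reindex)
  also have "\<dots> = (\<Sum>v\<in>\<sigma>. u (translate \<sigma> \<gamma> - {leaf \<sigma> \<gamma> (vertex v)}))"
  proof (intro sum.cong refl)
    fix v assume v: "v \<in> \<sigma>"
    have "transition \<sigma> v \<otimes> \<gamma> \<in> carrier \<Gamma>"
      using transition(1)[OF s True] g group by (simp add: group.is_monoid monoid.m_closed)
    then show "c (\<sigma> - {v}) (transition \<sigma> v \<otimes> \<gamma>) = u (translate \<sigma> \<gamma> - {leaf \<sigma> \<gamma> (vertex v)})"
      using c[OF v True] translate_face[OF s True g v] by simp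
  qed
  also have "\<dots> = (\<Sum>a\<in>(\<lambda>v. leaf \<sigma> \<gamma> (vertex v)) ` \<sigma>. u (translate \<sigma> \<gamma> - {a}))"
    using inj_section[OF leaf(1)[OF s g] s] by (simp add: sum.reindex)
  finally show ?thesis by (simp add: cobound_def translate_def image_image)
next
  case False
  then have "card (translate \<sigma> \<gamma>) = 1" using simplex_card[OF s] translate_lifted(3)[OF s g] by simp
  then obtain a where "translate \<sigma> \<gamma> = {a}" by (auto simp: card_1_singleton_iff)
  then show ?thesis using False u0 by (simp add: mat_apply_def incidence_def cobound_def)
qed

definition label :: "linfty set \<Rightarrow> 'g" where
  "label A = (SOME \<gamma>. \<gamma> \<in> carrier \<Gamma> \<and> A = translate (shadow A) \<gamma>)"

lemma label_translate:
  assumes "\<sigma> \<in> K" "\<gamma> \<in> carrier \<Gamma>"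
  shows "label (translate \<sigma> \<gamma>) = \<gamma>"
proof -
  have "\<exists>\<delta>. \<delta> \<in> carrier \<Gamma> \<and> translate \<sigma> \<gamma> = translate (shadow (translate \<sigma> \<gamma>)) \<delta>"
    using translate_lifted(2)[OF assms] assms(2) by auto
  from someI_ex[OF this] show ?thesis
    using translate_inj[OF assms(1) _ assms(2)] translate_lifted(2)[OF assms] unfolding label_def by metis
qed

definition on_lifted :: "(nat set \<Rightarrow> 'g \<Rightarrow> bit) \<Rightarrow> linfty set \<Rightarrow> bit" where
  "on_lifted c A = (if A \<in> lifted then c (shadow A) (label A) else 0)"

lemma on_lifted_translate: "\<sigma> \<in> K \<Longrightarrow> \<gamma> \<in> carrier \<Gamma> \<Longrightarrow> on_lifted c (translate \<sigma> \<gamma>) = c \<sigma> \<gamma>"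
  by (simp add: on_lifted_def translate_lifted label_translate)

lemma on_lifted_empty: "on_lifted c {} = 0"
  using lifted_finite by (auto simp: on_lifted_def)

lemma card_face: "v \<in> \<sigma> \<Longrightarrow> 2 \<le> card \<sigma> \<Longrightarrow> odd (card (\<sigma> - {v})) \<longleftrightarrow> even (card \<sigma>)"
  by (cases "card \<sigma>") (auto simp: card_Diff_singleton_if)

text \<open>The cochain c is cut off to the degrees of the parity par. Its coboundary then vanishes in all degrees:
in those of the other parity by assumption, in those of the same parity because no facet
contributes.\<close>

lemma integrate_cocycle:
  assumes contr: "contractible E"
    and cocycle: "\<And>\<sigma> \<gamma>. \<sigma> \<in> K \<Longrightarrow> odd (card \<sigma>) \<noteq> par \<Longrightarrow> \<gamma> \<in> carrier \<Gamma> \<Longrightarrow> mat_apply incidence c \<sigma> \<gamma> = 0"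
  obtains b where "\<And>\<sigma> \<gamma>. \<sigma> \<in> K \<Longrightarrow> \<gamma> \<in> carrier \<Gamma> \<Longrightarrow>
     cobound b (translate \<sigma> \<gamma>) = (if odd (card \<sigma>) = par then c \<sigma> \<gamma> else 0)"
proof -
  define c' where "c' \<sigma> \<gamma> = (if odd (card \<sigma>) = par then c \<sigma> \<gamma> else 0)" for \<sigma> \<gamma>
  have triv: "homologically_trivial lifted"
    by (rule homologically_trivial_lifted[OF contr]) (use e0 in blast)
  have cob: "cobound (on_lifted c') A = 0" if A: "A \<in> lifted" "2 \<le> card A" for A
  proof -
    obtain \<gamma> where g: "\<gamma> \<in> carrier \<Gamma>" "A = translate (shadow A) \<gamma>" using translate_surj[OF A(1)] .
    let ?s = "shadow A"
    note s = chart(1)[OF A(1)]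
    have 2: "2 \<le> card ?s" using A(2) chart(4)[OF A(1)] by simp
    have "cobound (on_lifted c') A = mat_apply incidence c' ?s \<gamma>"
      by (subst g(2), rule incidence_is_coboundary[where u = "on_lifted c'", OF s g(1) on_lifted_empty, symmetric])
         (simp add: on_lifted_translate face_simplex[OF s])
    also have "\<dots> = 0"
    proof (cases "odd (card ?s) = par")
      case True
      then have "c' (?s - {v}) \<delta> = 0" if "v \<in> ?s" for v \<delta>
        using card_face[OF that 2] by (auto simp: c'_def)
      then show ?thesis using 2 by (auto simp: mat_apply_def incidence_def intro!: sum.neutral)
    next
      case False
      then have "c' (?s - {v}) \<delta> = c (?s - {v}) \<delta>" if "v \<in> ?s" for v \<delta>
        using card_face[OF that 2] by (auto simp: c'_def)
      then have "mat_apply incidence c' ?s \<gamma> = mat_apply incidence c ?s \<gamma>"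
        using 2 by (auto simp: mat_apply_def incidence_def intro!: sum.cong)
      then show ?thesis using cocycle[OF s False g(1)] by simp
    qed
    finally show ?thesis .
  qed
  obtain b where b: "\<And>A. A \<in> lifted \<Longrightarrow> cobound b A = on_lifted c' A"
    by (rule cocycle_is_coboundary[OF triv, of "on_lifted c'"]) (use cob lifted_finite in auto)
  show thesis
  proof (rule that[of b])
    fix \<sigma> \<gamma> assume "\<sigma> \<in> K" "\<gamma> \<in> carrier \<Gamma>"
    then show "cobound b (translate \<sigma> \<gamma>) = (if odd (card \<sigma>) = par then c \<sigma> \<gamma> else 0)"
      by (simp add: b translate_lifted on_lifted_translate c'_def)
  qed
qed

lemma cobound_vertex:
  assumes "\<sigma> \<in> K" "card \<sigma> = 1" "\<gamma> \<in> carrier \<Gamma>"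
  shows "cobound b (translate \<sigma> \<gamma>) = b {}"
proof -
  have "card (translate \<sigma> \<gamma>) = 1" using translate_lifted(3)[OF assms(1,3)] assms(2) by simp
  then obtain a where "translate \<sigma> \<gamma> = {a}" by (auto simp: card_1_singleton_iff)
  then show ?thesis by (simp add: cobound_def)
qed

lemma incidence_incidence:
  assumes s: "\<sigma> \<in> K" and g: "\<gamma> \<in> carrier \<Gamma>"
    and c: "\<And>\<tau> \<gamma>. \<tau> \<in> K \<Longrightarrow> odd (card \<tau>) \<longleftrightarrow> even (card \<sigma>) \<Longrightarrow> \<gamma> \<in> carrier \<Gamma> \<Longrightarrow> c \<tau> \<gamma> = mat_apply incidence b \<tau> \<gamma>"
  shows "mat_apply incidence c \<sigma> \<gamma> = 0"
proof -
  have "mat_apply incidence c \<sigma> \<gamma> = cobound (cobound (on_lifted b)) (translate \<sigma> \<gamma>)"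
  proof (rule incidence_is_coboundary[OF s g])
    fix v \<delta> assume v: "v \<in> \<sigma>" "2 \<le> card \<sigma>" "\<delta> \<in> carrier \<Gamma>"
    have t: "\<sigma> - {v} \<in> K" by (rule face_simplex[OF s v(2)])
    have "c (\<sigma> - {v}) \<delta> = mat_apply incidence b (\<sigma> - {v}) \<delta>"
      by (rule c[OF t card_face[OF v(1,2)] v(3)])
    also have "\<dots> = cobound (on_lifted b) (translate (\<sigma> - {v}) \<delta>)"
      by (rule incidence_is_coboundary[where u = "on_lifted b", OF t v(3) on_lifted_empty])
         (simp add: on_lifted_translate face_simplex[OF t])
    finally show "c (\<sigma> - {v}) \<delta> = cobound (on_lifted b) (translate (\<sigma> - {v}) \<delta>)" .
  qed (simp add: cobound_def)
  also have "\<dots> = 0"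
    by (rule cobound_cobound) (use lifted_finite translate_lifted(1)[OF s g] in blast)
  finally show ?thesis .
qed

text \<open>A primitive in the augmented complex comes from one in the complex itself if its value at the
empty simplex is 0. This value is the common value on the vertices of the part of c of parity par:
it is 0 if that part does not involve vertices, and otherwise one value of c on a vertex
decides.\<close>

lemma primitive_of_cocycle:
  assumes contr: "contractible E" and v: "{v} \<in> K"
    and cocycle: "\<And>\<sigma> \<gamma>. \<sigma> \<in> K \<Longrightarrow> odd (card \<sigma>) \<noteq> par \<Longrightarrow> \<gamma> \<in> carrier \<Gamma> \<Longrightarrow> mat_apply incidence c \<sigma> \<gamma> = 0"
    and zero: "par \<Longrightarrow> \<gamma>0 \<in> carrier \<Gamma> \<and> c {v} \<gamma>0 = 0"
  obtains b where "\<And>\<sigma> \<gamma>. \<sigma> \<in> K \<Longrightarrow> odd (card \<sigma>) = par \<Longrightarrow> \<gamma> \<in> carrier \<Gamma> \<Longrightarrow> c \<sigma> \<gamma> = mat_apply incidence b \<sigma> \<gamma>"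
proof -
  obtain b where b: "\<And>\<sigma> \<gamma>. \<sigma> \<in> K \<Longrightarrow> \<gamma> \<in> carrier \<Gamma> \<Longrightarrow>
     cobound b (translate \<sigma> \<gamma>) = (if odd (card \<sigma>) = par then c \<sigma> \<gamma> else 0)"
    by (rule integrate_cocycle[OF contr, of par c]) (rule cocycle, assumption+, rule that)
  have one: "\<one> \<in> carrier \<Gamma>" using group by (simp add: group.is_monoid monoid.one_closed)
  have b0: "b {} = 0"
  proof (cases par)
    case True
    then show ?thesis using cobound_vertex[OF v _, of \<gamma>0 b] b[OF v, of \<gamma>0] zero by simp
  next
    case False
    then show ?thesis using cobound_vertex[OF v _ one, of b] b[OF v one] by simp
  qed
  show thesis
  proof (rule that[of "\<lambda>\<sigma> \<gamma>. b (translate \<sigma> \<gamma>)"])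
    fix \<sigma> \<gamma> assume s: "\<sigma> \<in> K" "odd (card \<sigma>) = par" "\<gamma> \<in> carrier \<Gamma>"
    then show "c \<sigma> \<gamma> = mat_apply incidence (\<lambda>\<sigma> \<gamma>. b (translate \<sigma> \<gamma>)) \<sigma> \<gamma>"
      using incidence_is_coboundary[where u = b, OF s(1,3) b0, of "\<lambda>\<sigma> \<gamma>. b (translate \<sigma> \<gamma>)"] b[OF s(1,3)] by simp
  qed
qed

text \<open>Cells of even dimension have an odd number of vertices. On cocycles of even degree the values on
vertices are constant: they are the value of a primitive at the empty simplex.\<close>

theorem entropy_imp_euler_characteristic_0:
  assumes contr: "contractible E" and h: "entropy \<Gamma> h"
  shows "complex_euler_characteristic K = 0"
proof -
  define I where "I = {\<sigma> \<in> K. odd (card \<sigma>)}"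
  define J where "J = {\<sigma> \<in> K. even (card \<sigma>)}"
  define I0 where "I0 = {\<sigma> \<in> K. card \<sigma> = 1}"
  have finK: "finite K" using complex by (simp add: finite_simplicial_complex_def)
  have m: "finite (incidence \<sigma>)" "incidence \<sigma> \<subseteq> {\<tau> \<in> K. odd (card \<tau>) \<longleftrightarrow> even (card \<sigma>)} \<times> carrier \<Gamma>"
    if "\<sigma> \<in> K" for \<sigma>
    using finite_simplex[OF that] card_face face_simplex[OF that] transition(1)[OF that]
    by (auto simp: incidence_def)
  have M: "matrix I J incidence"
    unfolding matrix_def using finK m by (fastforce simp: I_def J_def)
  have N: "matrix J I incidence"
    unfolding matrix_def using finK m by (fastforce simp: I_def J_def)
  have ne: "supp x0 \<in> K" using covered_supp(1)[OF e0] pe0 by simp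
  define v where "v = Min (supp x0)"
  have v: "{v} \<in> K" unfolding v_def by (rule Min_in_simplex(2)[OF ne])
  have one: "\<one> \<in> carrier \<Gamma>" using group by (simp add: group.is_monoid monoid.one_closed)
  have "card I = card J"
  proof (rule exact_pair_card_eq[OF h M N, of I0])
    show "I0 \<subseteq> I" "I \<inter> J = {}" by (auto simp: I_def J_def I0_def)
  next
    fix c :: "nat set \<Rightarrow> 'g \<Rightarrow> bit"
    show "(\<forall>i\<in>I. \<forall>\<gamma>\<in>carrier \<Gamma>. mat_apply incidence c i \<gamma> = 0) \<longleftrightarrow>
         (\<exists>b. \<forall>j\<in>J. \<forall>\<gamma>\<in>carrier \<Gamma>. c j \<gamma> = mat_apply incidence b j \<gamma>)" (is "?l \<longleftrightarrow> ?r")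
    proof
      assume ?l
      then obtain b where "\<And>\<sigma> \<gamma>. \<sigma> \<in> K \<Longrightarrow> odd (card \<sigma>) = False \<Longrightarrow> \<gamma> \<in> carrier \<Gamma> \<Longrightarrow> c \<sigma> \<gamma> = mat_apply incidence b \<sigma> \<gamma>"
        using primitive_of_cocycle[OF contr v, of False c] by (auto simp: I_def)
      then show ?r by (auto simp: J_def)
    next
      assume ?r
      then show ?l by (auto simp: I_def J_def intro!: incidence_incidence)
    qed
  next
    fix c :: "nat set \<Rightarrow> 'g \<Rightarrow> bit"
    show "(\<forall>j\<in>J. \<forall>\<gamma>\<in>carrier \<Gamma>. mat_apply incidence c j \<gamma> = 0) \<and> (\<forall>i\<in>I0. \<forall>\<gamma>\<in>carrier \<Gamma>. c i \<gamma> = 0) \<longleftrightarrow>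
         (\<exists>b. \<forall>i\<in>I. \<forall>\<gamma>\<in>carrier \<Gamma>. c i \<gamma> = mat_apply incidence b i \<gamma>)" (is "?l \<longleftrightarrow> ?r")
    proof
      assume l: ?l
      then have "c {v} \<one> = 0" using v one by (auto simp: I0_def)
      with l obtain b where "\<And>\<sigma> \<gamma>. \<sigma> \<in> K \<Longrightarrow> odd (card \<sigma>) = True \<Longrightarrow> \<gamma> \<in> carrier \<Gamma> \<Longrightarrow> c \<sigma> \<gamma> = mat_apply incidence b \<sigma> \<gamma>"
        using primitive_of_cocycle[OF contr v, of True c \<one>] one by (auto simp: J_def)
      then show ?r by (auto simp: I_def)
    next
      assume r: ?r
      then have "mat_apply incidence c j \<gamma> = 0" if "j \<in> J" "\<gamma> \<in> carrier \<Gamma>" for j \<gamma>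
        using that by (auto simp: I_def J_def intro!: incidence_incidence)
      moreover have "c i \<gamma> = 0" if "i \<in> I0" "\<gamma> \<in> carrier \<Gamma>" for i \<gamma>
        using r that by (auto simp: I_def I0_def mat_apply_def incidence_def)
      ultimately show ?l by blast
    qed
  next
    fix c :: "nat set \<Rightarrow> 'g \<Rightarrow> bit"
    assume "\<forall>j\<in>J. \<forall>\<gamma>\<in>carrier \<Gamma>. mat_apply incidence c j \<gamma> = 0"
    then obtain b where b: "\<And>\<sigma> \<gamma>. \<sigma> \<in> K \<Longrightarrow> \<gamma> \<in> carrier \<Gamma> \<Longrightarrow>
       cobound b (translate \<sigma> \<gamma>) = (if odd (card \<sigma>) = True then c \<sigma> \<gamma> else 0)"
      using integrate_cocycle[OF contr, of True c] by (auto simp: J_def)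
    have "c i \<gamma> = b {}" if "i \<in> I0" "\<gamma> \<in> carrier \<Gamma>" for i \<gamma>
      using that b[of i \<gamma>] cobound_vertex[of i \<gamma> b] by (simp add: I0_def)
    then show "\<exists>a. \<forall>i\<in>I0. \<forall>\<gamma>\<in>carrier \<Gamma>. c i \<gamma> = a" by blast
  qed
  moreover have "complex_euler_characteristic K = int (card I) - int (card J)"
  proof -
    have "complex_euler_characteristic K = (\<Sum>s\<in>I \<union> J. (- 1) ^ (card s - 1))"
      unfolding complex_euler_characteristic_def by (rule sum.cong) (auto simp: I_def J_def)
    also have "\<dots> = (\<Sum>s\<in>I. (- 1) ^ (card s - 1)) + (\<Sum>s\<in>J. (- 1) ^ (card s - 1))"
      by (rule sum.union_disjoint) (use finK in \<open>auto simp: I_def J_def\<close>)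
    also have "(\<Sum>s\<in>I. (- 1) ^ (card s - 1)) = (\<Sum>s\<in>I. (1::int))"
      by (intro sum.cong refl) (auto simp: I_def)
    also have "(\<Sum>s\<in>J. (- 1) ^ (card s - 1)) = (\<Sum>s\<in>J. (- 1::int))"
    proof (intro sum.cong refl)
      fix s assume s: "s \<in> J"
      then have "card s \<noteq> 0" using finite_simplex simplex_nonempty by (auto simp: J_def)
      then show "(- 1) ^ (card s - 1) = (- 1::int)" using s by (auto simp: J_def)
    qed
    finally show ?thesis by simp
  qed
  ultimately show ?thesis by simp
qed

end

theorem theorem1:
  fixes \<Gamma> :: "('g, 'm) monoid_scheme"
  assumes "group \<Gamma>"
    and "finite_type \<Gamma>"
    and "euler_characteristic \<Gamma> \<noteq> 0"
  shows "\<not> SEA \<Gamma>"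
proof
  assume "SEA \<Gamma>"
  then obtain h where h: "entropy \<Gamma> h" by (auto simp: SEA_def)
  define K where "K = (SOME K. classifying_complex \<Gamma> K)"
  have "\<exists>K. classifying_complex \<Gamma> K" using assms(2) by (simp add: finite_type_def)
  then have K: "classifying_complex \<Gamma> K" unfolding K_def by (rule someI_ex)
  then obtain x E p where fin: "finite_simplicial_complex K" and x: "x \<in> realization K"
    and iso: "\<Gamma> \<cong> fundamental_group (realization K) x"
    and E: "universal_cover E p (realization K)" "contractible (E :: linfty set)"
    unfolding classifying_complex_def by blast
  have "p ` E = realization K"
    using E(1) covering_space_imp_surjective[of E p] by (simp add: universal_cover_def)
  with x have "x \<in> p ` E" by simp
  then obtain e where e: "e \<in> E" "p e = x" by auto
  obtain \<Phi> where \<Phi>: "\<Phi> \<in> iso \<Gamma> (fundamental_group (realization K) x)"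
    using iso by (auto simp: is_iso_def)
  interpret marked_cover K E p \<Gamma> x e \<Phi>
    by (intro marked_cover.intro covered_complex.intro marked_cover_axioms.intro) (use fin E(1) assms(1) e \<Phi> in \<open>auto simp: universal_cover_def\<close>)
  have "complex_euler_characteristic K = 0" by (rule entropy_imp_euler_characteristic_0[OF E(2) h])
  then show False using assms(3) by (simp add: euler_characteristic_def K_def)
qed

end
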